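(* Let $(\mathcal M,\otimes_{\mathcal M},1)$ be a $\mathbf{k}$-linear monoidal abelian category and let $\mathcal C:(\mathcal M,\otimes_{\mathcal M},1)\to(\mathrm{BiCom}_{\mathbf k},\otimes,\underline{\mathbf k})$ be a bicomplex lax monoidal functor. Then the two spectral sequences induced by the standard column and row filtrations are functorial multiplicative spectral sequences, and they converge multiplicatively to $\mathrm H(\operatorname{Tot}(\mathcal C))$.
   Context: $\mathbf{k}$ is a field, $\otimes=\otimes_{\mathbf k}$, and $\mathrm{Vect}_{\mathbf k}$ is the category of $\mathbf{k}$-vector spaces. **Bicomplex lax monoidal functors.** A bicomplex is a bigraded vector space $E^{*,*}=\{E^{p,q}\}_{p,q\in\mathbb Z}$ with $d_h$ of degree $(1,0)$ and $d_v$ of degree $(0,1)$, $d_h^2=d_v^2=d_hd_v+d_vd_h=0$. The category $\mathrm{BiCom}_{\mathbf k}$ of bicomplexes (morphisms: bigraded maps of degree $(0,0)$ commuting with both differentials) is monoidal under the bigraded tensor product with $d_h(v\otimes w)=d_hv\otimes w+(-1)^{p+q}v\otimes d_hw$ for $v\in E^{p,q}$, and similarly $d_v$; the unit $\underline{\mathbf k}$ is $\mathbf{k}$ in bidegree $(0,0)$ with zero differentials. A bicomplex lax monoidal functor $\mathcal C$ is a lax monoidal functor $\mathcal M\to\mathrm{BiCom}_{\mathbf k}$: additive functors $\mathcal C^{p,q}:\mathcal M\to\mathrm{Vect}_{\mathbf k}$ ($p,q\in\mathbb Z$) with natural $d_h,d_v$ making each $\mathcal C(M)$ a bicomplex, and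 natural, associative, unital exterior products $\mathcal C^{p,q}(M)\otimes\mathcal C^{u,v}(N)\to\mathcal C^{p+u,q+v}(M\otimes_{\mathcal M}N)$ satisfying the Leibniz rule (sign $(-1)^{p+q}$) for both $d_h$ and $d_v$. $\operatorname{Tot}(\mathcal C)^n=\bigoplus_{p+q=n}\mathcal C^{p,q}$ with differential $d_h+d_v$ and the induced exterior product; its column (resp. row) filtration is $\mathcal F^s\operatorname{Tot}(\mathcal C)^n=\bigoplus_{p+q=n,\ p\ge s}\mathcal C^{p,q}$ (resp. $q\ge s$), and $\mathrm H(\operatorname{Tot}(\mathcal C))$ carries the induced product and filtration. **Functorial multiplicative spectral sequences.** - A *differential bigraded lax monoidal functor of degree $(r,-r+1)$* is a family of additive functors $\mathcal E^{p,q}:\mathcal M\to\mathrm{Vect}_{\mathbf k}$ ($p,q\in\mathbb Z$) with natural, associative exterior products $\times:\mathcal E^{p,q}(M)\otimes\mathcal E^{u,v}(N)\to\mathcal E^{p+u,q+v}(M\otimes_{\mathcal M}N)$, a unit $\mathbf{k}\to\mathcal E^{0,0}(1)$ satisfying the usual unitality and compatible with differentials, and natural differentials $d:\mathcal E^{p,q}\to\mathcal E^{p+r,q-r+1}$, $d^2=0$, with $d(x\times y)=dx\times y+(-1)^{p+q}x\times dy$ for $x\in\mathcal E^{p,q}(M)$. - A *functorial multiplicative spectral sequence* starting from $a\in\mathbb Z$ is a family $\{(\mathcal E_r,\times_r,d_r)\}_{r\ge a}$ of such functors, $\mathcal E_r$ of degree $(r,-r+1)$, with natural bigraded isomorphisms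 $\mathrm H^{*,*}(\mathcal E_r,d_r)\cong\mathcal E_{r+1}$ identifying the lax monoidal structure induced from $\times_r$ on cohomology with that of $\mathcal E_{r+1}$ (so that each $\{(\mathcal E_r(M),d_r(M))\}_{r\ge a}$ is a spectral sequence). - As usual, there are subfunctors $\mathcal B_r\subseteq\mathcal Z_r$ of $\mathcal E_a$ with $\mathcal E_{r+1}\cong\mathcal Z_r/\mathcal B_r$; put $\mathcal E_\infty=\bigcap_r\mathcal Z_r/\bigcup_r\mathcal B_r$, with the induced product $\times_\infty$. - A *filtered graded lax monoidal functor* is a family of additive functors $\mathcal H^n:\mathcal M\to\mathrm{Vect}_{\mathbf k}$ ($n\in\mathbb Z$) with natural associative unital exterior products $\mathcal H^m(M)\otimes\mathcal H^n(N)\to\mathcal H^{m+n}(M\otimes_{\mathcal M}N)$ and decreasing exhaustive Hausdorff filtrations by subfunctors $\mathcal F^p\mathcal H^n$ with $\mathcal F^p\times\mathcal F^q\subseteq\mathcal F^{p+q}$ (and the unit in $\mathcal F^0$). - The spectral sequence *converges multiplicatively* to a filtered graded lax monoidal functor $\mathcal H$ if there are natural isomorphisms $\mathcal E^{p,q}_\infty\cong\mathcal F^p\mathcal H^{p+q}/\mathcal F^{p+1}\mathcal H^{p+q}$ carrying $\times_\infty$ to the product induced on $\mathrm{Gr}_{\mathcal F}(\mathcal H)$.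
   Formalization: Convergence to H(Tot(C)) fails for general bicomplexes with direct-sum Tot; it is stated for the column (resp. row) filtration only when, for each M and n, C^{p,n-p}(M)=0 for p large (resp. C^{n-q,q}(M)=0 for q large). *)

theory Defs
  imports "HOL-Algebra.Module" "HOL-Algebra.AbelCoset" "HOL-Library.Product_Plus"
begin

section \<open>Vector spaces\<close>

text \<open>
  Vector spaces over a field \<open>k\<close> are HOL-Algebra modules over \<open>k\<close>; the fields \<open>mult\<close> and \<open>one\<close>,
  which module records inherit from ring records, are never used.
  A linear map out of a tensor product is represented by the corresponding bilinear map.
\<close>

definition linear_map ::
  "('k, 'r) ring_scheme \<Rightarrow> ('k, 'v) module \<Rightarrow> ('k, 'w) module \<Rightarrow> ('v \<Rightarrow> 'w) \<Rightarrow> bool" where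
  "linear_map k V W f \<longleftrightarrow>
     f \<in> carrier V \<rightarrow> carrier W \<and>
     (\<forall>x\<in>carrier V. \<forall>y\<in>carrier V. f (x \<oplus>\<^bsub>V\<^esub> y) = f x \<oplus>\<^bsub>W\<^esub> f y) \<and>
     (\<forall>a\<in>carrier k. \<forall>x\<in>carrier V. f (a \<odot>\<^bsub>V\<^esub> x) = a \<odot>\<^bsub>W\<^esub> f x)"

definition bilinear_map ::
  "('k, 'r) ring_scheme \<Rightarrow> ('k, 'u) module \<Rightarrow> ('k, 'v) module \<Rightarrow> ('k, 'w) module
    \<Rightarrow> ('u \<Rightarrow> 'v \<Rightarrow> 'w) \<Rightarrow> bool" where
  "bilinear_map k U V W b \<longleftrightarrow>
     (\<forall>x\<in>carrier U. linear_map k V W (b x)) \<and>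
     (\<forall>y\<in>carrier V. linear_map k U W (\<lambda>x. b x y))"

text \<open>
  The subquotient \<open>Z / B\<close> of a vector space, for subspaces \<open>B \<subseteq> Z\<close>. As everywhere below, an operation
  on cosets is the union of the cosets of its values on representatives.
\<close>

definition subquotient_space ::
  "('k, 'v) module \<Rightarrow> 'v set \<Rightarrow> 'v set \<Rightarrow> ('k, 'v set) module" where
  "subquotient_space V Z B =
     \<lparr>carrier = {x <+\<^bsub>V\<^esub> B | x. x \<in> Z}, mult = undefined, one = undefined,
      zero = B, add = (\<lambda>X Y. \<Union>x\<in>X. \<Union>y\<in>Y. (x \<oplus>\<^bsub>V\<^esub> y) <+\<^bsub>V\<^esub> B),
      smult = (\<lambda>a X. \<Union>x\<in>X. (a \<odot>\<^bsub>V\<^esub> x) <+\<^bsub>V\<^esub> B)\<rparr>"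

definition alternate :: "('k, 'v) module \<Rightarrow> int \<Rightarrow> 'v \<Rightarrow> 'v" where
  "alternate V n x = (if even n then x else \<ominus>\<^bsub>V\<^esub> x)"  \<comment> \<open>\<open>(-1)^n x\<close>\<close>


section \<open>Linear monoidal abelian categories\<close>

record ('k, 'o, 'm) linear_cat =
  Obj :: "'o set"
  Dom :: "'m \<Rightarrow> 'o"
  Cod :: "'m \<Rightarrow> 'o"
  Hom :: "'o \<Rightarrow> 'o \<Rightarrow> ('k, 'm) module"
  Id :: "'o \<Rightarrow> 'm"
  Comp :: "'m \<Rightarrow> 'm \<Rightarrow> 'm"  (infixr \<open>\<cdot>\<index>\<close> 75)

locale linear_category =
  fixes k :: "('k, 'r) ring_scheme" and M :: "('k, 'o, 'm, 'c) linear_cat_scheme" (structure)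
  assumes field: "field k"
    and hom_space: "\<lbrakk>A \<in> Obj M; B \<in> Obj M\<rbrakk> \<Longrightarrow> module k (Hom M A B)"
    and dom_cod: "\<lbrakk>A \<in> Obj M; B \<in> Obj M; f \<in> carrier (Hom M A B)\<rbrakk> \<Longrightarrow> Dom M f = A \<and> Cod M f = B"
    and id_in_hom: "A \<in> Obj M \<Longrightarrow> Id M A \<in> carrier (Hom M A A)"
    and comp_bilinear: "\<lbrakk>A \<in> Obj M; B \<in> Obj M; C \<in> Obj M\<rbrakk> \<Longrightarrow>
      bilinear_map k (Hom M B C) (Hom M A B) (Hom M A C) (\<lambda>g f. g \<cdot> f)"
    and id_left: "\<lbrakk>A \<in> Obj M; B \<in> Obj M; f \<in> carrier (Hom M A B)\<rbrakk> \<Longrightarrow> Id M B \<cdot> f = f"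
    and id_right: "\<lbrakk>A \<in> Obj M; B \<in> Obj M; f \<in> carrier (Hom M A B)\<rbrakk> \<Longrightarrow> f \<cdot> Id M A = f"
    and comp_assoc: "\<lbrakk>A \<in> Obj M; B \<in> Obj M; C \<in> Obj M; D \<in> Obj M;
      f \<in> carrier (Hom M A B); g \<in> carrier (Hom M B C); h \<in> carrier (Hom M C D)\<rbrakk> \<Longrightarrow>
      (h \<cdot> g) \<cdot> f = h \<cdot> (g \<cdot> f)"

definition is_iso :: "('k, 'o, 'm, 'c) linear_cat_scheme \<Rightarrow> 'o \<Rightarrow> 'o \<Rightarrow> 'm \<Rightarrow> bool" where
  "is_iso M A B f \<longleftrightarrow> f \<in> carrier (Hom M A B) \<and>
     (\<exists>g\<in>carrier (Hom M B A). g \<cdot>\<^bsub>M\<^esub> f = Id M A \<and> f \<cdot>\<^bsub>M\<^esub> g = Id M B)"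

definition is_mono :: "('k, 'o, 'm, 'c) linear_cat_scheme \<Rightarrow> 'o \<Rightarrow> 'o \<Rightarrow> 'm \<Rightarrow> bool" where
  "is_mono M A B f \<longleftrightarrow> f \<in> carrier (Hom M A B) \<and>
     (\<forall>X\<in>Obj M. \<forall>g\<in>carrier (Hom M X A). \<forall>h\<in>carrier (Hom M X A). f \<cdot>\<^bsub>M\<^esub> g = f \<cdot>\<^bsub>M\<^esub> h \<longrightarrow> g = h)"

definition is_epi :: "('k, 'o, 'm, 'c) linear_cat_scheme \<Rightarrow> 'o \<Rightarrow> 'o \<Rightarrow> 'm \<Rightarrow> bool" where
  "is_epi M A B f \<longleftrightarrow> f \<in> carrier (Hom M A B) \<and>
     (\<forall>X\<in>Obj M. \<forall>g\<in>carrier (Hom M B X). \<forall>h\<in>carrier (Hom M B X). g \<cdot>\<^bsub>M\<^esub> f = h \<cdot>\<^bsub>M\<^esub> f \<longrightarrow> g = h)"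

definition is_kernel ::
  "('k, 'o, 'm, 'c) linear_cat_scheme \<Rightarrow> 'o \<Rightarrow> 'o \<Rightarrow> 'o \<Rightarrow> 'm \<Rightarrow> 'm \<Rightarrow> bool" where
  "is_kernel M K A B i f \<longleftrightarrow>
     i \<in> carrier (Hom M K A) \<and> f \<in> carrier (Hom M A B) \<and> f \<cdot>\<^bsub>M\<^esub> i = \<zero>\<^bsub>Hom M K B\<^esub> \<and>
     (\<forall>X\<in>Obj M. \<forall>g\<in>carrier (Hom M X A). f \<cdot>\<^bsub>M\<^esub> g = \<zero>\<^bsub>Hom M X B\<^esub> \<longrightarrow>
       (\<exists>!h. h \<in> carrier (Hom M X K) \<and> i \<cdot>\<^bsub>M\<^esub> h = g))"

definition is_cokernel ::
  "('k, 'o, 'm, 'c) linear_cat_scheme \<Rightarrow> 'o \<Rightarrow> 'o \<Rightarrow> 'o \<Rightarrow> 'm \<Rightarrow> 'm \<Rightarrow> bool" where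
  "is_cokernel M Q A B c f \<longleftrightarrow>
     c \<in> carrier (Hom M B Q) \<and> f \<in> carrier (Hom M A B) \<and> c \<cdot>\<^bsub>M\<^esub> f = \<zero>\<^bsub>Hom M A Q\<^esub> \<and>
     (\<forall>X\<in>Obj M. \<forall>g\<in>carrier (Hom M B X). g \<cdot>\<^bsub>M\<^esub> f = \<zero>\<^bsub>Hom M A X\<^esub> \<longrightarrow>
       (\<exists>!h. h \<in> carrier (Hom M Q X) \<and> h \<cdot>\<^bsub>M\<^esub> c = g))"

locale linear_abelian_category = linear_category +
  assumes zero_object: "\<exists>Z\<in>Obj M. \<forall>A\<in>Obj M.
      carrier (Hom M A Z) = {\<zero>\<^bsub>Hom M A Z\<^esub>} \<and> carrier (Hom M Z A) = {\<zero>\<^bsub>Hom M Z A\<^esub>}"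
    and biproducts: "\<lbrakk>A \<in> Obj M; B \<in> Obj M\<rbrakk> \<Longrightarrow> \<exists>P\<in>Obj M.
      \<exists>i\<in>carrier (Hom M A P). \<exists>j\<in>carrier (Hom M B P).
      \<exists>p\<in>carrier (Hom M P A). \<exists>q\<in>carrier (Hom M P B).
        p \<cdot> i = Id M A \<and> q \<cdot> j = Id M B \<and>
        q \<cdot> i = \<zero>\<^bsub>Hom M A B\<^esub> \<and> p \<cdot> j = \<zero>\<^bsub>Hom M B A\<^esub> \<and>
        (i \<cdot> p) \<oplus>\<^bsub>Hom M P P\<^esub> (j \<cdot> q) = Id M P"
    and kernels: "\<lbrakk>A \<in> Obj M; B \<in> Obj M; f \<in> carrier (Hom M A B)\<rbrakk> \<Longrightarrow>
      \<exists>K\<in>Obj M. \<exists>i. is_kernel M K A B i f"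
    and cokernels: "\<lbrakk>A \<in> Obj M; B \<in> Obj M; f \<in> carrier (Hom M A B)\<rbrakk> \<Longrightarrow>
      \<exists>Q\<in>Obj M. \<exists>c. is_cokernel M Q A B c f"
    and mono_is_kernel: "\<lbrakk>A \<in> Obj M; B \<in> Obj M; is_mono M A B f\<rbrakk> \<Longrightarrow>
      \<exists>C\<in>Obj M. \<exists>g. is_kernel M A B C f g"
    and epi_is_cokernel: "\<lbrakk>A \<in> Obj M; B \<in> Obj M; is_epi M A B f\<rbrakk> \<Longrightarrow>
      \<exists>C\<in>Obj M. \<exists>g. is_cokernel M B C A f g"

record ('k, 'o, 'm) linear_moncat = "('k, 'o, 'm) linear_cat" +
  TensO :: "'o \<Rightarrow> 'o \<Rightarrow> 'o"  (infixr \<open>\<boxtimes>\<index>\<close> 80)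
  TensM :: "'m \<Rightarrow> 'm \<Rightarrow> 'm"  (infixr \<open>\<star>\<index>\<close> 80)
  UnitO :: "'o"
  Assoc :: "'o \<Rightarrow> 'o \<Rightarrow> 'o \<Rightarrow> 'm"  \<comment> \<open>\<open>(A \<otimes> B) \<otimes> C \<rightarrow> A \<otimes> (B \<otimes> C)\<close>\<close>
  LUnit :: "'o \<Rightarrow> 'm"  \<comment> \<open>\<open>1 \<otimes> A \<rightarrow> A\<close>\<close>
  RUnit :: "'o \<Rightarrow> 'm"  \<comment> \<open>\<open>A \<otimes> 1 \<rightarrow> A\<close>\<close>

locale linear_monoidal_abelian_category = linear_abelian_category k M
  for k :: "('k, 'r) ring_scheme" and M :: "('k, 'o, 'm, 'c) linear_moncat_scheme" (structure) +
  assumes unit_obj: "UnitO M \<in> Obj M"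
    and tens_obj: "\<lbrakk>A \<in> Obj M; B \<in> Obj M\<rbrakk> \<Longrightarrow> A \<boxtimes> B \<in> Obj M"
    and tens_bilinear: "\<lbrakk>A \<in> Obj M; A' \<in> Obj M; B \<in> Obj M; B' \<in> Obj M\<rbrakk> \<Longrightarrow>
      bilinear_map k (Hom M A A') (Hom M B B') (Hom M (A \<boxtimes> B) (A' \<boxtimes> B')) (\<lambda>f g. f \<star> g)"
    and tens_id: "\<lbrakk>A \<in> Obj M; B \<in> Obj M\<rbrakk> \<Longrightarrow> Id M A \<star> Id M B = Id M (A \<boxtimes> B)"
    and tens_comp: "\<lbrakk>A \<in> Obj M; A' \<in> Obj M; A'' \<in> Obj M; B \<in> Obj M; B' \<in> Obj M; B'' \<in> Obj M;
      f \<in> carrier (Hom M A A'); f' \<in> carrier (Hom M A' A'');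
      g \<in> carrier (Hom M B B'); g' \<in> carrier (Hom M B' B'')\<rbrakk> \<Longrightarrow>
      (f' \<cdot> f) \<star> (g' \<cdot> g) = (f' \<star> g') \<cdot> (f \<star> g)"
    and assoc_iso: "\<lbrakk>A \<in> Obj M; B \<in> Obj M; C \<in> Obj M\<rbrakk> \<Longrightarrow>
      is_iso M ((A \<boxtimes> B) \<boxtimes> C) (A \<boxtimes> (B \<boxtimes> C)) (Assoc M A B C)"
    and lunit_iso: "A \<in> Obj M \<Longrightarrow> is_iso M (UnitO M \<boxtimes> A) A (LUnit M A)"
    and runit_iso: "A \<in> Obj M \<Longrightarrow> is_iso M (A \<boxtimes> UnitO M) A (RUnit M A)"
    and assoc_natural: "\<lbrakk>A \<in> Obj M; A' \<in> Obj M; B \<in> Obj M; B' \<in> Obj M; C \<in> Obj M; C' \<in> Obj M;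
      f \<in> carrier (Hom M A A'); g \<in> carrier (Hom M B B'); h \<in> carrier (Hom M C C')\<rbrakk> \<Longrightarrow>
      Assoc M A' B' C' \<cdot> ((f \<star> g) \<star> h) = (f \<star> (g \<star> h)) \<cdot> Assoc M A B C"
    and lunit_natural: "\<lbrakk>A \<in> Obj M; A' \<in> Obj M; f \<in> carrier (Hom M A A')\<rbrakk> \<Longrightarrow>
      LUnit M A' \<cdot> (Id M (UnitO M) \<star> f) = f \<cdot> LUnit M A"
    and runit_natural: "\<lbrakk>A \<in> Obj M; A' \<in> Obj M; f \<in> carrier (Hom M A A')\<rbrakk> \<Longrightarrow>
      RUnit M A' \<cdot> (f \<star> Id M (UnitO M)) = f \<cdot> RUnit M A"
    and pentagon: "\<lbrakk>A \<in> Obj M; B \<in> Obj M; C \<in> Obj M; D \<in> Obj M\<rbrakk> \<Longrightarrow>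
      Assoc M A B (C \<boxtimes> D) \<cdot> Assoc M (A \<boxtimes> B) C D =
      (Id M A \<star> Assoc M B C D) \<cdot> (Assoc M A (B \<boxtimes> C) D \<cdot> (Assoc M A B C \<star> Id M D))"
    and triangle: "\<lbrakk>A \<in> Obj M; B \<in> Obj M\<rbrakk> \<Longrightarrow>
      (Id M A \<star> LUnit M B) \<cdot> Assoc M A (UnitO M) B = RUnit M A \<star> Id M B"


section \<open>Graded lax monoidal functors to vector spaces\<close>

text \<open>
  The grading is by an arbitrary abelian group: \<open>int\<close> in the graded, \<open>int \<times> int\<close> in the bigraded case.
  The unit map \<open>k \<rightarrow> F\<^sup>0(1)\<close> is given by the image of \<open>1\<close>.
\<close>

record ('g, 'k, 'o, 'm, 'v) lax_functor =
  FObj :: "'g \<Rightarrow> 'o \<Rightarrow> ('k, 'v) module"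
  FMor :: "'g \<Rightarrow> 'm \<Rightarrow> 'v \<Rightarrow> 'v"
  FProd :: "'g \<Rightarrow> 'g \<Rightarrow> 'o \<Rightarrow> 'o \<Rightarrow> 'v \<Rightarrow> 'v \<Rightarrow> 'v"
  FUnit :: "'v"

locale graded_lax_functor =
  fixes k :: "('k, 'r) ring_scheme" and M :: "('k, 'o, 'm, 'c) linear_moncat_scheme" (structure)
    and F :: "('g::ab_group_add, 'k, 'o, 'm, 'v) lax_functor"
  assumes obj_space: "A \<in> Obj M \<Longrightarrow> module k (FObj F g A)"
    and mor_linear: "\<lbrakk>A \<in> Obj M; B \<in> Obj M; f \<in> carrier (Hom M A B)\<rbrakk> \<Longrightarrow>
      linear_map k (FObj F g A) (FObj F g B) (FMor F g f)"
    and mor_id: "\<lbrakk>A \<in> Obj M; x \<in> carrier (FObj F g A)\<rbrakk> \<Longrightarrow> FMor F g (Id M A) x = x"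
    and mor_comp: "\<lbrakk>A \<in> Obj M; B \<in> Obj M; C \<in> Obj M; f \<in> carrier (Hom M A B);
      f' \<in> carrier (Hom M B C); x \<in> carrier (FObj F g A)\<rbrakk> \<Longrightarrow>
      FMor F g (f' \<cdot> f) x = FMor F g f' (FMor F g f x)"
    and mor_additive: "\<lbrakk>A \<in> Obj M; B \<in> Obj M; f \<in> carrier (Hom M A B);
      f' \<in> carrier (Hom M A B); x \<in> carrier (FObj F g A)\<rbrakk> \<Longrightarrow>
      FMor F g (f \<oplus>\<^bsub>Hom M A B\<^esub> f') x = FMor F g f x \<oplus>\<^bsub>FObj F g B\<^esub> FMor F g f' x"
    and prod_bilinear: "\<lbrakk>A \<in> Obj M; B \<in> Obj M\<rbrakk> \<Longrightarrow>
      bilinear_map k (FObj F g A) (FObj F h B) (FObj F (g + h) (A \<boxtimes> B)) (FProd F g h A B)"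
    and prod_natural: "\<lbrakk>A \<in> Obj M; A' \<in> Obj M; B \<in> Obj M; B' \<in> Obj M;
      f \<in> carrier (Hom M A A'); f' \<in> carrier (Hom M B B');
      x \<in> carrier (FObj F g A); y \<in> carrier (FObj F h B)\<rbrakk> \<Longrightarrow>
      FMor F (g + h) (f \<star> f') (FProd F g h A B x y) =
      FProd F g h A' B' (FMor F g f x) (FMor F h f' y)"
    and prod_assoc: "\<lbrakk>A \<in> Obj M; B \<in> Obj M; C \<in> Obj M; x \<in> carrier (FObj F g A);
      y \<in> carrier (FObj F h B); z \<in> carrier (FObj F l C)\<rbrakk> \<Longrightarrow>
      FMor F (g + h + l) (Assoc M A B C)
        (FProd F (g + h) l (A \<boxtimes> B) C (FProd F g h A B x y) z) =
      FProd F g (h + l) A (B \<boxtimes> C) x (FProd F h l B C y z)"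
    and unit_mem: "FUnit F \<in> carrier (FObj F 0 (UnitO M))"
    and unit_left: "\<lbrakk>A \<in> Obj M; x \<in> carrier (FObj F g A)\<rbrakk> \<Longrightarrow>
      FMor F g (LUnit M A) (FProd F 0 g (UnitO M) A (FUnit F) x) = x"
    and unit_right: "\<lbrakk>A \<in> Obj M; x \<in> carrier (FObj F g A)\<rbrakk> \<Longrightarrow>
      FMor F g (RUnit M A) (FProd F g 0 A (UnitO M) x (FUnit F)) = x"

locale mult_iso =
  fixes k :: "('k, 'r) ring_scheme" and M :: "('k, 'o, 'm, 'c) linear_moncat_scheme" (structure)
    and F :: "('g::ab_group_add, 'k, 'o, 'm, 'v) lax_functor"
    and G :: "('g, 'k, 'o, 'm, 'w) lax_functor"
    and \<phi> :: "'g \<Rightarrow> 'o \<Rightarrow> 'v \<Rightarrow> 'w"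
  assumes iso_linear: "A \<in> Obj M \<Longrightarrow> linear_map k (FObj F g A) (FObj G g A) (\<phi> g A)"
    and iso_bij: "A \<in> Obj M \<Longrightarrow> bij_betw (\<phi> g A) (carrier (FObj F g A)) (carrier (FObj G g A))"
    and iso_natural: "\<lbrakk>A \<in> Obj M; B \<in> Obj M; f \<in> carrier (Hom M A B); x \<in> carrier (FObj F g A)\<rbrakk> \<Longrightarrow>
      \<phi> g B (FMor F g f x) = FMor G g f (\<phi> g A x)"
    and iso_prod: "\<lbrakk>A \<in> Obj M; B \<in> Obj M; x \<in> carrier (FObj F g A); y \<in> carrier (FObj F h B)\<rbrakk> \<Longrightarrow>
      \<phi> (g + h) (A \<boxtimes> B) (FProd F g h A B x y) = FProd G g h A B (\<phi> g A x) (\<phi> h B y)"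

locale lax_monoidal_iso = mult_iso +
  assumes iso_unit: "\<phi> 0 (UnitO M) (FUnit F) = FUnit G"

text \<open>
  The subquotient \<open>Z / B\<close> of a graded lax monoidal functor, for subfunctors \<open>B \<subseteq> Z\<close> such that \<open>Z\<close>
  contains the unit and is closed under exterior products and \<open>B\<close> is an ideal in \<open>Z\<close>.
\<close>

definition subquotient_functor ::
  "('k, 'o, 'm, 'c) linear_moncat_scheme \<Rightarrow> ('g::ab_group_add, 'k, 'o, 'm, 'v) lax_functor
    \<Rightarrow> ('g \<Rightarrow> 'o \<Rightarrow> 'v set) \<Rightarrow> ('g \<Rightarrow> 'o \<Rightarrow> 'v set) \<Rightarrow> ('g, 'k, 'o, 'm, 'v set) lax_functor" where
  "subquotient_functor M F Z B =
     \<lparr>FObj = (\<lambda>g A. subquotient_space (FObj F g A) (Z g A) (B g A)),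
      FMor = (\<lambda>g f X. \<Union>x\<in>X. FMor F g f x <+\<^bsub>FObj F g (Cod M f)\<^esub> B g (Cod M f)),
      FProd = (\<lambda>g h A C X Y. \<Union>x\<in>X. \<Union>y\<in>Y.
        FProd F g h A C x y <+\<^bsub>FObj F (g + h) (A \<boxtimes>\<^bsub>M\<^esub> C)\<^esub> B (g + h) (A \<boxtimes>\<^bsub>M\<^esub> C)),
      FUnit = FUnit F <+\<^bsub>FObj F 0 (UnitO M)\<^esub> B 0 (UnitO M)\<rparr>"

definition bigrade ::
  "(int, 'k, 'o, 'm, 'v) lax_functor \<Rightarrow> (int \<times> int, 'k, 'o, 'm, 'v) lax_functor" where
  "bigrade F =
     \<lparr>FObj = (\<lambda>(p, q). FObj F (p + q)),
      FMor = (\<lambda>(p, q). FMor F (p + q)),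
      FProd = (\<lambda>(p, q) (u, v). FProd F (p + q) (u + v)),
      FUnit = FUnit F\<rparr>"


section \<open>Differentials and cohomology\<close>

text \<open>\<open>\<delta>\<close> is the bidegree of the differential.\<close>

locale bigraded_differential_functor = graded_lax_functor k M F
  for k :: "('k, 'r) ring_scheme" and M :: "('k, 'o, 'm, 'c) linear_moncat_scheme" (structure)
    and \<delta> :: "int \<times> int"
    and F :: "(int \<times> int, 'k, 'o, 'm, 'v) lax_functor"
    and d :: "int \<times> int \<Rightarrow> 'o \<Rightarrow> 'v \<Rightarrow> 'v" +
  assumes d_linear: "A \<in> Obj M \<Longrightarrow> linear_map k (FObj F g A) (FObj F (g + \<delta>) A) (d g A)"
    and d_natural: "\<lbrakk>A \<in> Obj M; B \<in> Obj M; f \<in> carrier (Hom M A B); x \<in> carrier (FObj F g A)\<rbrakk> \<Longrightarrow>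
      d g B (FMor F g f x) = FMor F (g + \<delta>) f (d g A x)"
    and d_square: "\<lbrakk>A \<in> Obj M; x \<in> carrier (FObj F g A)\<rbrakk> \<Longrightarrow>
      d (g + \<delta>) A (d g A x) = \<zero>\<^bsub>FObj F (g + \<delta> + \<delta>) A\<^esub>"
    and d_leibniz: "\<lbrakk>A \<in> Obj M; B \<in> Obj M; x \<in> carrier (FObj F (p, q) A); y \<in> carrier (FObj F h B)\<rbrakk> \<Longrightarrow>
      d ((p, q) + h) (A \<boxtimes> B) (FProd F (p, q) h A B x y) =
      FProd F ((p, q) + \<delta>) h A B (d (p, q) A x) y \<oplus>\<^bsub>FObj F ((p, q) + h + \<delta>) (A \<boxtimes> B)\<^esub>
      alternate (FObj F ((p, q) + h + \<delta>) (A \<boxtimes> B)) (p + q) (FProd F (p, q) (h + \<delta>) A B x (d h B y))"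
    and d_unit: "d 0 (UnitO M) (FUnit F) = \<zero>\<^bsub>FObj F \<delta> (UnitO M)\<^esub>"

definition cohomology ::
  "('k, 'o, 'm, 'c) linear_moncat_scheme \<Rightarrow> 'g \<Rightarrow> ('g::ab_group_add, 'k, 'o, 'm, 'v) lax_functor
    \<Rightarrow> ('g \<Rightarrow> 'o \<Rightarrow> 'v \<Rightarrow> 'v) \<Rightarrow> ('g, 'k, 'o, 'm, 'v set) lax_functor" where
  "cohomology M \<delta> F d = subquotient_functor M F
     (\<lambda>g A. {x \<in> carrier (FObj F g A). d g A x = \<zero>\<^bsub>FObj F (g + \<delta>) A\<^esub>})
     (\<lambda>g A. d (g - \<delta>) A ` carrier (FObj F (g - \<delta>) A))"


section \<open>Functorial multiplicative spectral sequences and their convergence\<close>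

locale functorial_mult_spectral_sequence =
  fixes k :: "('k, 'r) ring_scheme" and M :: "('k, 'o, 'm, 'c) linear_moncat_scheme" (structure)
    and a :: int
    and E :: "int \<Rightarrow> (int \<times> int, 'k, 'o, 'm, 'v) lax_functor"
    and d :: "int \<Rightarrow> int \<times> int \<Rightarrow> 'o \<Rightarrow> 'v \<Rightarrow> 'v"
    and \<phi> :: "int \<Rightarrow> int \<times> int \<Rightarrow> 'o \<Rightarrow> 'v set \<Rightarrow> 'v"
  assumes page: "a \<le> r \<Longrightarrow> bigraded_differential_functor k M (r, 1 - r) (E r) (d r)"
    and next_page: "a \<le> r \<Longrightarrow>
      lax_monoidal_iso k M (cohomology M (r, 1 - r) (E r) (d r)) (E (r + 1)) (\<phi> r)"

text \<open>
  \<open>ss_reach n\<close> sends an element of the starting page \<open>E a\<close> that survives to \<open>E (a + n)\<close> to its image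
  there. With \<open>ss_cycles n\<close> its domain and \<open>ss_bounds n\<close> its kernel,
  \<open>E (a + n) \<cong> ss_cycles n / ss_bounds n\<close>; that is, \<open>ss_cycles n\<close> is the subfunctor usually called
  \<open>Z\<^sub>r\<close> for \<open>r = a + n - 1\<close>, and \<open>ss_bounds n\<close> is the corresponding \<open>B\<^sub>r\<close>.
\<close>

primrec ss_reach ::
  "int \<Rightarrow> (int \<Rightarrow> (int \<times> int, 'k, 'o, 'm, 'v) lax_functor)
    \<Rightarrow> (int \<Rightarrow> int \<times> int \<Rightarrow> 'o \<Rightarrow> 'v \<Rightarrow> 'v) \<Rightarrow> (int \<Rightarrow> int \<times> int \<Rightarrow> 'o \<Rightarrow> 'v set \<Rightarrow> 'v)
    \<Rightarrow> nat \<Rightarrow> int \<times> int \<Rightarrow> 'o \<Rightarrow> 'v \<Rightarrow> 'v" where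
  "ss_reach a E d \<phi> 0 g A x = x"
| "ss_reach a E d \<phi> (Suc n) g A x = (let r = a + int n; g' = g - (r, 1 - r) in
     \<phi> r g A (ss_reach a E d \<phi> n g A x <+\<^bsub>FObj (E r) g A\<^esub> (d r g' A ` carrier (FObj (E r) g' A))))"

primrec ss_cycles ::
  "int \<Rightarrow> (int \<Rightarrow> (int \<times> int, 'k, 'o, 'm, 'v) lax_functor)
    \<Rightarrow> (int \<Rightarrow> int \<times> int \<Rightarrow> 'o \<Rightarrow> 'v \<Rightarrow> 'v) \<Rightarrow> (int \<Rightarrow> int \<times> int \<Rightarrow> 'o \<Rightarrow> 'v set \<Rightarrow> 'v)
    \<Rightarrow> nat \<Rightarrow> int \<times> int \<Rightarrow> 'o \<Rightarrow> 'v set" where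
  "ss_cycles a E d \<phi> 0 g A = carrier (FObj (E a) g A)"
| "ss_cycles a E d \<phi> (Suc n) g A = (let r = a + int n in
     {x \<in> ss_cycles a E d \<phi> n g A.
       d r g A (ss_reach a E d \<phi> n g A x) = \<zero>\<^bsub>FObj (E r) (g + (r, 1 - r)) A\<^esub>})"

definition ss_bounds ::
  "int \<Rightarrow> (int \<Rightarrow> (int \<times> int, 'k, 'o, 'm, 'v) lax_functor)
    \<Rightarrow> (int \<Rightarrow> int \<times> int \<Rightarrow> 'o \<Rightarrow> 'v \<Rightarrow> 'v) \<Rightarrow> (int \<Rightarrow> int \<times> int \<Rightarrow> 'o \<Rightarrow> 'v set \<Rightarrow> 'v)
    \<Rightarrow> nat \<Rightarrow> int \<times> int \<Rightarrow> 'o \<Rightarrow> 'v set" where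
  "ss_bounds a E d \<phi> n g A =
     {x \<in> ss_cycles a E d \<phi> n g A. ss_reach a E d \<phi> n g A x = \<zero>\<^bsub>FObj (E (a + int n)) g A\<^esub>}"

definition E_infinity ::
  "('k, 'o, 'm, 'c) linear_moncat_scheme
    \<Rightarrow> int \<Rightarrow> (int \<Rightarrow> (int \<times> int, 'k, 'o, 'm, 'v) lax_functor)
    \<Rightarrow> (int \<Rightarrow> int \<times> int \<Rightarrow> 'o \<Rightarrow> 'v \<Rightarrow> 'v) \<Rightarrow> (int \<Rightarrow> int \<times> int \<Rightarrow> 'o \<Rightarrow> 'v set \<Rightarrow> 'v)
    \<Rightarrow> (int \<times> int, 'k, 'o, 'm, 'v set) lax_functor" where
  "E_infinity M a E d \<phi> = subquotient_functor M (E a)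
     (\<lambda>g A. \<Inter>n. ss_cycles a E d \<phi> n g A) (\<lambda>g A. \<Union>n. ss_bounds a E d \<phi> n g A)"

text \<open>Throughout, \<open>\<F> s n A\<close> is the \<open>s\<close>-th filtration step in degree \<open>n\<close> on the object \<open>A\<close>.\<close>

locale filtered_graded_lax_functor = graded_lax_functor k M H
  for k :: "('k, 'r) ring_scheme" and M :: "('k, 'o, 'm, 'c) linear_moncat_scheme" (structure)
    and H :: "(int, 'k, 'o, 'm, 'v) lax_functor"
    and \<F> :: "int \<Rightarrow> int \<Rightarrow> 'o \<Rightarrow> 'v set" +
  assumes fil_subspace: "A \<in> Obj M \<Longrightarrow> submodule (\<F> s n A) k (FObj H n A)"
    and fil_subfunctor: "\<lbrakk>A \<in> Obj M; B \<in> Obj M; f \<in> carrier (Hom M A B); x \<in> \<F> s n A\<rbrakk> \<Longrightarrow>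
      FMor H n f x \<in> \<F> s n B"
    and fil_decreasing: "A \<in> Obj M \<Longrightarrow> \<F> (s + 1) n A \<subseteq> \<F> s n A"
    and fil_exhaustive: "A \<in> Obj M \<Longrightarrow> (\<Union>s. \<F> s n A) = carrier (FObj H n A)"
    and fil_hausdorff: "A \<in> Obj M \<Longrightarrow> (\<Inter>s. \<F> s n A) = {\<zero>\<^bsub>FObj H n A\<^esub>}"
    and fil_prod: "\<lbrakk>A \<in> Obj M; B \<in> Obj M; x \<in> \<F> s m A; y \<in> \<F> t n B\<rbrakk> \<Longrightarrow>
      FProd H m n A B x y \<in> \<F> (s + t) (m + n) (A \<boxtimes> B)"
    and fil_unit: "FUnit H \<in> \<F> 0 0 (UnitO M)"

definition associated_graded ::
  "('k, 'o, 'm, 'c) linear_moncat_scheme \<Rightarrow> (int, 'k, 'o, 'm, 'v) lax_functor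
    \<Rightarrow> (int \<Rightarrow> int \<Rightarrow> 'o \<Rightarrow> 'v set) \<Rightarrow> (int \<times> int, 'k, 'o, 'm, 'v set) lax_functor" where
  "associated_graded M H \<F> = subquotient_functor M (bigrade H)
     (\<lambda>(p, q). \<F> p (p + q)) (\<lambda>(p, q). \<F> (p + 1) (p + q))"

definition converges_multiplicatively ::
  "('k, 'r) ring_scheme \<Rightarrow> ('k, 'o, 'm, 'c) linear_moncat_scheme
    \<Rightarrow> int \<Rightarrow> (int \<Rightarrow> (int \<times> int, 'k, 'o, 'm, 'v) lax_functor)
    \<Rightarrow> (int \<Rightarrow> int \<times> int \<Rightarrow> 'o \<Rightarrow> 'v \<Rightarrow> 'v) \<Rightarrow> (int \<Rightarrow> int \<times> int \<Rightarrow> 'o \<Rightarrow> 'v set \<Rightarrow> 'v)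
    \<Rightarrow> (int, 'k, 'o, 'm, 'w) lax_functor \<Rightarrow> (int \<Rightarrow> int \<Rightarrow> 'o \<Rightarrow> 'w set) \<Rightarrow> bool" where
  "converges_multiplicatively k M a E d \<phi> H \<F> \<longleftrightarrow>
     filtered_graded_lax_functor k M H \<F> \<and>
     (\<exists>\<psi>. mult_iso k M (E_infinity M a E d \<phi>) (associated_graded M H \<F>) \<psi>)"


section \<open>The spectral sequence of a filtered differential graded lax monoidal functor\<close>

text \<open>
  For \<open>T\<close> with differential \<open>d\<close> of degree \<open>1\<close> and decreasing filtration \<open>\<F>\<close>,
  \<^item> \<open>Z\<^sub>r\<^sup>p\<^sup>q = {x \<in> \<F>\<^sup>p T\<^sup>p\<^sup>+\<^sup>q. d x \<in> \<F>\<^sup>p\<^sup>+\<^sup>r T\<^sup>p\<^sup>+\<^sup>q\<^sup>+\<^sup>1}\<close>,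
  \<^item> \<open>B\<^sub>r\<^sup>p\<^sup>q = \<F>\<^sup>p T\<^sup>p\<^sup>+\<^sup>q \<inter> d (\<F>\<^sup>p\<^sup>-\<^sup>r T\<^sup>p\<^sup>+\<^sup>q\<^sup>-\<^sup>1)\<close>,
  \<^item> \<open>E\<^sub>r\<^sup>p\<^sup>q = Z\<^sub>r\<^sup>p\<^sup>q / (Z\<^sub>r\<^sub>-\<^sub>1\<^sup>p\<^sup>+\<^sup>1\<^sup>,\<^sup>q\<^sup>-\<^sup>1 + B\<^sub>r\<^sub>-\<^sub>1\<^sup>p\<^sup>q)\<close>.

  For \<open>r = 0\<close> this is the associated graded \<open>\<F>\<^sup>p T\<^sup>p\<^sup>+\<^sup>q / \<F>\<^sup>p\<^sup>+\<^sup>1 T\<^sup>p\<^sup>+\<^sup>q\<close>.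
\<close>

definition fil_Z ::
  "(int \<Rightarrow> 'o \<Rightarrow> 'v \<Rightarrow> 'v) \<Rightarrow> (int \<Rightarrow> int \<Rightarrow> 'o \<Rightarrow> 'v set) \<Rightarrow> int \<Rightarrow> int \<times> int \<Rightarrow> 'o \<Rightarrow> 'v set" where
  "fil_Z d \<F> r = (\<lambda>(p, q) A. {x \<in> \<F> p (p + q) A. d (p + q) A x \<in> \<F> (p + r) (p + q + 1) A})"

definition fil_B ::
  "(int \<Rightarrow> 'o \<Rightarrow> 'v \<Rightarrow> 'v) \<Rightarrow> (int \<Rightarrow> int \<Rightarrow> 'o \<Rightarrow> 'v set) \<Rightarrow> int \<Rightarrow> int \<times> int \<Rightarrow> 'o \<Rightarrow> 'v set" where
  "fil_B d \<F> r = (\<lambda>(p, q) A. \<F> p (p + q) A \<inter> d (p + q - 1) A ` \<F> (p - r) (p + q - 1) A)"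

definition fil_denom ::
  "(int, 'k, 'o, 'm, 'v) lax_functor \<Rightarrow> (int \<Rightarrow> 'o \<Rightarrow> 'v \<Rightarrow> 'v) \<Rightarrow> (int \<Rightarrow> int \<Rightarrow> 'o \<Rightarrow> 'v set)
    \<Rightarrow> int \<Rightarrow> int \<times> int \<Rightarrow> 'o \<Rightarrow> 'v set" where
  "fil_denom T d \<F> r = (\<lambda>(p, q) A.
     fil_Z d \<F> (r - 1) (p + 1, q - 1) A <+>\<^bsub>FObj T (p + q) A\<^esub> fil_B d \<F> (r - 1) (p, q) A)"

definition fil_page ::
  "('k, 'o, 'm, 'c) linear_moncat_scheme \<Rightarrow> (int, 'k, 'o, 'm, 'v) lax_functor
    \<Rightarrow> (int \<Rightarrow> 'o \<Rightarrow> 'v \<Rightarrow> 'v) \<Rightarrow> (int \<Rightarrow> int \<Rightarrow> 'o \<Rightarrow> 'v set)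
    \<Rightarrow> int \<Rightarrow> (int \<times> int, 'k, 'o, 'm, 'v set) lax_functor" where
  "fil_page M T d \<F> r = subquotient_functor M (bigrade T) (fil_Z d \<F> r) (fil_denom T d \<F> r)"

definition fil_diff ::
  "(int, 'k, 'o, 'm, 'v) lax_functor \<Rightarrow> (int \<Rightarrow> 'o \<Rightarrow> 'v \<Rightarrow> 'v) \<Rightarrow> (int \<Rightarrow> int \<Rightarrow> 'o \<Rightarrow> 'v set)
    \<Rightarrow> int \<Rightarrow> int \<times> int \<Rightarrow> 'o \<Rightarrow> 'v set \<Rightarrow> 'v set" where
  "fil_diff T d \<F> r = (\<lambda>(p, q) A X.
     \<Union>x\<in>X. d (p + q) A x <+\<^bsub>FObj T (p + q + 1) A\<^esub> fil_denom T d \<F> r (p + r, q + 1 - r) A)"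

text \<open>
  The canonical isomorphism from the cohomology of page \<open>r\<close> to page \<open>r + 1\<close>. It maps the class of the
  class of \<open>x \<in> Z\<^sub>r\<^sub>+\<^sub>1\<close> to the class of \<open>x\<close>; the latter consists of all \<open>y \<in> Z\<^sub>r\<^sub>+\<^sub>1\<close> whose class on
  page \<open>r\<close> lies in the given cohomology class.
\<close>

definition fil_iso ::
  "(int, 'k, 'o, 'm, 'v) lax_functor \<Rightarrow> (int \<Rightarrow> 'o \<Rightarrow> 'v \<Rightarrow> 'v) \<Rightarrow> (int \<Rightarrow> int \<Rightarrow> 'o \<Rightarrow> 'v set)
    \<Rightarrow> int \<Rightarrow> int \<times> int \<Rightarrow> 'o \<Rightarrow> 'v set set \<Rightarrow> 'v set" where
  "fil_iso T d \<F> r = (\<lambda>(p, q) A c.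
     {x \<in> fil_Z d \<F> (r + 1) (p, q) A. x <+\<^bsub>FObj T (p + q) A\<^esub> fil_denom T d \<F> r (p, q) A \<in> c})"

definition cohomology_fil ::
  "(int, 'k, 'o, 'm, 'v) lax_functor \<Rightarrow> (int \<Rightarrow> 'o \<Rightarrow> 'v \<Rightarrow> 'v) \<Rightarrow> (int \<Rightarrow> int \<Rightarrow> 'o \<Rightarrow> 'v set)
    \<Rightarrow> int \<Rightarrow> int \<Rightarrow> 'o \<Rightarrow> 'v set set" where
  "cohomology_fil T d \<F> s n A =
     {x <+\<^bsub>FObj T n A\<^esub> (d (n - 1) A ` carrier (FObj T (n - 1) A)) | x.
       x \<in> \<F> s n A \<and> d n A x = \<zero>\<^bsub>FObj T (n + 1) A\<^esub>}"


section \<open>Bicomplex lax monoidal functors and their total complexes\<close>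

locale bicomplex_lax_functor =
  horizontal: bigraded_differential_functor k M "(1, 0)" C dh +
  vertical: bigraded_differential_functor k M "(0, 1)" C dv
  for k :: "('k, 'r) ring_scheme" and M :: "('k, 'o, 'm, 'c) linear_moncat_scheme" (structure)
    and C :: "(int \<times> int, 'k, 'o, 'm, 'v) lax_functor"
    and dh dv :: "int \<times> int \<Rightarrow> 'o \<Rightarrow> 'v \<Rightarrow> 'v" +
  assumes anticommute: "\<lbrakk>A \<in> Obj M; x \<in> carrier (FObj C g A)\<rbrakk> \<Longrightarrow>
      dh (g + (0, 1)) A (dv g A x) \<oplus>\<^bsub>FObj C (g + (1, 1)) A\<^esub> dv (g + (1, 0)) A (dh g A x) =
      \<zero>\<^bsub>FObj C (g + (1, 1)) A\<^esub>"

text \<open>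
  An element \<open>x\<close> of the direct sum \<open>Tot\<^sup>n\<close> is a finitely supported family whose member \<open>x p\<close> lies in
  bidegree \<open>(p, n - p)\<close>.
\<close>

definition tot_support ::
  "(int \<times> int, 'k, 'o, 'm, 'v) lax_functor \<Rightarrow> int \<Rightarrow> 'o \<Rightarrow> (int \<Rightarrow> 'v) \<Rightarrow> int set" where
  "tot_support C n A x = {p. x p \<noteq> \<zero>\<^bsub>FObj C (p, n - p) A\<^esub>}"

definition tot_space ::
  "(int \<times> int, 'k, 'o, 'm, 'v) lax_functor \<Rightarrow> int \<Rightarrow> 'o \<Rightarrow> ('k, int \<Rightarrow> 'v) module" where
  "tot_space C n A =
     \<lparr>carrier = {x. (\<forall>p. x p \<in> carrier (FObj C (p, n - p) A)) \<and> finite (tot_support C n A x)},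
      mult = undefined, one = undefined,
      zero = (\<lambda>p. \<zero>\<^bsub>FObj C (p, n - p) A\<^esub>),
      add = (\<lambda>x y p. x p \<oplus>\<^bsub>FObj C (p, n - p) A\<^esub> y p),
      smult = (\<lambda>a x p. a \<odot>\<^bsub>FObj C (p, n - p) A\<^esub> x p)\<rparr>"

definition Tot ::
  "('k, 'o, 'm, 'c) linear_moncat_scheme \<Rightarrow> (int \<times> int, 'k, 'o, 'm, 'v) lax_functor
    \<Rightarrow> (int, 'k, 'o, 'm, int \<Rightarrow> 'v) lax_functor" where
  "Tot M C =
     \<lparr>FObj = tot_space C,
      FMor = (\<lambda>n f x p. FMor C (p, n - p) f (x p)),
      FProd = (\<lambda>m n A B x y s. \<Oplus>\<^bsub>FObj C (s, m + n - s) (A \<boxtimes>\<^bsub>M\<^esub> B)\<^esub>p\<in>tot_support C m A x.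
        FProd C (p, m - p) (s - p, n - (s - p)) A B (x p) (y (s - p))),
      FUnit = (\<lambda>p. if p = 0 then FUnit C else \<zero>\<^bsub>FObj C (p, - p) (UnitO M)\<^esub>)\<rparr>"

definition tot_diff ::
  "(int \<times> int, 'k, 'o, 'm, 'v) lax_functor
    \<Rightarrow> (int \<times> int \<Rightarrow> 'o \<Rightarrow> 'v \<Rightarrow> 'v) \<Rightarrow> (int \<times> int \<Rightarrow> 'o \<Rightarrow> 'v \<Rightarrow> 'v)
    \<Rightarrow> int \<Rightarrow> 'o \<Rightarrow> (int \<Rightarrow> 'v) \<Rightarrow> (int \<Rightarrow> 'v)" where
  "tot_diff C dh dv n A x = (\<lambda>p.
     dh (p - 1, n - (p - 1)) A (x (p - 1)) \<oplus>\<^bsub>FObj C (p, n + 1 - p) A\<^esub> dv (p, n - p) A (x p))"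

definition column_fil ::
  "(int \<times> int, 'k, 'o, 'm, 'v) lax_functor \<Rightarrow> int \<Rightarrow> int \<Rightarrow> 'o \<Rightarrow> (int \<Rightarrow> 'v) set" where
  "column_fil C s n A = {x \<in> carrier (tot_space C n A). \<forall>p\<in>tot_support C n A x. p \<ge> s}"

definition row_fil ::
  "(int \<times> int, 'k, 'o, 'm, 'v) lax_functor \<Rightarrow> int \<Rightarrow> int \<Rightarrow> 'o \<Rightarrow> (int \<Rightarrow> 'v) set" where
  "row_fil C s n A = {x \<in> carrier (tot_space C n A). \<forall>p\<in>tot_support C n A x. n - p \<ge> s}"

text \<open>
  For a bicomplex that is unbounded along its antidiagonals the spectral sequences need not converge
  to the cohomology of the direct sum total complex. It suffices that the filtration of each
  \<open>Tot\<^sup>n\<close> is eventually zero, which is what the following two conditions say for columns and rows.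
\<close>

definition column_bounded ::
  "('k, 'o, 'm, 'c) linear_moncat_scheme \<Rightarrow> (int \<times> int, 'k, 'o, 'm, 'v) lax_functor \<Rightarrow> bool" where
  "column_bounded M C \<longleftrightarrow>
     (\<forall>A\<in>Obj M. \<forall>n. \<exists>s. \<forall>p\<ge>s. carrier (FObj C (p, n - p) A) = {\<zero>\<^bsub>FObj C (p, n - p) A\<^esub>})"

definition row_bounded ::
  "('k, 'o, 'm, 'c) linear_moncat_scheme \<Rightarrow> (int \<times> int, 'k, 'o, 'm, 'v) lax_functor \<Rightarrow> bool" where
  "row_bounded M C \<longleftrightarrow>
     (\<forall>A\<in>Obj M. \<forall>n. \<exists>s. \<forall>q\<ge>s. carrier (FObj C (n - q, q) A) = {\<zero>\<^bsub>FObj C (n - q, q) A\<^esub>})"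

end

theory Submission
  imports Defs
begin

text \<open>
  The column and the row filtration make \<open>Tot(C)\<close> a filtered differential graded lax monoidal
  functor, and the theorem is a statement about any such functor \<open>(T, d, \<F>)\<close>. Each functor in
  sight - a page, the cohomology of a page, the limit page, the cohomology of \<open>T\<close>, its associated
  graded - is a subquotient of \<open>T\<close>, or of a subquotient of \<open>T\<close>, so that it could be written
  \<open>Z / N\<close> with a lax monoidal subfunctor \<open>Z\<close> of \<open>T\<close> and a two-sided ideal \<open>N\<close> of \<open>Z\<close>. Two such functors
  are isomorphic, compatibly with all structure, once they have the same \<open>Z\<close> and \<open>N\<close>.

  This is organised by the notion of a presentation (\<open>lax_presentation\<close>) of a functor \<open>G\<close> by
  \<open>(F, Z, N)\<close>: a surjection \<open>Z \<rightarrow> G\<close> with kernel \<open>N\<close> that preserves all operations. Presentations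
  transport the axioms of a lax monoidal functor (\<open>G_lax\<close>), functors presented by the same data are
  isomorphic (\<open>presentations_isomorphic\<close>), and a subquotient of a presented functor is presented by
  subfunctors of the original one (\<open>subquotient_presentation\<close>). The last fact removes the sets of sets
  that iterated subquotients consist of: every computation happens with elements of \<open>T\<close>.

  Page \<open>r\<close> is presented by \<open>Z\<^sub>r\<close> and \<open>N\<^sub>r = Z\<^sub>r\<^sub>-\<^sub>1\<^sup>p\<^sup>+\<^sup>1 + B\<^sub>r\<^sub>-\<^sub>1\<^sup>p\<close>. Multiplicativity is the assertion that
  \<open>N\<^sub>r\<close> is an ideal of \<open>Z\<^sub>r\<close> (\<open>den_prod_left\<close>, \<open>den_prod_right\<close>), which follows from the Leibniz rule.
  The cohomology of page \<open>r\<close> and page \<open>r + 1\<close> are both presented by \<open>(Z\<^sub>r\<^sub>+\<^sub>1, N\<^sub>r\<^sub>+\<^sub>1)\<close>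
  (\<open>page_cohomology_presentation\<close>). If the filtration is eventually zero in each degree, then the limit
  page and the associated graded of the cohomology are both presented by the cocycles in \<open>\<F>\<^sup>p\<close> modulo
  those that are cohomologous to a cocycle in \<open>\<F>\<^sup>p\<^sup>+\<^sup>1\<close> (\<open>E_infinity_presentation\<close>,
  \<open>graded_cohomology_presentation\<close>).

  It remains to see that \<open>Tot(C)\<close> is such a functor. The identities to be checked are multilinear, so it
  suffices to check them on families with one nonzero member (\<open>linear_ext\<close>), where they are
  the corresponding identities of the bicomplex. Columns and rows are treated together through the
  weight that they assign to a bidegree (\<open>weighted_bicomplex\<close>).
\<close>

section \<open>Linear maps and cosets of subspaces\<close>

text \<open>
  An operation on cosets is the union of the cosets of its values on representatives; it is computed by
  showing that this coset does not depend on the representatives.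
\<close>

lemma UN_const_on:
  assumes "x \<in> X" and "\<And>y. y \<in> X \<Longrightarrow> f y = c"
  shows "(\<Union>y\<in>X. f y) = c"
  using assms by auto

lemma UN2_const_on:
  assumes "x \<in> X" and "y \<in> Y" and "\<And>x y. x \<in> X \<Longrightarrow> y \<in> Y \<Longrightarrow> f x y = c"
  shows "(\<Union>x\<in>X. \<Union>y\<in>Y. f x y) = c"
  using assms by auto

context module
begin

lemma submodule_carrier: "submodule H R M \<Longrightarrow> x \<in> H \<Longrightarrow> x \<in> carrier M"
  using submoduleE(1) by blast

lemma submodule_zero: "submodule H R M \<Longrightarrow> \<zero>\<^bsub>M\<^esub> \<in> H"
  by (metis M.r_neg submoduleE(1,2,3,5) ex_in_conv subsetD)

lemma submodule_diff: "submodule H R M \<Longrightarrow> x \<in> H \<Longrightarrow> y \<in> H \<Longrightarrow> x \<ominus>\<^bsub>M\<^esub> y \<in> H"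
  by (simp add: a_minus_def submoduleE(3,5))

text \<open>
  Ordered rewriting with the laws of an abelian group does not bring \<open>x\<close> and \<open>\<ominus> x\<close> next to each
  other; these rules cancel them across up to two other summands, which is as far as the sums below
  reach.
\<close>

lemma cancel_apart:
  "\<lbrakk>x \<in> carrier M; y \<in> carrier M\<rbrakk> \<Longrightarrow> x \<oplus>\<^bsub>M\<^esub> (y \<oplus>\<^bsub>M\<^esub> \<ominus>\<^bsub>M\<^esub> x) = y"
  "\<lbrakk>x \<in> carrier M; y \<in> carrier M; z \<in> carrier M\<rbrakk> \<Longrightarrow>
    x \<oplus>\<^bsub>M\<^esub> (y \<oplus>\<^bsub>M\<^esub> (\<ominus>\<^bsub>M\<^esub> x \<oplus>\<^bsub>M\<^esub> z)) = y \<oplus>\<^bsub>M\<^esub> z"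
  "\<lbrakk>x \<in> carrier M; y \<in> carrier M; z \<in> carrier M\<rbrakk> \<Longrightarrow>
    x \<oplus>\<^bsub>M\<^esub> (y \<oplus>\<^bsub>M\<^esub> (z \<oplus>\<^bsub>M\<^esub> \<ominus>\<^bsub>M\<^esub> x)) = y \<oplus>\<^bsub>M\<^esub> z"
  "\<lbrakk>x \<in> carrier M; y \<in> carrier M; z \<in> carrier M; w \<in> carrier M\<rbrakk> \<Longrightarrow>
    x \<oplus>\<^bsub>M\<^esub> (y \<oplus>\<^bsub>M\<^esub> (z \<oplus>\<^bsub>M\<^esub> (\<ominus>\<^bsub>M\<^esub> x \<oplus>\<^bsub>M\<^esub> w))) = y \<oplus>\<^bsub>M\<^esub> (z \<oplus>\<^bsub>M\<^esub> w)"
  by (simp_all add: M.a_lcomm[of x y] M.a_lcomm[of x z] M.r_neg M.r_neg2)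

lemmas group_simps =
  cancel_apart M.minus_eq M.minus_add M.minus_minus M.a_assoc M.a_comm M.a_lcomm M.r_neg M.l_neg M.r_neg1 M.r_neg2

lemma diff_add_cancel: "x \<in> carrier M \<Longrightarrow> y \<in> carrier M \<Longrightarrow> (x \<ominus>\<^bsub>M\<^esub> y) \<oplus>\<^bsub>M\<^esub> y = x"
  by (simp add: group_simps)

lemma add_diff_cancel: "x \<in> carrier M \<Longrightarrow> y \<in> carrier M \<Longrightarrow> (x \<oplus>\<^bsub>M\<^esub> y) \<ominus>\<^bsub>M\<^esub> x = y"
  by (simp add: group_simps)

lemma add_diff_cancel': "x \<in> carrier M \<Longrightarrow> y \<in> carrier M \<Longrightarrow> (x \<oplus>\<^bsub>M\<^esub> y) \<ominus>\<^bsub>M\<^esub> y = x"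
  by (simp add: group_simps)

lemma diff_zero: "x \<in> carrier M \<Longrightarrow> x \<ominus>\<^bsub>M\<^esub> \<zero>\<^bsub>M\<^esub> = x"
  by (simp add: M.minus_eq)

lemma diff_self: "x \<in> carrier M \<Longrightarrow> x \<ominus>\<^bsub>M\<^esub> x = \<zero>\<^bsub>M\<^esub>"
  by (simp add: group_simps)

lemma diff_add_diff:
  "\<lbrakk>a \<in> carrier M; b \<in> carrier M; x \<in> carrier M; y \<in> carrier M\<rbrakk> \<Longrightarrow>
    (a \<oplus>\<^bsub>M\<^esub> b) \<ominus>\<^bsub>M\<^esub> (x \<oplus>\<^bsub>M\<^esub> y) = (a \<ominus>\<^bsub>M\<^esub> x) \<oplus>\<^bsub>M\<^esub> (b \<ominus>\<^bsub>M\<^esub> y)"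
  by (simp add: group_simps)

lemma diff_trans:
  "\<lbrakk>x \<in> carrier M; y \<in> carrier M; z \<in> carrier M\<rbrakk> \<Longrightarrow>
    (x \<ominus>\<^bsub>M\<^esub> y) \<oplus>\<^bsub>M\<^esub> (y \<ominus>\<^bsub>M\<^esub> z) = x \<ominus>\<^bsub>M\<^esub> z"
  by (simp add: group_simps)

lemma smult_diff:
  "\<lbrakk>a \<in> carrier R; x \<in> carrier M; y \<in> carrier M\<rbrakk> \<Longrightarrow>
    a \<odot>\<^bsub>M\<^esub> (x \<ominus>\<^bsub>M\<^esub> y) = a \<odot>\<^bsub>M\<^esub> x \<ominus>\<^bsub>M\<^esub> a \<odot>\<^bsub>M\<^esub> y"
  by (simp add: M.minus_eq smult_r_distr smult_r_minus)

lemma mem_l_coset: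
  assumes "submodule B R M" "x \<in> carrier M"
  shows "y \<in> x <+\<^bsub>M\<^esub> B \<longleftrightarrow> y \<in> carrier M \<and> y \<ominus>\<^bsub>M\<^esub> x \<in> B"
proof
  assume "y \<in> x <+\<^bsub>M\<^esub> B"
  then obtain b where "b \<in> B" "y = x \<oplus>\<^bsub>M\<^esub> b"
    by (auto simp: a_l_coset_def')
  then show "y \<in> carrier M \<and> y \<ominus>\<^bsub>M\<^esub> x \<in> B"
    using assms submodule_carrier[OF assms(1), of b] by (simp add: add_diff_cancel)
next
  assume y: "y \<in> carrier M \<and> y \<ominus>\<^bsub>M\<^esub> x \<in> B"
  then have "y = x \<oplus>\<^bsub>M\<^esub> (y \<ominus>\<^bsub>M\<^esub> x)"
    using assms(2) by (simp add: group_simps)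
  then show "y \<in> x <+\<^bsub>M\<^esub> B"
    using y by (auto simp: a_l_coset_def')
qed

lemma l_coset_self: "submodule B R M \<Longrightarrow> x \<in> carrier M \<Longrightarrow> x \<in> x <+\<^bsub>M\<^esub> B"
  by (simp add: mem_l_coset diff_self submodule_zero)

lemma l_coset_eq_iff:
  assumes "submodule B R M" "x \<in> carrier M" "y \<in> carrier M"
  shows "x <+\<^bsub>M\<^esub> B = y <+\<^bsub>M\<^esub> B \<longleftrightarrow> x \<ominus>\<^bsub>M\<^esub> y \<in> B"
proof
  assume "x <+\<^bsub>M\<^esub> B = y <+\<^bsub>M\<^esub> B"
  then show "x \<ominus>\<^bsub>M\<^esub> y \<in> B"
    using l_coset_self[OF assms(1,2)] mem_l_coset[OF assms(1,3), of x] by simp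
next
  assume xy: "x \<ominus>\<^bsub>M\<^esub> y \<in> B"
  have "y \<ominus>\<^bsub>M\<^esub> x = \<ominus>\<^bsub>M\<^esub> (x \<ominus>\<^bsub>M\<^esub> y)"
    using assms by (simp add: group_simps)
  then have yx: "y \<ominus>\<^bsub>M\<^esub> x \<in> B"
    using submoduleE(3)[OF assms(1) xy] by simp
  have "z \<in> x <+\<^bsub>M\<^esub> B \<longleftrightarrow> z \<in> y <+\<^bsub>M\<^esub> B" for z
    using mem_l_coset[OF assms(1,2), of z] mem_l_coset[OF assms(1,3), of z] assms(2,3)
      diff_trans[of z x y] diff_trans[of z y x] submoduleE(5)[OF assms(1)] xy yx
    by metis
  then show "x <+\<^bsub>M\<^esub> B = y <+\<^bsub>M\<^esub> B" by blast
qed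

lemma zero_l_coset: "submodule B R M \<Longrightarrow> \<zero>\<^bsub>M\<^esub> <+\<^bsub>M\<^esub> B = B"
  using mem_l_coset[of B "\<zero>\<^bsub>M\<^esub>"] submodule_carrier[of B] by (auto simp: diff_zero)

lemma mem_set_add: "x \<in> A <+>\<^bsub>M\<^esub> B \<longleftrightarrow> (\<exists>a\<in>A. \<exists>b\<in>B. x = a \<oplus>\<^bsub>M\<^esub> b)"
  by (simp add: set_add_def')

lemma submodule_add_set:
  assumes "submodule A R M" "submodule B R M"
  shows "submodule (A <+>\<^bsub>M\<^esub> B) R M"
proof (rule submoduleI)
  note A = submodule_carrier[OF assms(1)] submoduleE(3-5)[OF assms(1)]
  note B = submodule_carrier[OF assms(2)] submoduleE(3-5)[OF assms(2)]
  show "A <+>\<^bsub>M\<^esub> B \<subseteq> carrier M" using A(1) B(1) by (auto simp: mem_set_add)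
  have "\<zero>\<^bsub>M\<^esub> = \<zero>\<^bsub>M\<^esub> \<oplus>\<^bsub>M\<^esub> \<zero>\<^bsub>M\<^esub>" by simp
  then show "\<zero>\<^bsub>M\<^esub> \<in> A <+>\<^bsub>M\<^esub> B"
    unfolding mem_set_add using submodule_zero[OF assms(1)] submodule_zero[OF assms(2)] by blast
  fix x assume "x \<in> A <+>\<^bsub>M\<^esub> B"
  then obtain a b where ab: "a \<in> A" "b \<in> B" "x = a \<oplus>\<^bsub>M\<^esub> b"
    by (auto simp: mem_set_add)
  have "\<ominus>\<^bsub>M\<^esub> x = \<ominus>\<^bsub>M\<^esub> a \<oplus>\<^bsub>M\<^esub> \<ominus>\<^bsub>M\<^esub> b"
    using ab A(1) B(1) by (simp add: M.minus_add)
  then show "\<ominus>\<^bsub>M\<^esub> x \<in> A <+>\<^bsub>M\<^esub> B"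
    unfolding mem_set_add using ab A(2) B(2) by blast
  show "x \<oplus>\<^bsub>M\<^esub> y \<in> A <+>\<^bsub>M\<^esub> B" if "y \<in> A <+>\<^bsub>M\<^esub> B" for y
  proof -
    from that obtain a' b' where *: "a' \<in> A" "b' \<in> B" "y = a' \<oplus>\<^bsub>M\<^esub> b'"
      by (auto simp: mem_set_add)
    have "x \<oplus>\<^bsub>M\<^esub> y = (a \<oplus>\<^bsub>M\<^esub> a') \<oplus>\<^bsub>M\<^esub> (b \<oplus>\<^bsub>M\<^esub> b')"
      using ab * A(1) B(1) by (simp add: M.a_ac)
    then show ?thesis unfolding mem_set_add using ab * A(4) B(4) by blast
  qed
  show "c \<odot>\<^bsub>M\<^esub> x \<in> A <+>\<^bsub>M\<^esub> B" if "c \<in> carrier R" for c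
  proof -
    have "c \<odot>\<^bsub>M\<^esub> x = c \<odot>\<^bsub>M\<^esub> a \<oplus>\<^bsub>M\<^esub> c \<odot>\<^bsub>M\<^esub> b"
      using ab that A(1) B(1) by (simp add: smult_r_distr)
    then show ?thesis unfolding mem_set_add using ab that A(3) B(3) by blast
  qed
qed

end

context
  fixes k :: "('k, 'r) ring_scheme" and V :: "('k, 'v) module"
  assumes V: "module k V"
begin

interpretation V: module k V by (rule V)

lemma alternate_closed: "x \<in> carrier V \<Longrightarrow> alternate V n x \<in> carrier V"
  by (simp add: alternate_def)

lemma submodule_alternate: "submodule H k V \<Longrightarrow> x \<in> H \<Longrightarrow> alternate V n x \<in> H"
  by (simp add: alternate_def V.submoduleE(3))

lemma alternate_zero: "alternate V n \<zero>\<^bsub>V\<^esub> = \<zero>\<^bsub>V\<^esub>"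
  by (simp add: alternate_def)

lemma alternate_alternate: "x \<in> carrier V \<Longrightarrow> alternate V n (alternate V n x) = x"
  by (simp add: alternate_def)

lemma alternate_add:
  "x \<in> carrier V \<Longrightarrow> y \<in> carrier V \<Longrightarrow>
    alternate V n (x \<oplus>\<^bsub>V\<^esub> y) = alternate V n x \<oplus>\<^bsub>V\<^esub> alternate V n y"
  by (simp add: alternate_def V.M.minus_add)

end

lemma linear_mapD:
  assumes "linear_map k V W f"
  shows linear_map_closed: "x \<in> carrier V \<Longrightarrow> f x \<in> carrier W"
    and linear_map_add: "x \<in> carrier V \<Longrightarrow> y \<in> carrier V \<Longrightarrow> f (x \<oplus>\<^bsub>V\<^esub> y) = f x \<oplus>\<^bsub>W\<^esub> f y"
    and linear_map_smult: "c \<in> carrier k \<Longrightarrow> x \<in> carrier V \<Longrightarrow> f (c \<odot>\<^bsub>V\<^esub> x) = c \<odot>\<^bsub>W\<^esub> f x"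
  using assms by (auto simp: linear_map_def)

lemma bilinear_mapD:
  assumes "bilinear_map k U V W b"
  shows bilinear_map_right: "x \<in> carrier U \<Longrightarrow> linear_map k V W (b x)"
    and bilinear_map_left: "y \<in> carrier V \<Longrightarrow> linear_map k U W (\<lambda>x. b x y)"
  using assms by (auto simp: bilinear_map_def)

context
  fixes k :: "('k, 'r) ring_scheme" and V :: "('k, 'v) module" and W :: "('k, 'w) module"
    and f :: "'v \<Rightarrow> 'w"
  assumes V: "module k V" and W: "module k W" and f: "linear_map k V W f"
begin

interpretation V: module k V by (rule V)
interpretation W: module k W by (rule W)

lemma linear_map_zero: "f \<zero>\<^bsub>V\<^esub> = \<zero>\<^bsub>W\<^esub>"
  using linear_map_add[OF f, of "\<zero>\<^bsub>V\<^esub>" "\<zero>\<^bsub>V\<^esub>"] linear_map_closed[OF f, of "\<zero>\<^bsub>V\<^esub>"]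
  by simp

lemma linear_map_minus: "x \<in> carrier V \<Longrightarrow> f (\<ominus>\<^bsub>V\<^esub> x) = \<ominus>\<^bsub>W\<^esub> f x"
  using linear_map_add[OF f, of "\<ominus>\<^bsub>V\<^esub> x" x] linear_map_zero linear_map_closed[OF f]
  by (simp add: V.M.l_neg W.M.minus_equality)

lemma linear_map_diff:
  "x \<in> carrier V \<Longrightarrow> y \<in> carrier V \<Longrightarrow> f (x \<ominus>\<^bsub>V\<^esub> y) = f x \<ominus>\<^bsub>W\<^esub> f y"
  by (simp add: a_minus_def linear_map_add[OF f] linear_map_minus)

lemma linear_map_alternate_commute: "x \<in> carrier V \<Longrightarrow> f (alternate V n x) = alternate W n (f x)"
  by (simp add: alternate_def linear_map_minus)

lemma submodule_image:
  assumes H: "submodule H k V" shows "submodule (f ` H) k W"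
proof (rule W.submoduleI)
  note H' = V.submodule_carrier[OF H] V.submoduleE(3-5)[OF H]
  show "f ` H \<subseteq> carrier W" using H'(1) linear_map_closed[OF f] by auto
  show "\<zero>\<^bsub>W\<^esub> \<in> f ` H" using V.submodule_zero[OF H] linear_map_zero by force
  show "\<ominus>\<^bsub>W\<^esub> y \<in> f ` H" if "y \<in> f ` H" for y
    using that H' by (auto simp: linear_map_minus[symmetric])
  show "y \<oplus>\<^bsub>W\<^esub> z \<in> f ` H" if "y \<in> f ` H" "z \<in> f ` H" for y z
    using that H' by (auto simp: linear_map_add[OF f, symmetric])
  show "c \<odot>\<^bsub>W\<^esub> y \<in> f ` H" if "c \<in> carrier k" "y \<in> f ` H" for c y
    using that H' by (auto simp: linear_map_smult[OF f, symmetric])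
qed

lemma submodule_vimage:
  assumes H: "submodule H k V" and K: "submodule K k W"
  shows "submodule {x \<in> H. f x \<in> K} k V"
proof (rule V.submoduleI)
  note H' = V.submodule_carrier[OF H] V.submoduleE(3-5)[OF H]
  note K' = W.submodule_carrier[OF K] W.submoduleE(3-5)[OF K]
  show "{x \<in> H. f x \<in> K} \<subseteq> carrier V" using H'(1) by auto
  show "\<zero>\<^bsub>V\<^esub> \<in> {x \<in> H. f x \<in> K}"
    using V.submodule_zero[OF H] W.submodule_zero[OF K] linear_map_zero by simp
qed (use V.submodule_carrier[OF H] V.submoduleE(3-5)[OF H] W.submoduleE(3-5)[OF K] in
    \<open>auto simp: linear_map_minus linear_map_add[OF f] linear_map_smult[OF f]\<close>)

end

lemma submodule_Int:
  assumes "module k V" "submodule A k V" "submodule B k V" shows "submodule (A \<inter> B) k V"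
proof -
  interpret V: module k V by fact
  show ?thesis
    by (rule V.submoduleI)
      (use V.submoduleE[OF assms(2)] V.submoduleE[OF assms(3)] V.submodule_zero[OF assms(2)]
        V.submodule_zero[OF assms(3)] in auto)
qed

lemma submodule_zero_set:
  assumes "module k V" shows "submodule {\<zero>\<^bsub>V\<^esub>} k V"
proof -
  interpret V: module k V by fact
  show ?thesis by (rule V.submoduleI) auto
qed

text \<open>
  The module axioms are equations apart from the existence of negatives, and all of them pass to the
  image of a map that preserves the operations.
\<close>

lemma module_surjective_image:
  assumes V: "module k V" and Z: "submodule Z k V" and onto: "\<pi> ` Z = carrier W"
    and zero: "\<pi> \<zero>\<^bsub>V\<^esub> = \<zero>\<^bsub>W\<^esub>"
    and add: "\<And>x y. x \<in> Z \<Longrightarrow> y \<in> Z \<Longrightarrow> \<pi> (x \<oplus>\<^bsub>V\<^esub> y) = \<pi> x \<oplus>\<^bsub>W\<^esub> \<pi> y"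
    and smult: "\<And>a x. a \<in> carrier k \<Longrightarrow> x \<in> Z \<Longrightarrow> \<pi> (a \<odot>\<^bsub>V\<^esub> x) = a \<odot>\<^bsub>W\<^esub> \<pi> x"
  shows "module k W"
proof -
  interpret V: module k V by fact
  note Z' = V.submodule_carrier[OF Z] V.submoduleE(3-5)[OF Z] V.submodule_zero[OF Z]
  have W: "x \<in> carrier W \<longleftrightarrow> (\<exists>z\<in>Z. x = \<pi> z)" for x
    using onto by auto
  show ?thesis
  proof (rule moduleI)
    show "cring k" by (rule V.R.is_cring)
    show "abelian_group W"
    proof (rule abelian_groupI)
      fix x assume "x \<in> carrier W"
      then obtain z where z: "z \<in> Z" "x = \<pi> z" by (auto simp: W)
      then have "\<pi> (\<ominus>\<^bsub>V\<^esub> z) \<oplus>\<^bsub>W\<^esub> x = \<zero>\<^bsub>W\<^esub>"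
        using Z' by (simp add: add[symmetric] zero[symmetric] V.M.l_neg)
      then show "\<exists>y\<in>carrier W. y \<oplus>\<^bsub>W\<^esub> x = \<zero>\<^bsub>W\<^esub>"
        using z Z'(2)[of z] by (metis W)
    qed (use Z' in \<open>auto simp: W add[symmetric] zero[symmetric] V.M.a_ac\<close>)
  qed (use Z' in \<open>auto simp: W add[symmetric] smult[symmetric] V.smult_l_distr V.smult_r_distr V.smult_assoc1\<close>)
qed

lemma linear_map_comp: "linear_map k U V f \<Longrightarrow> linear_map k V W g \<Longrightarrow> linear_map k U W (\<lambda>x. g (f x))"
  unfolding linear_map_def[of k U W] by (auto simp: linear_mapD)

lemma linear_map_const_zero:
  assumes W: "module k W" shows "linear_map k V W (\<lambda>x. \<zero>\<^bsub>W\<^esub>)"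
proof -
  interpret W: module k W by (rule W)
  show ?thesis by (simp add: linear_map_def)
qed

lemma linear_map_sum:
  assumes W: "module k W" and f: "linear_map k V W f" and g: "linear_map k V W g"
  shows "linear_map k V W (\<lambda>x. f x \<oplus>\<^bsub>W\<^esub> g x)"
proof -
  interpret W: module k W by (rule W)
  show ?thesis
    unfolding linear_map_def
    using linear_mapD[OF f] linear_mapD[OF g] by (auto simp: W.smult_r_distr W.M.a_ac)
qed

lemma linear_map_alternate:
  assumes W: "module k W" shows "linear_map k W W (alternate W n)"
proof -
  interpret W: module k W by (rule W)
  show ?thesis
    unfolding linear_map_def alternate_def by (auto simp: W.smult_r_minus W.M.minus_add)
qed

section \<open>Subquotients of lax monoidal functors\<close>

context linear_monoidal_abelian_category
begin

lemma assoc_hom: "\<lbrakk>A \<in> Obj M; B \<in> Obj M; C \<in> Obj M\<rbrakk> \<Longrightarrow>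
    Assoc M A B C \<in> carrier (Hom M ((A \<boxtimes> B) \<boxtimes> C) (A \<boxtimes> (B \<boxtimes> C)))"
  using assoc_iso by (simp add: is_iso_def)

lemma lunit_hom: "A \<in> Obj M \<Longrightarrow> LUnit M A \<in> carrier (Hom M (UnitO M \<boxtimes> A) A)"
  using lunit_iso by (simp add: is_iso_def)

lemma runit_hom: "A \<in> Obj M \<Longrightarrow> RUnit M A \<in> carrier (Hom M (A \<boxtimes> UnitO M) A)"
  using runit_iso by (simp add: is_iso_def)

lemma tens_hom: "\<lbrakk>A \<in> Obj M; A' \<in> Obj M; B \<in> Obj M; B' \<in> Obj M;
    f \<in> carrier (Hom M A A'); g \<in> carrier (Hom M B B')\<rbrakk> \<Longrightarrow>
    f \<star> g \<in> carrier (Hom M (A \<boxtimes> B) (A' \<boxtimes> B'))"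
  using tens_bilinear[of A A' B B'] by (auto simp: bilinear_map_def linear_map_def)

lemma comp_hom: "\<lbrakk>A \<in> Obj M; B \<in> Obj M; C \<in> Obj M; f \<in> carrier (Hom M A B); g \<in> carrier (Hom M B C)\<rbrakk> \<Longrightarrow>
    g \<cdot> f \<in> carrier (Hom M A C)"
  using comp_bilinear[of A B C] by (auto simp: bilinear_map_def linear_map_def)

lemma add_hom: "\<lbrakk>A \<in> Obj M; B \<in> Obj M; f \<in> carrier (Hom M A B); g \<in> carrier (Hom M A B)\<rbrakk> \<Longrightarrow>
    f \<oplus>\<^bsub>Hom M A B\<^esub> g \<in> carrier (Hom M A B)"
  by (rule abelian_monoid.a_closed[OF abelian_group.axioms(1)[OF module.axioms(2)[OF hom_space]]])

end

context graded_lax_functor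
begin

lemma mor_closed: "\<lbrakk>A \<in> Obj M; B \<in> Obj M; f \<in> carrier (Hom M A B); x \<in> carrier (FObj F g A)\<rbrakk> \<Longrightarrow>
    FMor F g f x \<in> carrier (FObj F g B)"
  by (rule linear_map_closed[OF mor_linear])

lemma prod_closed: "\<lbrakk>A \<in> Obj M; B \<in> Obj M; x \<in> carrier (FObj F g A); y \<in> carrier (FObj F h B)\<rbrakk> \<Longrightarrow>
    FProd F g h A B x y \<in> carrier (FObj F (g + h) (A \<boxtimes> B))"
  by (rule linear_map_closed[OF bilinear_map_right[OF prod_bilinear]])

lemma prod_linear_right: "\<lbrakk>A \<in> Obj M; B \<in> Obj M; x \<in> carrier (FObj F g A)\<rbrakk> \<Longrightarrow>
    linear_map k (FObj F h B) (FObj F (g + h) (A \<boxtimes> B)) (FProd F g h A B x)"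
  by (rule bilinear_map_right[OF prod_bilinear])

lemma prod_linear_left: "\<lbrakk>A \<in> Obj M; B \<in> Obj M; y \<in> carrier (FObj F h B)\<rbrakk> \<Longrightarrow>
    linear_map k (FObj F g A) (FObj F (g + h) (A \<boxtimes> B)) (\<lambda>x. FProd F g h A B x y)"
  by (rule bilinear_map_left[OF prod_bilinear])

end

text \<open>
  The conditions under which the structure of \<open>F\<close> descends to \<open>Z / N\<close>: \<open>Z\<close> is a lax monoidal subfunctor
  and \<open>N\<close> is a subfunctor of \<open>Z\<close> that is a two-sided ideal for the exterior products.
\<close>

locale lax_subquotient =
  linear_monoidal_abelian_category k M + graded_lax_functor k M F
  for k :: "('k, 'r) ring_scheme" and M :: "('k, 'o, 'm, 'c) linear_moncat_scheme" (structure)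
    and F :: "('g::ab_group_add, 'k, 'o, 'm, 'v) lax_functor"
    and Z N :: "'g \<Rightarrow> 'o \<Rightarrow> 'v set" +
  assumes Z_sub: "A \<in> Obj M \<Longrightarrow> submodule (Z g A) k (FObj F g A)"
    and N_sub: "A \<in> Obj M \<Longrightarrow> submodule (N g A) k (FObj F g A)"
    and N_le_Z: "A \<in> Obj M \<Longrightarrow> N g A \<subseteq> Z g A"
    and Z_mor: "\<lbrakk>A \<in> Obj M; B \<in> Obj M; f \<in> carrier (Hom M A B); x \<in> Z g A\<rbrakk> \<Longrightarrow> FMor F g f x \<in> Z g B"
    and N_mor: "\<lbrakk>A \<in> Obj M; B \<in> Obj M; f \<in> carrier (Hom M A B); x \<in> N g A\<rbrakk> \<Longrightarrow> FMor F g f x \<in> N g B"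
    and Z_prod: "\<lbrakk>A \<in> Obj M; B \<in> Obj M; x \<in> Z g A; y \<in> Z h B\<rbrakk> \<Longrightarrow>
      FProd F g h A B x y \<in> Z (g + h) (A \<boxtimes> B)"
    and N_prod_left: "\<lbrakk>A \<in> Obj M; B \<in> Obj M; x \<in> N g A; y \<in> Z h B\<rbrakk> \<Longrightarrow>
      FProd F g h A B x y \<in> N (g + h) (A \<boxtimes> B)"
    and N_prod_right: "\<lbrakk>A \<in> Obj M; B \<in> Obj M; x \<in> Z g A; y \<in> N h B\<rbrakk> \<Longrightarrow>
      FProd F g h A B x y \<in> N (g + h) (A \<boxtimes> B)"
    and Z_unit: "FUnit F \<in> Z 0 (UnitO M)"
begin

lemma Z_carrier: "A \<in> Obj M \<Longrightarrow> x \<in> Z g A \<Longrightarrow> x \<in> carrier (FObj F g A)"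
  using module.submodule_carrier[OF obj_space Z_sub] .

lemma N_carrier: "A \<in> Obj M \<Longrightarrow> x \<in> N g A \<Longrightarrow> x \<in> carrier (FObj F g A)"
  using module.submodule_carrier[OF obj_space N_sub] .

lemma cls_eq_iff:
  assumes "A \<in> Obj M" "x \<in> Z g A" "y \<in> Z g A"
  shows "x <+\<^bsub>FObj F g A\<^esub> N g A = y <+\<^bsub>FObj F g A\<^esub> N g A \<longleftrightarrow> x \<ominus>\<^bsub>FObj F g A\<^esub> y \<in> N g A"
  by (rule module.l_coset_eq_iff[OF obj_space N_sub]) (use assms Z_carrier in auto)

lemma mem_cls:
  assumes A: "A \<in> Obj M" and x: "x \<in> Z g A" and y: "y \<in> x <+\<^bsub>FObj F g A\<^esub> N g A"
  shows "y \<in> Z g A" and "y \<ominus>\<^bsub>FObj F g A\<^esub> x \<in> N g A"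
proof -
  interpret V: module k "FObj F g A" by (rule obj_space[OF A])
  show *: "y \<ominus>\<^bsub>FObj F g A\<^esub> x \<in> N g A" and "y \<in> Z g A"
    using V.mem_l_coset[OF N_sub[OF A] Z_carrier[OF A x], of y] y
      V.submoduleE(5)[OF Z_sub[OF A], of "y \<ominus>\<^bsub>FObj F g A\<^esub> x" x] N_le_Z[OF A] x
      V.diff_add_cancel[of y x] Z_carrier[OF A x] by auto
qed

lemma self_in_cls: "A \<in> Obj M \<Longrightarrow> x \<in> Z g A \<Longrightarrow> x \<in> x <+\<^bsub>FObj F g A\<^esub> N g A"
  by (rule module.l_coset_self[OF obj_space N_sub]) (use Z_carrier in auto)

end

text \<open>
  A functor \<open>G\<close> together with an identification \<open>G \<cong> Z / N\<close>, given by the map \<open>\<pi>\<close> from representatives to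
  elements of \<open>G\<close>. Elements of \<open>G\<close> may be of any type; in particular \<open>G\<close> may itself be an iterated
  subquotient.
\<close>

locale lax_presentation = lax_subquotient k M F Z N
  for k :: "('k, 'r) ring_scheme" and M :: "('k, 'o, 'm, 'c) linear_moncat_scheme" (structure)
    and F :: "('g::ab_group_add, 'k, 'o, 'm, 'v) lax_functor"
    and Z N :: "'g \<Rightarrow> 'o \<Rightarrow> 'v set"
    and G :: "('g, 'k, 'o, 'm, 'w) lax_functor"
    and \<pi> :: "'g \<Rightarrow> 'o \<Rightarrow> 'v \<Rightarrow> 'w" +
  assumes pr_onto: "A \<in> Obj M \<Longrightarrow> \<pi> g A ` Z g A = carrier (FObj G g A)"
    and pr_eq_iff: "\<lbrakk>A \<in> Obj M; x \<in> Z g A; y \<in> Z g A\<rbrakk> \<Longrightarrow>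
      \<pi> g A x = \<pi> g A y \<longleftrightarrow> x \<ominus>\<^bsub>FObj F g A\<^esub> y \<in> N g A"
    and pr_zero: "A \<in> Obj M \<Longrightarrow> \<pi> g A \<zero>\<^bsub>FObj F g A\<^esub> = \<zero>\<^bsub>FObj G g A\<^esub>"
    and pr_add: "\<lbrakk>A \<in> Obj M; x \<in> Z g A; y \<in> Z g A\<rbrakk> \<Longrightarrow>
      \<pi> g A (x \<oplus>\<^bsub>FObj F g A\<^esub> y) = \<pi> g A x \<oplus>\<^bsub>FObj G g A\<^esub> \<pi> g A y"
    and pr_smult: "\<lbrakk>A \<in> Obj M; c \<in> carrier k; x \<in> Z g A\<rbrakk> \<Longrightarrow>
      \<pi> g A (c \<odot>\<^bsub>FObj F g A\<^esub> x) = c \<odot>\<^bsub>FObj G g A\<^esub> \<pi> g A x"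
    and pr_mor: "\<lbrakk>A \<in> Obj M; B \<in> Obj M; f \<in> carrier (Hom M A B); x \<in> Z g A\<rbrakk> \<Longrightarrow>
      \<pi> g B (FMor F g f x) = FMor G g f (\<pi> g A x)"
    and pr_prod: "\<lbrakk>A \<in> Obj M; B \<in> Obj M; x \<in> Z g A; y \<in> Z h B\<rbrakk> \<Longrightarrow>
      \<pi> (g + h) (A \<boxtimes> B) (FProd F g h A B x y) = FProd G g h A B (\<pi> g A x) (\<pi> h B y)"
    and pr_unit: "\<pi> 0 (UnitO M) (FUnit F) = FUnit G"

text \<open>
  Independence of representatives is linearity for the linear operations. For exterior products it is
  the ideal property, by \<open>x'y' - xy = (x' - x)y' + x(y' - y)\<close>.
\<close>

theorem (in lax_subquotient) presentation:
  "lax_presentation k M F Z N (subquotient_functor M F Z N) (\<lambda>g A x. x <+\<^bsub>FObj F g A\<^esub> N g A)"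
proof (unfold_locales, goal_cases)
  case (1 A g)
  then show ?case by (auto simp: subquotient_functor_def subquotient_space_def)
next
  case (2 A x g y)
  then show ?case by (rule cls_eq_iff)
next
  case (3 A g)
  then show ?case
    using module.zero_l_coset[OF obj_space N_sub]
    by (simp add: subquotient_functor_def subquotient_space_def)
next
  case (4 A x g y)
  interpret V: module k "FObj F g A" by (rule obj_space[OF 4(1)])
  have "(x' \<oplus>\<^bsub>FObj F g A\<^esub> y') <+\<^bsub>FObj F g A\<^esub> N g A = (x \<oplus>\<^bsub>FObj F g A\<^esub> y) <+\<^bsub>FObj F g A\<^esub> N g A"
    if x': "x' \<in> x <+\<^bsub>FObj F g A\<^esub> N g A" and y': "y' \<in> y <+\<^bsub>FObj F g A\<^esub> N g A" for x' y'
    using mem_cls[OF 4(1,2) x'] mem_cls[OF 4(1,3) y'] 4 V.submoduleE(5)[OF Z_sub[OF 4(1)]]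
      V.submoduleE(5)[OF N_sub[OF 4(1)]] Z_carrier[OF 4(1)]
    by (simp add: cls_eq_iff V.diff_add_diff)
  note eq = UN2_const_on[OF self_in_cls[OF 4(1,2)] self_in_cls[OF 4(1,3)], OF this]
  show ?case by (simp add: subquotient_functor_def subquotient_space_def) (rule eq[symmetric])
next
  case (5 A c x g)
  interpret V: module k "FObj F g A" by (rule obj_space[OF 5(1)])
  have "(c \<odot>\<^bsub>FObj F g A\<^esub> x') <+\<^bsub>FObj F g A\<^esub> N g A = (c \<odot>\<^bsub>FObj F g A\<^esub> x) <+\<^bsub>FObj F g A\<^esub> N g A"
    if x': "x' \<in> x <+\<^bsub>FObj F g A\<^esub> N g A" for x'
    using mem_cls[OF 5(1,3) x'] 5 V.submoduleE(4)[OF Z_sub[OF 5(1)]]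
      V.submoduleE(4)[OF N_sub[OF 5(1)]] Z_carrier[OF 5(1)]
    by (simp add: cls_eq_iff V.smult_diff[symmetric])
  note eq = UN_const_on[OF self_in_cls[OF 5(1,3)], OF this]
  show ?case by (simp add: subquotient_functor_def subquotient_space_def) (rule eq[symmetric])
next
  case (6 A B f x g)
  have cod: "Cod M f = B" using dom_cod 6 by blast
  have "FMor F g f x' <+\<^bsub>FObj F g B\<^esub> N g B = FMor F g f x <+\<^bsub>FObj F g B\<^esub> N g B"
    if x': "x' \<in> x <+\<^bsub>FObj F g A\<^esub> N g A" for x'
  proof -
    note m = mem_cls[OF 6(1,4) x']
    show ?thesis
      using m N_mor[OF 6(1-3) m(2)] Z_mor[OF 6(1-3) m(1)] Z_mor[OF 6(1-4)] 6 Z_carrier[OF 6(1)]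
        linear_map_diff[OF obj_space[OF 6(1)] obj_space[OF 6(2)] mor_linear[OF 6(1-3)]]
      by (simp add: cls_eq_iff)
  qed
  note eq = UN_const_on[OF self_in_cls[OF 6(1,4)], OF this]
  show ?case by (simp add: subquotient_functor_def cod) (rule eq[symmetric])
next
  case (7 A B x g y h)
  have AB: "A \<boxtimes> B \<in> Obj M" using 7 tens_obj by blast
  interpret V: module k "FObj F (g + h) (A \<boxtimes> B)" by (rule obj_space[OF AB])
  have "FProd F g h A B x' y' <+\<^bsub>FObj F (g + h) (A \<boxtimes> B)\<^esub> N (g + h) (A \<boxtimes> B)
      = FProd F g h A B x y <+\<^bsub>FObj F (g + h) (A \<boxtimes> B)\<^esub> N (g + h) (A \<boxtimes> B)"
    if x': "x' \<in> x <+\<^bsub>FObj F g A\<^esub> N g A" and y': "y' \<in> y <+\<^bsub>FObj F h B\<^esub> N h B" for x' y'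
  proof -
    note x = mem_cls[OF 7(1,3) x'] and y = mem_cls[OF 7(2,4) y']
    let ?b = "FProd F g h A B" and ?V = "FObj F (g + h) (A \<boxtimes> B)"
    have Z: "?b x' y' \<in> Z (g + h) (A \<boxtimes> B)" "?b x y \<in> Z (g + h) (A \<boxtimes> B)" "?b x y' \<in> Z (g + h) (A \<boxtimes> B)"
      using Z_prod 7 x(1) y(1) by auto
    have "?b x' y' \<ominus>\<^bsub>?V\<^esub> ?b x y' = ?b (x' \<ominus>\<^bsub>FObj F g A\<^esub> x) y'"
      by (rule linear_map_diff[OF obj_space[OF 7(1)] obj_space[OF AB] prod_linear_left[OF 7(1,2)
            Z_carrier[OF 7(2) y(1)]] Z_carrier[OF 7(1) x(1)] Z_carrier[OF 7(1,3)], symmetric])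
    moreover have "?b x y' \<ominus>\<^bsub>?V\<^esub> ?b x y = ?b x (y' \<ominus>\<^bsub>FObj F h B\<^esub> y)"
      by (rule linear_map_diff[OF obj_space[OF 7(2)] obj_space[OF AB] prod_linear_right[OF 7(1,2)
            Z_carrier[OF 7(1,3)]] Z_carrier[OF 7(2) y(1)] Z_carrier[OF 7(2,4)], symmetric])
    ultimately have "?b x' y' \<ominus>\<^bsub>?V\<^esub> ?b x y' \<in> N (g + h) (A \<boxtimes> B)"
      "?b x y' \<ominus>\<^bsub>?V\<^esub> ?b x y \<in> N (g + h) (A \<boxtimes> B)"
      using N_prod_left[OF 7(1,2) x(2) y(1)] N_prod_right[OF 7(1,2,3) y(2)] by auto
    then have "?b x' y' \<ominus>\<^bsub>?V\<^esub> ?b x y \<in> N (g + h) (A \<boxtimes> B)"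
      using V.diff_trans[of "?b x' y'" "?b x y'" "?b x y"] Z Z_carrier[OF AB]
        V.submoduleE(5)[OF N_sub[OF AB]] by metis
    then show ?thesis using Z AB by (simp add: cls_eq_iff)
  qed
  note eq = UN2_const_on[OF self_in_cls[OF 7(1,3)] self_in_cls[OF 7(2,4)], OF this]
  show ?case by (simp add: subquotient_functor_def) (rule eq[symmetric])
next
  case 8
  then show ?case by (simp add: subquotient_functor_def)
qed

context lax_presentation
begin

lemma carrier_iff: "A \<in> Obj M \<Longrightarrow> u \<in> carrier (FObj G g A) \<longleftrightarrow> (\<exists>x\<in>Z g A. u = \<pi> g A x)"
  using pr_onto[of A g] by auto

lemma carrierE:
  assumes "A \<in> Obj M" "u \<in> carrier (FObj G g A)"
  obtains x where "x \<in> Z g A" "u = \<pi> g A x"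
  using assms by (auto simp: carrier_iff)

lemma pr_closed: "A \<in> Obj M \<Longrightarrow> x \<in> Z g A \<Longrightarrow> \<pi> g A x \<in> carrier (FObj G g A)"
  using pr_onto[of A g] by auto

lemma pr_zero_iff:
  assumes "A \<in> Obj M" "x \<in> Z g A" shows "\<pi> g A x = \<zero>\<^bsub>FObj G g A\<^esub> \<longleftrightarrow> x \<in> N g A"
proof -
  interpret V: module k "FObj F g A" by (rule obj_space[OF assms(1)])
  show ?thesis
    using pr_eq_iff[OF assms V.submodule_zero[OF Z_sub[OF assms(1)]]] pr_zero[OF assms(1), of g]
      V.diff_zero[OF Z_carrier[OF assms]] by simp
qed

lemma G_space:
  assumes A: "A \<in> Obj M" shows "module k (FObj G g A)"
  by (rule module_surjective_image[OF obj_space[OF A] Z_sub[OF A] pr_onto[OF A] pr_zero[OF A]])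
    (use pr_add[OF A] pr_smult[OF A] in auto)

lemma pr_minus:
  assumes "A \<in> Obj M" "x \<in> Z g A"
  shows "\<pi> g A (\<ominus>\<^bsub>FObj F g A\<^esub> x) = \<ominus>\<^bsub>FObj G g A\<^esub> \<pi> g A x"
proof -
  interpret V: module k "FObj F g A" by (rule obj_space[OF assms(1)])
  interpret W: module k "FObj G g A" by (rule G_space[OF assms(1)])
  have "\<pi> g A (\<ominus>\<^bsub>FObj F g A\<^esub> x) \<oplus>\<^bsub>FObj G g A\<^esub> \<pi> g A x = \<zero>\<^bsub>FObj G g A\<^esub>"
    using assms V.submoduleE(3)[OF Z_sub[OF assms(1)]] Z_carrier[OF assms(1)]
    by (simp add: pr_add[symmetric] pr_zero[symmetric] V.M.l_neg)
  then show ?thesis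
    using W.M.minus_equality assms V.submoduleE(3)[OF Z_sub[OF assms(1)]] pr_closed by metis
qed

lemma pr_diff:
  assumes "A \<in> Obj M" "x \<in> Z g A" "y \<in> Z g A"
  shows "\<pi> g A (x \<ominus>\<^bsub>FObj F g A\<^esub> y) = \<pi> g A x \<ominus>\<^bsub>FObj G g A\<^esub> \<pi> g A y"
  using module.submoduleE(3)[OF obj_space Z_sub] assms by (simp add: a_minus_def pr_add pr_minus)

lemma pr_alternate: "A \<in> Obj M \<Longrightarrow> x \<in> Z g A \<Longrightarrow>
    \<pi> g A (alternate (FObj F g A) n x) = alternate (FObj G g A) n (\<pi> g A x)"
  by (simp add: alternate_def pr_minus)

lemma Z_add: "A \<in> Obj M \<Longrightarrow> x \<in> Z g A \<Longrightarrow> y \<in> Z g A \<Longrightarrow> x \<oplus>\<^bsub>FObj F g A\<^esub> y \<in> Z g A"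
  using module.submoduleE(5)[OF obj_space Z_sub] .

lemma Z_smult: "A \<in> Obj M \<Longrightarrow> c \<in> carrier k \<Longrightarrow> x \<in> Z g A \<Longrightarrow> c \<odot>\<^bsub>FObj F g A\<^esub> x \<in> Z g A"
  using module.submoduleE(4)[OF obj_space Z_sub] .

text \<open>
  The form in which morphisms, exterior products and differentials inherit linearity from \<open>F\<close>.
\<close>

lemma induced_linear:
  assumes "A \<in> Obj M" "B \<in> Obj M" and f: "linear_map k (FObj F g A) (FObj F h B) f"
    and Z: "\<And>x. x \<in> Z g A \<Longrightarrow> f x \<in> Z h B"
    and u: "\<And>x. x \<in> Z g A \<Longrightarrow> u (\<pi> g A x) = \<pi> h B (f x)"
  shows "linear_map k (FObj G g A) (FObj G h B) u"
proof -
  have "u (\<pi> g A x) \<in> carrier (FObj G h B)" if "x \<in> Z g A" for x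
    using that assms by (simp add: pr_closed)
  moreover have "u (\<pi> g A x \<oplus>\<^bsub>FObj G g A\<^esub> \<pi> g A y) = u (\<pi> g A x) \<oplus>\<^bsub>FObj G h B\<^esub> u (\<pi> g A y)"
    if "x \<in> Z g A" "y \<in> Z g A" for x y
    using that assms by (simp add: pr_add[symmetric] Z_add Z_carrier linear_map_add[OF f])
  moreover have "u (c \<odot>\<^bsub>FObj G g A\<^esub> \<pi> g A x) = c \<odot>\<^bsub>FObj G h B\<^esub> u (\<pi> g A x)"
    if "c \<in> carrier k" "x \<in> Z g A" for c x
    using that assms by (simp add: pr_smult[symmetric] Z_smult Z_carrier linear_map_smult[OF f])
  ultimately show ?thesis
    unfolding linear_map_def pr_onto[OF assms(1), symmetric] by blast
qed

text \<open>
  Each axiom is an identity between values of operations, so it holds in \<open>G\<close> because it holds for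
  representatives in \<open>Z\<close>.
\<close>

theorem G_lax: "graded_lax_functor k M G"
proof (rule graded_lax_functor.intro, goal_cases)
  case (1 A g)
  then show ?case by (rule G_space)
next
  case (2 A B f g)
  then show ?case
    by (intro induced_linear[OF 2(1,2) mor_linear[OF 2]]) (auto simp: Z_mor pr_mor)
next
  case (3 A x g)
  then show ?case
    using id_in_hom by (auto simp: carrier_iff pr_mor[symmetric] mor_id Z_carrier)
next
  case (4 A B C f f' x g)
  then show ?case
    using comp_hom[of A B C f f']
    by (auto simp: carrier_iff[of A] pr_mor[symmetric] mor_comp[of A B C] Z_carrier Z_mor[of A B])
next
  case (5 A B f f' x g)
  then show ?case
    using add_hom[of A B f f']
    by (auto simp: carrier_iff[of A] pr_mor[symmetric] pr_add[symmetric] mor_additive[of A B] Z_carrier Z_mor[of A B])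
next
  case (6 A B g h)
  then have AB: "A \<boxtimes> B \<in> Obj M" by (simp add: tens_obj)
  have "linear_map k (FObj G h B) (FObj G (g + h) (A \<boxtimes> B)) (FProd G g h A B u)"
    if u: "u \<in> carrier (FObj G g A)" for u
  proof -
    obtain x where x: "x \<in> Z g A" "u = \<pi> g A x" by (rule carrierE[OF 6(1) u])
    show ?thesis
      by (rule induced_linear[OF 6(2) AB prod_linear_right[OF 6 Z_carrier[OF 6(1) x(1)]]])
        (use x 6 in \<open>auto simp: Z_prod pr_prod\<close>)
  qed
  moreover have "linear_map k (FObj G g A) (FObj G (g + h) (A \<boxtimes> B)) (\<lambda>u. FProd G g h A B u v)"
    if v: "v \<in> carrier (FObj G h B)" for v
  proof -
    obtain y where y: "y \<in> Z h B" "v = \<pi> h B y" by (rule carrierE[OF 6(2) v])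
    show ?thesis
      by (rule induced_linear[OF 6(1) AB prod_linear_left[OF 6 Z_carrier[OF 6(2) y(1)]]])
        (use y 6 in \<open>auto simp: Z_prod pr_prod\<close>)
  qed
  ultimately show ?case by (auto simp: bilinear_map_def)
next
  case (7 A A' B B' f f' x g y h)
  then show ?case
    using tens_hom[of A A' B B' f f'] tens_obj[of A B] tens_obj[of A' B']
    by (auto simp: carrier_iff[of A] carrier_iff[of B] pr_prod[symmetric] pr_mor[symmetric]
        prod_natural[of A A' B B'] Z_carrier Z_mor[of A A'] Z_mor[of B B'] Z_prod)
next
  case (8 A B C x g y h z l)
  then obtain a b c where abc: "a \<in> Z g A" "x = \<pi> g A a" "b \<in> Z h B" "y = \<pi> h B b" "c \<in> Z l C" "z = \<pi> l C c"
    using carrierE[OF 8(1,4)] carrierE[OF 8(2,5)] carrierE[OF 8(3,6)] by metis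
  note ob = tens_obj[OF 8(1,2)] tens_obj[OF 8(2,3)] tens_obj[OF tens_obj[OF 8(1,2)] 8(3)]
    tens_obj[OF 8(1) tens_obj[OF 8(2,3)]]
  have "FMor G (g + h + l) (Assoc M A B C) (FProd G (g + h) l (A \<boxtimes> B) C (FProd G g h A B x y) z)
     = \<pi> (g + h + l) (A \<boxtimes> B \<boxtimes> C) (FMor F (g + h + l) (Assoc M A B C)
        (FProd F (g + h) l (A \<boxtimes> B) C (FProd F g h A B a b) c))"
    using abc 8 ob assoc_hom[OF 8(1-3)]
    by (simp add: pr_prod Z_prod pr_mor[of "(A \<boxtimes> B) \<boxtimes> C" "A \<boxtimes> B \<boxtimes> C"])
  also have "\<dots> = \<pi> (g + (h + l)) (A \<boxtimes> B \<boxtimes> C) (FProd F g (h + l) A (B \<boxtimes> C) a (FProd F h l B C b c))"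
    using prod_assoc[OF 8(1-3) Z_carrier[OF 8(1) abc(1)] Z_carrier[OF 8(2) abc(3)] Z_carrier[OF 8(3) abc(5)]]
    by (simp add: add.assoc)
  also have "\<dots> = FProd G g (h + l) A (B \<boxtimes> C) x (FProd G h l B C y z)"
    using abc 8 ob by (simp add: pr_prod Z_prod)
  finally show ?case .
next
  case 9
  show ?case using pr_closed[OF unit_obj Z_unit] by (simp add: pr_unit)
next
  case (10 A x g)
  obtain a where a: "a \<in> Z g A" "x = \<pi> g A a" by (rule carrierE[OF 10])
  have P: "FProd F 0 g (UnitO M) A (FUnit F) a \<in> Z g (UnitO M \<boxtimes> A)"
    using Z_prod[OF unit_obj 10(1) Z_unit a(1)] by simp
  have "FProd G 0 g (UnitO M) A (FUnit G) x = \<pi> g (UnitO M \<boxtimes> A) (FProd F 0 g (UnitO M) A (FUnit F) a)"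
    using pr_prod[OF unit_obj 10(1) Z_unit a(1)] a by (simp add: pr_unit)
  then show ?case
    using a 10 P lunit_hom[OF 10(1)] tens_obj[OF unit_obj 10(1)]
    by (simp add: pr_mor[symmetric] unit_left Z_carrier)
next
  case (11 A x g)
  obtain a where a: "a \<in> Z g A" "x = \<pi> g A a" by (rule carrierE[OF 11])
  have P: "FProd F g 0 A (UnitO M) a (FUnit F) \<in> Z g (A \<boxtimes> UnitO M)"
    using Z_prod[OF 11(1) unit_obj a(1) Z_unit] by simp
  have "FProd G g 0 A (UnitO M) x (FUnit G) = \<pi> g (A \<boxtimes> UnitO M) (FProd F g 0 A (UnitO M) a (FUnit F))"
    using pr_prod[OF 11(1) unit_obj a(1) Z_unit] a by (simp add: pr_unit)
  then show ?case
    using a 11 P runit_hom[OF 11(1)] tens_obj[OF 11(1) unit_obj]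
    by (simp add: pr_mor[symmetric] unit_right Z_carrier)
qed

lemma image_submodule:
  assumes A: "A \<in> Obj M" and H: "submodule H k (FObj F g A)" and HZ: "H \<subseteq> Z g A"
  shows "submodule (\<pi> g A ` H) k (FObj G g A)"
proof -
  interpret V: module k "FObj F g A" by (rule obj_space[OF A])
  interpret W: module k "FObj G g A" by (rule G_space[OF A])
  note H' = V.submoduleE(3-5)[OF H] and Z' = subsetD[OF HZ]
  show ?thesis
  proof (rule W.submoduleI)
    show "\<pi> g A ` H \<subseteq> carrier (FObj G g A)" using Z' pr_closed[OF A] by auto
    show "\<zero>\<^bsub>FObj G g A\<^esub> \<in> \<pi> g A ` H"
      using V.submodule_zero[OF H] pr_zero[OF A, of g] by force
    show "\<ominus>\<^bsub>FObj G g A\<^esub> y \<in> \<pi> g A ` H" if "y \<in> \<pi> g A ` H" for y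
      using that H' Z' by (auto simp: pr_minus[OF A, symmetric])
    show "y \<oplus>\<^bsub>FObj G g A\<^esub> z \<in> \<pi> g A ` H" if "y \<in> \<pi> g A ` H" "z \<in> \<pi> g A ` H" for y z
      using that H' Z' by (auto simp: pr_add[OF A, symmetric])
    show "c \<odot>\<^bsub>FObj G g A\<^esub> y \<in> \<pi> g A ` H" if "c \<in> carrier k" "y \<in> \<pi> g A ` H" for c y
      using that H' Z' by (auto simp: pr_smult[OF A, symmetric])
  qed
qed

text \<open>
  A subquotient of \<open>Z / N\<close> given by the images of \<open>Z'\<close> and \<open>N'\<close> is \<open>Z' / (N' + N \<inter> Z')\<close>, and the second
  summand is absorbed when \<open>N \<inter> Z' \<subseteq> N'\<close>. For
  the limit page \<open>Z'\<close> consists of cocycles and does not contain \<open>N\<close>.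
\<close>

theorem subquotient_presentation:
  assumes S: "lax_subquotient k M F Z' N'"
    and Z'_le: "\<And>g A. A \<in> Obj M \<Longrightarrow> Z' g A \<subseteq> Z g A"
    and N_le: "\<And>g A x. A \<in> Obj M \<Longrightarrow> x \<in> Z' g A \<Longrightarrow> x \<in> N g A \<Longrightarrow> x \<in> N' g A"
    and ZG: "\<And>g A. A \<in> Obj M \<Longrightarrow> ZG g A = \<pi> g A ` Z' g A"
    and NG: "\<And>g A. A \<in> Obj M \<Longrightarrow> NG g A = \<pi> g A ` N' g A"
  shows "lax_presentation k M F Z' N' (subquotient_functor M G ZG NG)
    (\<lambda>g A x. \<pi> g A x <+\<^bsub>FObj G g A\<^esub> NG g A)"
proof -
  interpret S: lax_subquotient k M F Z' N' by (rule S)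
  interpret G: graded_lax_functor k M G by (rule G_lax)
  have N'_le: "N' g A \<subseteq> Z g A" if "A \<in> Obj M" for g A
    using S.N_le_Z Z'_le that by blast
  note [simp] = subsetD[OF Z'_le] subsetD[OF N'_le] tens_obj
  interpret Q: lax_subquotient k M G ZG NG
  proof (intro lax_subquotient.intro lax_subquotient_axioms.intro
      linear_monoidal_abelian_category_axioms G_lax, goal_cases)
    case (1 A g) then show ?case using image_submodule[OF 1 S.Z_sub Z'_le] by (simp add: ZG)
  next
    case (2 A g) then show ?case using image_submodule[OF 2 S.N_sub N'_le] by (simp add: NG)
  next
    case (3 A g) then show ?case using S.N_le_Z[OF 3] by (auto simp: ZG NG)
  next
    case (4 A B f x g) then show ?case by (auto simp: ZG pr_mor[OF 4(1-3), symmetric] S.Z_mor[OF 4(1-3)])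
  next
    case (5 A B f x g) then show ?case by (auto simp: NG pr_mor[OF 5(1-3), symmetric] S.N_mor[OF 5(1-3)])
  next
    case (6 A B x g y h) then show ?case by (auto simp: ZG pr_prod[OF 6(1,2), symmetric] S.Z_prod[OF 6(1,2)])
  next
    case (7 A B x g y h) then show ?case
      by (auto simp: NG ZG pr_prod[OF 7(1,2), symmetric] S.N_prod_left[OF 7(1,2)])
  next
    case (8 A B x g y h) then show ?case
      by (auto simp: NG ZG pr_prod[OF 8(1,2), symmetric] S.N_prod_right[OF 8(1,2)])
  next
    case 9 show ?case using S.Z_unit by (auto simp: ZG unit_obj pr_unit[symmetric])
  qed
  interpret Q: lax_presentation k M G ZG NG "subquotient_functor M G ZG NG"
    "\<lambda>g A x. x <+\<^bsub>FObj G g A\<^esub> NG g A"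
    by (rule Q.presentation)
  have ZG_mem: "\<pi> g A x \<in> ZG g A" if "A \<in> Obj M" "x \<in> Z' g A" for g A x
    using that by (simp add: ZG)
  show ?thesis
  proof (unfold_locales, goal_cases)
    case (1 A g)
    have "(\<lambda>x. \<pi> g A x <+\<^bsub>FObj G g A\<^esub> NG g A) ` Z' g A = (\<lambda>u. u <+\<^bsub>FObj G g A\<^esub> NG g A) ` ZG g A"
      by (simp add: ZG[OF 1] image_image)
    then show ?case using Q.pr_onto[OF 1] by simp
  next
    case (2 A x g y)
    interpret V: module k "FObj F g A" by (rule obj_space[OF 2(1)])
    have xy: "x \<ominus>\<^bsub>FObj F g A\<^esub> y \<in> Z' g A"
      using V.submodule_diff[OF S.Z_sub[OF 2(1)]] 2 by blast
    have "\<pi> g A x <+\<^bsub>FObj G g A\<^esub> NG g A = \<pi> g A y <+\<^bsub>FObj G g A\<^esub> NG g A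
        \<longleftrightarrow> \<pi> g A (x \<ominus>\<^bsub>FObj F g A\<^esub> y) \<in> \<pi> g A ` N' g A"
      using Q.pr_eq_iff[OF 2(1) ZG_mem[OF 2(1,2)] ZG_mem[OF 2(1,3)]] 2 by (simp add: pr_diff NG)
    also have "\<dots> \<longleftrightarrow> x \<ominus>\<^bsub>FObj F g A\<^esub> y \<in> N' g A"
    proof
      assume "\<pi> g A (x \<ominus>\<^bsub>FObj F g A\<^esub> y) \<in> \<pi> g A ` N' g A"
      then obtain n where n: "n \<in> N' g A" "\<pi> g A (x \<ominus>\<^bsub>FObj F g A\<^esub> y) = \<pi> g A n" by blast
      have nZ: "n \<in> Z' g A" using n(1) S.N_le_Z[OF 2(1)] by blast
      have "(x \<ominus>\<^bsub>FObj F g A\<^esub> y) \<ominus>\<^bsub>FObj F g A\<^esub> n \<in> N g A"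
        using n(2) xy nZ 2(1) by (simp add: pr_eq_iff)
      then have "(x \<ominus>\<^bsub>FObj F g A\<^esub> y) \<ominus>\<^bsub>FObj F g A\<^esub> n \<in> N' g A"
        using N_le[OF 2(1)] V.submodule_diff[OF S.Z_sub[OF 2(1)] xy nZ] by blast
      then show "x \<ominus>\<^bsub>FObj F g A\<^esub> y \<in> N' g A"
        using V.submoduleE(5)[OF S.N_sub[OF 2(1)] _ n(1)] V.diff_add_cancel
          S.Z_carrier[OF 2(1) xy] S.Z_carrier[OF 2(1) nZ] by metis
    qed blast
    finally show ?case .
  next
    case (3 A g) show ?case using Q.pr_zero[OF 3] pr_zero[OF 3] by simp
  next
    case (4 A x g y) then show ?case using Q.pr_add[OF 4(1) ZG_mem ZG_mem, OF 4(1,2,1,3)] by (simp add: pr_add)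
  next
    case (5 A c x g) then show ?case using Q.pr_smult[OF 5(1,2) ZG_mem, OF 5(1,3)] by (simp add: pr_smult)
  next
    case (6 A B f x g) then show ?case using Q.pr_mor[OF 6(1-3) ZG_mem, OF 6(1,4)] by (simp add: pr_mor[OF 6(1-3)])
  next
    case (7 A B x g y h) then show ?case
      using Q.pr_prod[OF 7(1,2) ZG_mem ZG_mem, OF 7(1,3,2,4)] by (simp add: pr_prod[OF 7(1,2)])
  next
    case 8 show ?case using Q.pr_unit by (simp add: pr_unit)
  qed
qed

end

text \<open>
  The kernels agree, so the map \<open>\<phi>\<close> with \<open>\<phi> \<circ> \<pi> = \<pi>'\<close> is injective; \<open>\<pi>'\<close> is onto, so it is surjective; and it
  respects all operations because \<open>\<pi>\<close> and \<open>\<pi>'\<close> do.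
\<close>

theorem presentations_isomorphic:
  assumes G: "lax_presentation k M F Z N G \<pi>" and G': "lax_presentation k M F Z N G' \<pi>'"
    and \<phi>: "\<And>g A x. A \<in> Obj M \<Longrightarrow> x \<in> Z g A \<Longrightarrow> \<phi> g A (\<pi> g A x) = \<pi>' g A x"
  shows "lax_monoidal_iso k M G G' \<phi>"
proof -
  interpret G: lax_presentation k M F Z N G \<pi> by (rule G)
  interpret G': lax_presentation k M F Z N G' \<pi>' by (rule G')
  show ?thesis
  proof (unfold_locales, goal_cases)
    case (1 A g)
    have "\<phi> g A (\<pi> g A x) = \<pi>' g A x" if "x \<in> Z g A" for x using \<phi>[OF 1 that] .
    then show ?case
      unfolding linear_map_def G.pr_onto[OF 1, symmetric]
      using 1 G.Z_add[OF 1, of _ g] G.Z_smult[OF 1, of _ _ g]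
      by (auto simp: G.pr_add[symmetric] G.pr_smult[symmetric] G'.pr_add G'.pr_smult G'.pr_closed)
  next
    case (2 A g)
    have "inj_on (\<phi> g A) (\<pi> g A ` Z g A)"
      using \<phi>[OF 2] G.pr_eq_iff[OF 2] G'.pr_eq_iff[OF 2] by (auto simp: inj_on_def)
    moreover have "\<phi> g A ` \<pi> g A ` Z g A = \<pi>' g A ` Z g A"
      using \<phi>[OF 2] by (simp add: image_image)
    ultimately show ?case by (simp add: bij_betw_def G.pr_onto[OF 2] G'.pr_onto[OF 2])
  next
    case (3 A B f x g)
    obtain a where "a \<in> Z g A" "x = \<pi> g A a" by (rule G.carrierE[OF 3(1,4)])
    then show ?case using 3 G.Z_mor[OF 3(1-3)]
      by (simp add: G.pr_mor[OF 3(1-3), symmetric] G'.pr_mor[OF 3(1-3), symmetric] \<phi>)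
  next
    case (4 A B x g y h)
    obtain a where "a \<in> Z g A" "x = \<pi> g A a" by (rule G.carrierE[OF 4(1,3)])
    moreover obtain b where "b \<in> Z h B" "y = \<pi> h B b" by (rule G.carrierE[OF 4(2,4)])
    ultimately show ?case using 4 G.Z_prod[OF 4(1,2)] G.tens_obj
      by (simp add: G.pr_prod[OF 4(1,2), symmetric] G'.pr_prod[OF 4(1,2), symmetric] \<phi>)
  next
    case 5
    show ?case using \<phi>[OF G.unit_obj G.Z_unit] by (simp add: G.pr_unit G'.pr_unit)
  qed
qed

text \<open>
  Equal kernels make \<open>\<pi> x \<mapsto> \<pi>' x\<close> well defined, so any choice of preimages under \<open>\<pi>\<close> serves.
\<close>

theorem presentations_isomorphic_ex:
  assumes G: "lax_presentation k M F Z N G \<pi>" and G': "lax_presentation k M F Z N G' \<pi>'"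
  shows "\<exists>\<phi>. lax_monoidal_iso k M G G' \<phi>"
proof -
  interpret G: lax_presentation k M F Z N G \<pi> by (rule G)
  interpret G': lax_presentation k M F Z N G' \<pi>' by (rule G')
  define \<phi> where "\<phi> = (\<lambda>g A u. \<pi>' g A (SOME x. x \<in> Z g A \<and> \<pi> g A x = u))"
  have "\<phi> g A (\<pi> g A x) = \<pi>' g A x" if A: "A \<in> Obj M" and x: "x \<in> Z g A" for g A x
  proof -
    define y where "y = (SOME y. y \<in> Z g A \<and> \<pi> g A y = \<pi> g A x)"
    have "y \<in> Z g A \<and> \<pi> g A y = \<pi> g A x"
      unfolding y_def by (rule someI[of _ x]) (use x in simp)
    then have "\<pi>' g A y = \<pi>' g A x"
      using G.pr_eq_iff[OF A] G'.pr_eq_iff[OF A] x by blast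
    then show ?thesis by (simp add: \<phi>_def y_def)
  qed
  then have "lax_monoidal_iso k M G G' \<phi>" by (rule presentations_isomorphic[OF G G'])
  then show ?thesis by blast
qed

definition total_degree :: "int \<times> int \<Rightarrow> int" where
  "total_degree g = fst g + snd g"

lemma total_degree_simps [simp]:
  "total_degree (p, q) = p + q" "total_degree 0 = 0"
  "total_degree (g + h) = total_degree g + total_degree h"
  by (simp_all add: total_degree_def)

lemma bigrade_simps:
  "FObj (bigrade F) g = FObj F (total_degree g)"
  "FMor (bigrade F) g = FMor F (total_degree g)"
  "FProd (bigrade F) g h = FProd F (total_degree g) (total_degree h)"
  "FUnit (bigrade F) = FUnit F"
  by (simp_all add: bigrade_def total_degree_def split: prod.splits)

lemma bigrade_lax:
  assumes "graded_lax_functor k M F" shows "graded_lax_functor k M (bigrade F)"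
proof -
  interpret graded_lax_functor k M F by fact
  show ?thesis
    by (rule graded_lax_functor.intro; simp add: bigrade_simps)
      (rule obj_space mor_linear mor_id mor_comp mor_additive prod_bilinear prod_natural prod_assoc
        unit_mem unit_left unit_right; assumption)+
qed

lemma bigrade_presentation:
  assumes "lax_presentation k M F Z N G \<pi>"
  shows "lax_presentation k M (bigrade F) (\<lambda>g. Z (total_degree g)) (\<lambda>g. N (total_degree g))
    (bigrade G) (\<lambda>g. \<pi> (total_degree g))"
proof -
  interpret lax_presentation k M F Z N G \<pi> by fact
  interpret B: graded_lax_functor k M "bigrade F"
    by (rule bigrade_lax[OF graded_lax_functor_axioms])
  show ?thesis
    by (intro lax_presentation.intro lax_presentation_axioms.intro lax_subquotient.intro
        lax_subquotient_axioms.intro linear_monoidal_abelian_category_axioms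
        B.graded_lax_functor_axioms; (simp add: bigrade_simps)?)
      (rule Z_sub N_sub N_le_Z Z_mor N_mor Z_prod N_prod_left N_prod_right Z_unit
        pr_onto pr_eq_iff pr_zero pr_add pr_smult pr_mor pr_prod pr_unit; assumption)+
qed

section \<open>The pages of a filtered differential graded lax monoidal functor\<close>

text \<open>
  The multiplicative and functorial version of a filtered cochain complex: \<open>d\<close> is a derivation of degree
  \<open>1\<close> that preserves a decreasing exhaustive multiplicative filtration by subfunctors.
\<close>

locale filtered_differential_functor =
  linear_monoidal_abelian_category k M + graded_lax_functor k M T
  for k :: "('k, 'r) ring_scheme" and M :: "('k, 'o, 'm, 'c) linear_moncat_scheme" (structure)
    and T :: "(int, 'k, 'o, 'm, 'v) lax_functor"
    and d :: "int \<Rightarrow> 'o \<Rightarrow> 'v \<Rightarrow> 'v"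
    and \<F> :: "int \<Rightarrow> int \<Rightarrow> 'o \<Rightarrow> 'v set" +
  assumes d_linear: "A \<in> Obj M \<Longrightarrow> linear_map k (FObj T n A) (FObj T (n + 1) A) (d n A)"
    and d_natural: "\<lbrakk>A \<in> Obj M; B \<in> Obj M; f \<in> carrier (Hom M A B); x \<in> carrier (FObj T n A)\<rbrakk> \<Longrightarrow>
      d n B (FMor T n f x) = FMor T (n + 1) f (d n A x)"
    and d_square: "\<lbrakk>A \<in> Obj M; x \<in> carrier (FObj T n A)\<rbrakk> \<Longrightarrow>
      d (n + 1) A (d n A x) = \<zero>\<^bsub>FObj T (n + 1 + 1) A\<^esub>"
    and d_leibniz: "\<lbrakk>A \<in> Obj M; B \<in> Obj M; x \<in> carrier (FObj T m A); y \<in> carrier (FObj T n B)\<rbrakk> \<Longrightarrow>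
      d (m + n) (A \<boxtimes> B) (FProd T m n A B x y) =
      FProd T (m + 1) n A B (d m A x) y \<oplus>\<^bsub>FObj T (m + n + 1) (A \<boxtimes> B)\<^esub>
      alternate (FObj T (m + n + 1) (A \<boxtimes> B)) m (FProd T m (n + 1) A B x (d n B y))"
    and d_unit: "d 0 (UnitO M) (FUnit T) = \<zero>\<^bsub>FObj T 1 (UnitO M)\<^esub>"
    and fil_sub: "A \<in> Obj M \<Longrightarrow> submodule (\<F> s n A) k (FObj T n A)"
    and fil_mor: "\<lbrakk>A \<in> Obj M; B \<in> Obj M; f \<in> carrier (Hom M A B); x \<in> \<F> s n A\<rbrakk> \<Longrightarrow>
      FMor T n f x \<in> \<F> s n B"
    and fil_antimono: "\<lbrakk>A \<in> Obj M; s \<le> t; x \<in> \<F> t n A\<rbrakk> \<Longrightarrow> x \<in> \<F> s n A"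
    and fil_exhaustive: "\<lbrakk>A \<in> Obj M; x \<in> carrier (FObj T n A)\<rbrakk> \<Longrightarrow> \<exists>s. x \<in> \<F> s n A"
    and fil_prod: "\<lbrakk>A \<in> Obj M; B \<in> Obj M; x \<in> \<F> s m A; y \<in> \<F> t n B\<rbrakk> \<Longrightarrow>
      FProd T m n A B x y \<in> \<F> (s + t) (m + n) (A \<boxtimes> B)"
    and fil_unit: "FUnit T \<in> \<F> 0 0 (UnitO M)"
    and fil_d: "\<lbrakk>A \<in> Obj M; x \<in> \<F> s n A\<rbrakk> \<Longrightarrow> d n A x \<in> \<F> s (n + 1) A"
begin

abbreviation "numer \<equiv> fil_Z d \<F>"
abbreviation "denom \<equiv> fil_denom T d \<F>"
abbreviation "page \<equiv> fil_page M T d \<F>"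
abbreviation "page_d \<equiv> fil_diff T d \<F>"
abbreviation "page_iso \<equiv> fil_iso T d \<F>"
abbreviation "H \<equiv> cohomology M 1 T d"
abbreviation "H_fil \<equiv> cohomology_fil T d \<F>"

lemma fil_carrier: "A \<in> Obj M \<Longrightarrow> x \<in> \<F> s n A \<Longrightarrow> x \<in> carrier (FObj T n A)"
  by (rule module.submodule_carrier[OF obj_space fil_sub])

lemma fil_add: "A \<in> Obj M \<Longrightarrow> x \<in> \<F> s n A \<Longrightarrow> y \<in> \<F> s n A \<Longrightarrow> x \<oplus>\<^bsub>FObj T n A\<^esub> y \<in> \<F> s n A"
  by (rule module.submoduleE(5)[OF obj_space fil_sub])

lemma fil_diff_closed: "A \<in> Obj M \<Longrightarrow> x \<in> \<F> s n A \<Longrightarrow> y \<in> \<F> s n A \<Longrightarrow> x \<ominus>\<^bsub>FObj T n A\<^esub> y \<in> \<F> s n A"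
  by (rule module.submodule_diff[OF obj_space fil_sub])

lemma fil_zero: "A \<in> Obj M \<Longrightarrow> \<zero>\<^bsub>FObj T n A\<^esub> \<in> \<F> s n A"
  by (rule module.submodule_zero[OF obj_space fil_sub])

lemma fil_alternate: "A \<in> Obj M \<Longrightarrow> x \<in> \<F> s n A \<Longrightarrow> alternate (FObj T n A) m x \<in> \<F> s n A"
  by (rule submodule_alternate[OF obj_space fil_sub])

lemma d_closed: "A \<in> Obj M \<Longrightarrow> x \<in> carrier (FObj T n A) \<Longrightarrow> d n A x \<in> carrier (FObj T (n + 1) A)"
  by (rule linear_map_closed[OF d_linear])

lemma d_add: "A \<in> Obj M \<Longrightarrow> x \<in> carrier (FObj T n A) \<Longrightarrow> y \<in> carrier (FObj T n A) \<Longrightarrow>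
    d n A (x \<oplus>\<^bsub>FObj T n A\<^esub> y) = d n A x \<oplus>\<^bsub>FObj T (n + 1) A\<^esub> d n A y"
  by (rule linear_map_add[OF d_linear])

lemma d_diff: "A \<in> Obj M \<Longrightarrow> x \<in> carrier (FObj T n A) \<Longrightarrow> y \<in> carrier (FObj T n A) \<Longrightarrow>
    d n A (x \<ominus>\<^bsub>FObj T n A\<^esub> y) = d n A x \<ominus>\<^bsub>FObj T (n + 1) A\<^esub> d n A y"
  by (rule linear_map_diff[OF obj_space obj_space d_linear])

lemma d_zero: "A \<in> Obj M \<Longrightarrow> d n A \<zero>\<^bsub>FObj T n A\<^esub> = \<zero>\<^bsub>FObj T (n + 1) A\<^esub>"
  by (rule linear_map_zero[OF obj_space obj_space d_linear])

lemma d_alternate: "A \<in> Obj M \<Longrightarrow> x \<in> carrier (FObj T n A) \<Longrightarrow>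
    d n A (alternate (FObj T n A) m x) = alternate (FObj T (n + 1) A) m (d n A x)"
  by (rule linear_map_alternate_commute[OF obj_space obj_space d_linear])

lemma d_linear_into: "A \<in> Obj M \<Longrightarrow> linear_map k (FObj T (n - 1) A) (FObj T n A) (d (n - 1) A)"
  using d_linear[of A "n - 1"] by simp

lemma d_into: "A \<in> Obj M \<Longrightarrow> w \<in> carrier (FObj T (n - 1) A) \<Longrightarrow> d (n - 1) A w \<in> carrier (FObj T n A)"
  by (rule linear_map_closed[OF d_linear_into])

lemma d_d: "A \<in> Obj M \<Longrightarrow> w \<in> carrier (FObj T (n - 1) A) \<Longrightarrow> d n A (d (n - 1) A w) = \<zero>\<^bsub>FObj T (n + 1) A\<^esub>"
  using d_square[of A w "n - 1"] by simp

lemma prod_d_left_closed: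
  "\<lbrakk>A \<in> Obj M; B \<in> Obj M; x \<in> carrier (FObj T m A); y \<in> carrier (FObj T n B)\<rbrakk> \<Longrightarrow>
    FProd T (m + 1) n A B (d m A x) y \<in> carrier (FObj T (m + n + 1) (A \<boxtimes> B))"
  using prod_closed[of A B "d m A x" "m + 1" y n] d_closed[of A x m] by (simp add: ac_simps)

lemma prod_d_right_closed:
  "\<lbrakk>A \<in> Obj M; B \<in> Obj M; x \<in> carrier (FObj T m A); y \<in> carrier (FObj T n B)\<rbrakk> \<Longrightarrow>
    FProd T m (n + 1) A B x (d n B y) \<in> carrier (FObj T (m + n + 1) (A \<boxtimes> B))"
  using prod_closed[of A B x m "d n B y" "n + 1"] d_closed by (simp add: add.assoc)

text \<open>
  The Leibniz rule, read through the filtration: \<open>d (x y)\<close> lies as deep as both \<open>dx y\<close> and \<open>x dy\<close>.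
\<close>

lemma fil_d_prod:
  assumes A: "A \<in> Obj M" and B: "B \<in> Obj M"
    and x: "x \<in> \<F> p m A" "d m A x \<in> \<F> p' (m + 1) A"
    and y: "y \<in> \<F> q n B" "d n B y \<in> \<F> q' (n + 1) B"
    and s: "s \<le> p' + q" "s \<le> p + q'"
  shows "d (m + n) (A \<boxtimes> B) (FProd T m n A B x y) \<in> \<F> s (m + n + 1) (A \<boxtimes> B)"
proof -
  note AB = tens_obj[OF A B]
  have "FProd T (m + 1) n A B (d m A x) y \<in> \<F> s (m + n + 1) (A \<boxtimes> B)"
    using fil_antimono[OF AB s(1) fil_prod[OF A B x(2) y(1)]] by (simp add: algebra_simps)
  moreover have "FProd T m (n + 1) A B x (d n B y) \<in> \<F> s (m + n + 1) (A \<boxtimes> B)"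
    using fil_antimono[OF AB s(2) fil_prod[OF A B x(1) y(2)]] by (simp add: algebra_simps)
  ultimately show ?thesis
    using d_leibniz[OF A B fil_carrier[OF A x(1)] fil_carrier[OF B y(1)]]
    by (simp add: fil_add fil_alternate AB)
qed

text \<open>
  The Leibniz rule for \<open>x\<close> and \<open>w\<close>, solved for the term \<open>x dw\<close>. So a product with a coboundary is a
  coboundary up to a term that contains \<open>dx\<close>.
\<close>

lemma prod_boundary_right:
  assumes A: "A \<in> Obj M" and B: "B \<in> Obj M"
    and x: "x \<in> carrier (FObj T m A)" and w: "w \<in> carrier (FObj T (n - 1) B)"
  defines "V \<equiv> FObj T (m + n) (A \<boxtimes> B)"
    and "U \<equiv> FObj T (m + n - 1) (A \<boxtimes> B)"
  shows "FProd T m n A B x (d (n - 1) B w) =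
    d (m + n - 1) (A \<boxtimes> B) (alternate U m (FProd T m (n - 1) A B x w)) \<ominus>\<^bsub>V\<^esub>
    alternate V m (FProd T (m + 1) (n - 1) A B (d m A x) w)"
    and "alternate U m (FProd T m (n - 1) A B x w) \<in> carrier U"
    and "FProd T (m + 1) (n - 1) A B (d m A x) w \<in> carrier V"
proof -
  note AB = tens_obj[OF A B]
  have ix: "m + (n - 1) = m + n - 1" "m + (n - 1) + 1 = m + n" "m + n - 1 + 1 = m + n" "n - 1 + 1 = n"
    by simp_all
  interpret V: module k V unfolding V_def by (rule obj_space[OF AB])
  note mV = obj_space[OF AB, of "m + n", folded V_def]
  note mU = obj_space[OF AB, of "m + n - 1", folded U_def]
  have xw: "FProd T m (n - 1) A B x w \<in> carrier U"
    using prod_closed[OF A B x w] by (simp add: U_def ix)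
  then show "alternate U m (FProd T m (n - 1) A B x w) \<in> carrier U"
    by (rule alternate_closed[OF mU])
  show dxw: "FProd T (m + 1) (n - 1) A B (d m A x) w \<in> carrier V"
    using prod_d_left_closed[OF A B x w] by (simp add: V_def ix)
  have xdw: "FProd T m n A B x (d (n - 1) B w) \<in> carrier V"
    using prod_d_right_closed[OF A B x w] by (simp add: V_def ix)
  have "d (m + n - 1) (A \<boxtimes> B) (alternate U m (FProd T m (n - 1) A B x w))
      = alternate V m (d (m + n - 1) (A \<boxtimes> B) (FProd T m (n - 1) A B x w))"
    using d_alternate[OF AB, of _ "m + n - 1"] xw by (simp add: U_def V_def ix)
  also have "\<dots> = alternate V m (FProd T (m + 1) (n - 1) A B (d m A x) w) \<oplus>\<^bsub>V\<^esub> FProd T m n A B x (d (n - 1) B w)"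
    using d_leibniz[OF A B x w] dxw xdw
    by (simp add: ix alternate_add[OF mV] alternate_closed[OF mV] alternate_alternate[OF mV] flip: V_def)
  finally show "FProd T m n A B x (d (n - 1) B w) =
    d (m + n - 1) (A \<boxtimes> B) (alternate U m (FProd T m (n - 1) A B x w)) \<ominus>\<^bsub>V\<^esub>
    alternate V m (FProd T (m + 1) (n - 1) A B (d m A x) w)"
    using V.add_diff_cancel[OF alternate_closed[OF mV dxw] xdw] by simp
qed

lemma prod_boundary_left:
  assumes A: "A \<in> Obj M" and B: "B \<in> Obj M"
    and w: "w \<in> carrier (FObj T (m - 1) A)" and y: "y \<in> carrier (FObj T n B)"
  defines "V \<equiv> FObj T (m + n) (A \<boxtimes> B)"
    and "U \<equiv> FObj T (m + n - 1) (A \<boxtimes> B)"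
  shows "FProd T m n A B (d (m - 1) A w) y =
    d (m + n - 1) (A \<boxtimes> B) (FProd T (m - 1) n A B w y) \<ominus>\<^bsub>V\<^esub>
    alternate V (m - 1) (FProd T (m - 1) (n + 1) A B w (d n B y))"
    and "FProd T (m - 1) n A B w y \<in> carrier U"
    and "FProd T (m - 1) (n + 1) A B w (d n B y) \<in> carrier V"
proof -
  note AB = tens_obj[OF A B]
  have ix: "m - 1 + n = m + n - 1" "m - 1 + n + 1 = m + n" "m - 1 + 1 = m" "m + n - 1 + 1 = m + n"
    by simp_all
  interpret V: module k V unfolding V_def by (rule obj_space[OF AB])
  note mV = obj_space[OF AB, of "m + n", folded V_def]
  show "FProd T (m - 1) n A B w y \<in> carrier U"
    using prod_closed[OF A B w y] by (simp add: U_def ix)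
  show wdy: "FProd T (m - 1) (n + 1) A B w (d n B y) \<in> carrier V"
    using prod_d_right_closed[OF A B w y] by (simp add: V_def ix)
  have dwy: "FProd T m n A B (d (m - 1) A w) y \<in> carrier V"
    using prod_d_left_closed[OF A B w y] by (simp add: V_def ix)
  have "d (m + n - 1) (A \<boxtimes> B) (FProd T (m - 1) n A B w y) =
     FProd T m n A B (d (m - 1) A w) y \<oplus>\<^bsub>V\<^esub> alternate V (m - 1) (FProd T (m - 1) (n + 1) A B w (d n B y))"
    using d_leibniz[OF A B w y] by (simp add: ix flip: V_def)
  then show "FProd T m n A B (d (m - 1) A w) y =
    d (m + n - 1) (A \<boxtimes> B) (FProd T (m - 1) n A B w y) \<ominus>\<^bsub>V\<^esub>
    alternate V (m - 1) (FProd T (m - 1) (n + 1) A B w (d n B y))"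
    using V.add_diff_cancel'[OF dwy alternate_closed[OF mV wdy]] by simp
qed

text \<open>
  \<open>cyc\<close> and \<open>den\<close> are the numerator and the denominator of page \<open>r\<close>, with filtration degree \<open>p\<close> and total
  degree \<open>n = p + q\<close> as separate arguments: multiplication adds both degrees, \<open>d\<close> adds \<open>r\<close> and \<open>1\<close>.
\<close>

definition cyc :: "int \<Rightarrow> int \<Rightarrow> int \<Rightarrow> 'o \<Rightarrow> 'v set" where
  "cyc r p n A = {x \<in> \<F> p n A. d n A x \<in> \<F> (p + r) (n + 1) A}"

definition den :: "int \<Rightarrow> int \<Rightarrow> int \<Rightarrow> 'o \<Rightarrow> 'v set" where
  "den r p n A = cyc (r - 1) (p + 1) n A <+>\<^bsub>FObj T n A\<^esub> (\<F> p n A \<inter> d (n - 1) A ` \<F> (p + 1 - r) (n - 1) A)"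

lemma fil_Z_eq: "numer r g A = cyc r (fst g) (total_degree g) A"
  by (simp add: fil_Z_def cyc_def total_degree_def split: prod.split)

lemma fil_denom_eq: "denom r g A = den r (fst g) (total_degree g) A"
  by (cases g) (simp add: fil_denom_def den_def fil_Z_eq fil_B_def algebra_simps)

lemma cyc_carrier: "A \<in> Obj M \<Longrightarrow> x \<in> cyc r p n A \<Longrightarrow> x \<in> carrier (FObj T n A)"
  using fil_carrier[of A x p n] by (simp add: cyc_def)

lemma cyc_sub: "A \<in> Obj M \<Longrightarrow> submodule (cyc r p n A) k (FObj T n A)"
  unfolding cyc_def by (rule submodule_vimage[OF obj_space obj_space d_linear fil_sub fil_sub])

lemma den_sub: "A \<in> Obj M \<Longrightarrow> submodule (den r p n A) k (FObj T n A)"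
  unfolding den_def
  by (intro module.submodule_add_set[OF obj_space] cyc_sub submodule_Int[OF obj_space] fil_sub
      submodule_image[OF obj_space obj_space d_linear_into])

lemma denI:
  assumes "A \<in> Obj M" "z \<in> cyc (r - 1) (p + 1) n A" "w \<in> \<F> (p + 1 - r) (n - 1) A"
    "d (n - 1) A w \<in> \<F> p n A" "x = z \<oplus>\<^bsub>FObj T n A\<^esub> d (n - 1) A w"
  shows "x \<in> den r p n A"
  unfolding den_def module.mem_set_add[OF obj_space[OF assms(1)]] using assms by blast

lemma denE:
  assumes "A \<in> Obj M" "x \<in> den r p n A"
  obtains z w where "z \<in> cyc (r - 1) (p + 1) n A" "w \<in> \<F> (p + 1 - r) (n - 1) A"
    "d (n - 1) A w \<in> \<F> p n A" "x = z \<oplus>\<^bsub>FObj T n A\<^esub> d (n - 1) A w"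
  using assms unfolding den_def module.mem_set_add[OF obj_space[OF assms(1)]] by blast

lemma cyc_in_den:
  assumes A: "A \<in> Obj M" and z: "z \<in> cyc (r - 1) (p + 1) n A"
  shows "z \<in> den r p n A"
proof -
  interpret V: module k "FObj T n A" by (rule obj_space[OF A])
  have "d (n - 1) A \<zero>\<^bsub>FObj T (n - 1) A\<^esub> = \<zero>\<^bsub>FObj T n A\<^esub>" using d_zero[OF A, of "n - 1"] by simp
  then show ?thesis
    by (intro denI[OF A z fil_zero[OF A]]) (use fil_zero[OF A] cyc_carrier[OF A z] in auto)
qed

lemma boundary_in_den:
  assumes A: "A \<in> Obj M" and w: "w \<in> \<F> (p + 1 - r) (n - 1) A" "d (n - 1) A w \<in> \<F> p n A"
  shows "d (n - 1) A w \<in> den r p n A"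
proof -
  interpret V: module k "FObj T n A" by (rule obj_space[OF A])
  show ?thesis
    by (rule denI[OF A module.submodule_zero[OF obj_space[OF A] cyc_sub[OF A]] w])
      (use fil_carrier[OF A w(2)] in simp)
qed

lemma den_le_cyc:
  assumes A: "A \<in> Obj M" shows "den r p n A \<subseteq> cyc r p n A"
proof
  fix x assume "x \<in> den r p n A"
  then obtain z w where zw: "z \<in> cyc (r - 1) (p + 1) n A" "w \<in> \<F> (p + 1 - r) (n - 1) A"
    "d (n - 1) A w \<in> \<F> p n A" "x = z \<oplus>\<^bsub>FObj T n A\<^esub> d (n - 1) A w"
    by (rule denE[OF A])
  have "z \<in> cyc r p n A"
    using zw(1) fil_antimono[OF A, of p "p + 1" z n] by (simp add: cyc_def)
  moreover have "d (n - 1) A w \<in> cyc r p n A"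
    using zw(3) d_d[OF A fil_carrier[OF A zw(2)]] fil_zero[OF A] by (simp add: cyc_def)
  ultimately show "x \<in> cyc r p n A"
    using zw(4) module.submoduleE(5)[OF obj_space cyc_sub] A by simp
qed

lemma cyc_prod:
  assumes "A \<in> Obj M" "B \<in> Obj M" "x \<in> cyc r p m A" "y \<in> cyc r q n B"
  shows "FProd T m n A B x y \<in> cyc r (p + q) (m + n) (A \<boxtimes> B)"
  using assms fil_prod[OF assms(1,2), of x p m y q n]
    fil_d_prod[OF assms(1,2), of x p m "p + r" y q n "q + r" "p + q + r"]
  by (simp add: cyc_def)

text \<open>
  The form in which products with boundaries arise: \<open>b\<close> is \<open>du\<close> up to an error \<open>v\<close> that is in the first
  summand of the denominator. Since \<open>b\<close> and \<open>v\<close> have filtration degree \<open>p\<close>, so has \<open>du\<close>.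
\<close>

lemma den_of_shifted_boundary:
  assumes A: "A \<in> Obj M" and z: "z \<in> cyc (r - 1) (p + 1) n A"
    and u: "u \<in> \<F> (p + 1 - r) (n - 1) A" and v: "v \<in> cyc (r - 1) (p + 1) n A"
    and b: "b \<in> \<F> p n A" "b = d (n - 1) A u \<ominus>\<^bsub>FObj T n A\<^esub> v"
  shows "z \<oplus>\<^bsub>FObj T n A\<^esub> b \<in> den r p n A"
proof -
  interpret V: module k "FObj T n A" by (rule obj_space[OF A])
  note c = cyc_carrier[OF A z] cyc_carrier[OF A v] d_into[OF A fil_carrier[OF A u]]
  have "d (n - 1) A u = b \<oplus>\<^bsub>FObj T n A\<^esub> v" using b(2) c by (simp add: V.diff_add_cancel)
  then have "d (n - 1) A u \<in> \<F> p n A"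
    using fil_add[OF A b(1)] fil_antimono[OF A, of p "p + 1"] v by (simp add: cyc_def)
  moreover have "z \<oplus>\<^bsub>FObj T n A\<^esub> b = (z \<ominus>\<^bsub>FObj T n A\<^esub> v) \<oplus>\<^bsub>FObj T n A\<^esub> d (n - 1) A u"
    using b(2) c by (simp add: V.M.minus_eq V.M.a_ac)
  ultimately show ?thesis
    using V.submodule_diff[OF cyc_sub[OF A] z v] u by (intro denI[OF A])
qed

text \<open>
  Let \<open>y = z + dw\<close>. The product \<open>x z\<close> belongs to the first summand of the denominator because \<open>z\<close> does. Up
  to signs, \<open>x dw\<close> is \<open>d (x w)\<close> minus \<open>dx w\<close>. Here \<open>x w\<close> is deep enough for the second summand, and
  \<open>dx w\<close> belongs to the first: \<open>dx\<close> lies \<open>r\<close> steps deeper than \<open>x\<close> and \<open>w\<close> only \<open>r - 1\<close> steps less deep than \<open>y\<close>.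
\<close>

lemma den_prod_right:
  assumes A: "A \<in> Obj M" and B: "B \<in> Obj M" and x: "x \<in> cyc r p m A" and y: "y \<in> den r q n B"
  shows "FProd T m n A B x y \<in> den r (p + q) (m + n) (A \<boxtimes> B)"
proof -
  note AB = tens_obj[OF A B]
  define V where "V = FObj T (m + n) (A \<boxtimes> B)"
  define U where "U = FObj T (m + n - 1) (A \<boxtimes> B)"
  obtain z w where zw: "z \<in> cyc (r - 1) (q + 1) n B" "w \<in> \<F> (q + 1 - r) (n - 1) B"
    "d (n - 1) B w \<in> \<F> q n B" "y = z \<oplus>\<^bsub>FObj T n B\<^esub> d (n - 1) B w"
    using y by (rule denE[OF B])
  have xc: "x \<in> carrier (FObj T m A)" "x \<in> \<F> p m A" "d m A x \<in> \<F> (p + r) (m + 1) A"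
    using x cyc_carrier[OF A] by (auto simp: cyc_def)
  have zc: "z \<in> \<F> (q + 1) n B" "d n B z \<in> \<F> (q + r) (n + 1) B"
    using zw(1) by (auto simp: cyc_def algebra_simps)
  have wc: "w \<in> carrier (FObj T (n - 1) B)" using zw(2) fil_carrier[OF B] by blast
  note b = prod_boundary_right[OF A B xc(1) wc, folded V_def U_def]
  let ?xz = "FProd T m n A B x z" and ?u = "alternate U m (FProd T m (n - 1) A B x w)"
  let ?v = "FProd T (m + 1) (n - 1) A B (d m A x) w"
  let ?dw = "d (n - 1) B w"
  have xz: "?xz \<in> cyc (r - 1) (p + q + 1) (m + n) (A \<boxtimes> B)"
    using fil_prod[OF A B xc(2) zc(1)]
      fil_d_prod[OF A B xc(2,3) zc, of "p + q + r"]
    by (simp add: cyc_def algebra_simps)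
  have u: "?u \<in> \<F> (p + q + 1 - r) (m + n - 1) (A \<boxtimes> B)"
    using fil_alternate[OF AB fil_prod[OF A B xc(2) zw(2)]] by (simp add: U_def algebra_simps)
  have xdw: "FProd T m n A B x ?dw \<in> \<F> (p + q) (m + n) (A \<boxtimes> B)"
    by (rule fil_prod[OF A B xc(2) zw(3)])
  have v1: "?v \<in> \<F> (p + q + 1) (m + n) (A \<boxtimes> B)"
    using fil_prod[OF A B xc(3) zw(2)] by (simp add: algebra_simps)
  have dx0: "d (m + 1) A (d m A x) \<in> \<F> s (m + 1 + 1) A" for s
    using d_square[OF A xc(1)] fil_zero[OF A, of "m + 1 + 1"] by simp
  have dw': "d (n - 1) B w \<in> \<F> q (n - 1 + 1) B" using zw(3) by simp
  have v2: "d (m + n) (A \<boxtimes> B) ?v \<in> \<F> (p + q + r) (m + n + 1) (A \<boxtimes> B)"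
    \<comment> \<open>\<open>d dx = 0\<close> may be placed in step \<open>p + 2r - 1\<close>, which puts \<open>d dx w\<close> in step \<open>p + q + r\<close>\<close>
    using fil_d_prod[OF A B xc(3) dx0 zw(2) dw', of "p + q + r" "p + 2 * r - 1"] by (simp add: algebra_simps)
  have "?v \<in> cyc (r - 1) (p + q + 1) (m + n) (A \<boxtimes> B)"
    using v1 v2 by (simp add: cyc_def add.assoc)
  then have v: "alternate V m ?v \<in> cyc (r - 1) (p + q + 1) (m + n) (A \<boxtimes> B)"
    unfolding V_def by (rule submodule_alternate[OF obj_space[OF AB] cyc_sub[OF AB]])
  have "FProd T m n A B x y = ?xz \<oplus>\<^bsub>V\<^esub> FProd T m n A B x ?dw"
    unfolding zw(4) V_def
    by (rule linear_map_add[OF prod_linear_right[OF A B xc(1)] fil_carrier[OF B zc(1)] fil_carrier[OF B zw(3)]])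
  then show ?thesis
    using den_of_shifted_boundary[OF AB xz u v xdw] b(1) by (simp add: V_def)
qed

text \<open>
  The mirror image of \<open>den_prod_right\<close>, starting from \<open>d (w y) = dw y \<plusminus> w dy\<close>.
\<close>

lemma den_prod_left:
  assumes A: "A \<in> Obj M" and B: "B \<in> Obj M" and x: "x \<in> den r p m A" and y: "y \<in> cyc r q n B"
  shows "FProd T m n A B x y \<in> den r (p + q) (m + n) (A \<boxtimes> B)"
proof -
  note AB = tens_obj[OF A B]
  define V where "V = FObj T (m + n) (A \<boxtimes> B)"
  define U where "U = FObj T (m + n - 1) (A \<boxtimes> B)"
  obtain z w where zw: "z \<in> cyc (r - 1) (p + 1) m A" "w \<in> \<F> (p + 1 - r) (m - 1) A"
    "d (m - 1) A w \<in> \<F> p m A" "x = z \<oplus>\<^bsub>FObj T m A\<^esub> d (m - 1) A w"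
    using x by (rule denE[OF A])
  have yc: "y \<in> carrier (FObj T n B)" "y \<in> \<F> q n B" "d n B y \<in> \<F> (q + r) (n + 1) B"
    using y cyc_carrier[OF B] by (auto simp: cyc_def)
  have zc: "z \<in> \<F> (p + 1) m A" "d m A z \<in> \<F> (p + r) (m + 1) A"
    using zw(1) by (auto simp: cyc_def algebra_simps)
  have wc: "w \<in> carrier (FObj T (m - 1) A)" using zw(2) fil_carrier[OF A] by blast
  note b = prod_boundary_left[OF A B wc yc(1), folded V_def U_def]
  let ?zy = "FProd T m n A B z y" and ?u = "FProd T (m - 1) n A B w y"
  let ?v = "FProd T (m - 1) (n + 1) A B w (d n B y)"
  let ?dw = "d (m - 1) A w"
  have zy: "?zy \<in> cyc (r - 1) (p + q + 1) (m + n) (A \<boxtimes> B)"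
    using fil_prod[OF A B zc(1) yc(2)]
      fil_d_prod[OF A B zc yc(2,3), of "p + q + r"]
    by (simp add: cyc_def algebra_simps)
  have u: "?u \<in> \<F> (p + q + 1 - r) (m + n - 1) (A \<boxtimes> B)"
    using fil_prod[OF A B zw(2) yc(2)] by (simp add: algebra_simps)
  have dwy: "FProd T m n A B ?dw y \<in> \<F> (p + q) (m + n) (A \<boxtimes> B)"
    by (rule fil_prod[OF A B zw(3) yc(2)])
  have v1: "?v \<in> \<F> (p + q + 1) (m + n) (A \<boxtimes> B)"
    using fil_prod[OF A B zw(2) yc(3)] by (simp add: algebra_simps)
  have dy0: "d (n + 1) B (d n B y) \<in> \<F> s (n + 1 + 1) B" for s
    using d_square[OF B yc(1)] fil_zero[OF B, of "n + 1 + 1"] by simp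
  have dw': "d (m - 1) A w \<in> \<F> p (m - 1 + 1) A" using zw(3) by simp
  have v2: "d (m + n) (A \<boxtimes> B) ?v \<in> \<F> (p + q + r) (m + n + 1) (A \<boxtimes> B)"
    \<comment> \<open>\<open>d dy = 0\<close> may be placed in step \<open>q + 2r - 1\<close>, which puts \<open>w d dy\<close> in step \<open>p + q + r\<close>\<close>
    using fil_d_prod[OF A B zw(2) dw' yc(3) dy0, of "p + q + r" "q + 2 * r - 1"] by (simp add: algebra_simps)
  have "?v \<in> cyc (r - 1) (p + q + 1) (m + n) (A \<boxtimes> B)"
    using v1 v2 by (simp add: cyc_def add.assoc)
  then have v: "alternate V (m - 1) ?v \<in> cyc (r - 1) (p + q + 1) (m + n) (A \<boxtimes> B)"
    unfolding V_def by (rule submodule_alternate[OF obj_space[OF AB] cyc_sub[OF AB]])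
  have "FProd T m n A B x y = ?zy \<oplus>\<^bsub>V\<^esub> FProd T m n A B ?dw y"
    unfolding zw(4) V_def
    by (rule linear_map_add[OF prod_linear_left[OF A B yc(1)] fil_carrier[OF A zc(1)] fil_carrier[OF A zw(3)]])
  then show ?thesis
    using den_of_shifted_boundary[OF AB zy u v dwy] b(1) by (simp add: V_def)
qed

lemma cyc_mono: "\<lbrakk>A \<in> Obj M; r \<le> r'; x \<in> cyc r' p n A\<rbrakk> \<Longrightarrow> x \<in> cyc r p n A"
  using fil_antimono[of A "p + r" "p + r'"] by (simp add: cyc_def)

lemma d_cyc:
  assumes A: "A \<in> Obj M" and x: "x \<in> cyc r p n A" shows "d n A x \<in> cyc r' (p + r) (n + 1) A"
  using x d_square[OF A cyc_carrier[OF A x]] fil_zero[OF A, of "n + 1 + 1"] by (simp add: cyc_def)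

text \<open>
  The summand \<open>dw\<close> of an element \<open>z + dw\<close> of the denominator is killed by \<open>d\<close>, and \<open>dz\<close> belongs to the
  second summand of the denominator in filtration degree \<open>p + r\<close>.
\<close>

lemma d_den:
  assumes A: "A \<in> Obj M" and x: "x \<in> den r p n A" shows "d n A x \<in> den r (p + r) (n + 1) A"
proof -
  obtain z w where zw: "z \<in> cyc (r - 1) (p + 1) n A" "w \<in> \<F> (p + 1 - r) (n - 1) A"
    "d (n - 1) A w \<in> \<F> p n A" "x = z \<oplus>\<^bsub>FObj T n A\<^esub> d (n - 1) A w"
    using x by (rule denE[OF A])
  interpret W: module k "FObj T (n + 1) A" by (rule obj_space[OF A])
  have "d n A x = d n A z"
    using zw d_add[OF A, of z n "d (n - 1) A w"] d_d[OF A, of w n] fil_carrier[OF A]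
      cyc_carrier[OF A zw(1)] d_closed[OF A] by simp
  moreover have "d (n + 1 - 1) A z \<in> den r (p + r) (n + 1) A"
    by (rule boundary_in_den[OF A]) (use zw(1) in \<open>simp_all add: cyc_def\<close>)
  ultimately show ?thesis by simp
qed

text \<open>
  Naturality of \<open>d\<close> makes numerator and denominator subfunctors; closure under products and the ideal property are
  \<open>cyc_prod\<close>, \<open>den_prod_left\<close> and \<open>den_prod_right\<close>.
\<close>

lemma page_subquotient: "lax_subquotient k M (bigrade T) (numer r) (denom r)"
proof (intro lax_subquotient.intro lax_subquotient_axioms.intro linear_monoidal_abelian_category_axioms
    bigrade_lax graded_lax_functor_axioms, unfold fil_Z_eq fil_denom_eq bigrade_simps, goal_cases)
  case (1 A g) then show ?case by (rule cyc_sub)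
next
  case (2 A g) then show ?case by (rule den_sub)
next
  case (3 A g) then show ?case by (rule den_le_cyc)
next
  case (4 A B f x g)
  then show ?case using fil_mor d_natural[OF 4(1-3) cyc_carrier[OF 4(1,4)]] by (simp add: cyc_def)
next
  case (5 A B f x g)
  let ?n = "total_degree g"
  obtain z w where zw: "z \<in> cyc (r - 1) (fst g + 1) ?n A" "w \<in> \<F> (fst g + 1 - r) (?n - 1) A"
    "d (?n - 1) A w \<in> \<F> (fst g) ?n A" "x = z \<oplus>\<^bsub>FObj T ?n A\<^esub> d (?n - 1) A w"
    using 5(4) by (rule denE[OF 5(1)])
  have w: "w \<in> carrier (FObj T (?n - 1) A)" using zw(2) fil_carrier 5 by blast
  have dw: "FMor T ?n f (d (?n - 1) A w) = d (?n - 1) B (FMor T (?n - 1) f w)"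
    using d_natural[OF 5(1-3) w] by simp
  show ?case
  proof (rule denI[OF 5(2)])
    show "FMor T ?n f z \<in> cyc (r - 1) (fst g + 1) ?n B"
      using zw(1) fil_mor[OF 5(1-3)] d_natural[OF 5(1-3) cyc_carrier[OF 5(1) zw(1)]] by (simp add: cyc_def)
    show "FMor T (?n - 1) f w \<in> \<F> (fst g + 1 - r) (?n - 1) B"
      using zw(2) fil_mor[OF 5(1-3)] by simp
    show "d (?n - 1) B (FMor T (?n - 1) f w) \<in> \<F> (fst g) ?n B"
      using fil_mor[OF 5(1-3) zw(3)] dw by simp
    show "FMor T ?n f x = FMor T ?n f z \<oplus>\<^bsub>FObj T ?n B\<^esub> d (?n - 1) B (FMor T (?n - 1) f w)"
      unfolding zw(4) dw[symmetric]
      by (rule linear_map_add[OF mor_linear[OF 5(1-3)] cyc_carrier[OF 5(1) zw(1)] fil_carrier[OF 5(1) zw(3)]])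
  qed
next
  case (6 A B x g y h) then show ?case using cyc_prod by simp
next
  case (7 A B x g y h) then show ?case using den_prod_left by simp
next
  case (8 A B x g y h) then show ?case using den_prod_right by simp
next
  case 9
  show ?case
    using fil_unit d_unit fil_zero[OF unit_obj, of 1] by (simp add: cyc_def)
qed

definition page_cls :: "int \<Rightarrow> int \<times> int \<Rightarrow> 'o \<Rightarrow> 'v \<Rightarrow> 'v set" where
  "page_cls r g A x = x <+\<^bsub>FObj (bigrade T) g A\<^esub> denom r g A"

lemma page_presentation:
  "lax_presentation k M (bigrade T) (numer r) (denom r) (page r) (page_cls r)"
  using lax_subquotient.presentation[OF page_subquotient[of r]]
  unfolding fil_page_def page_cls_def[abs_def] .

interpretation P: lax_presentation k M "bigrade T" "numer r" "denom r"
  "page r" "page_cls r" for r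
  by (rule page_presentation)

text \<open>
  The differential of the page is induced by \<open>d\<close>, since \<open>d\<close> maps denominators to denominators.
\<close>

lemma page_d_eq:
  assumes A: "A \<in> Obj M" and x: "x \<in> numer r g A"
  shows "page_d r g A (page_cls r g A x) = page_cls r (g + (r, 1 - r)) A (d (total_degree g) A x)"
proof -
  let ?n = "total_degree g" and ?h = "g + (r, 1 - r)"
  have eq: "page_d r g A X = (\<Union>x\<in>X. page_cls r ?h A (d ?n A x))" for X
    by (cases g) (simp add: fil_diff_def page_cls_def bigrade_simps algebra_simps)
  have "page_cls r ?h A (d ?n A y) = page_cls r ?h A (d ?n A x)" if "y \<in> page_cls r g A x" for y
  proof -
    note y = P.mem_cls[OF A x, of y, folded page_cls_def, OF that]
    have Z: "d ?n A y \<in> numer r ?h A" "d ?n A x \<in> numer r ?h A"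
      using x y(1) d_cyc[OF A] by (auto simp: fil_Z_eq)
    have "d ?n A y \<ominus>\<^bsub>FObj T (?n + 1) A\<^esub> d ?n A x = d ?n A (y \<ominus>\<^bsub>FObj T ?n A\<^esub> x)"
      using d_diff[OF A] x y(1) cyc_carrier[OF A] by (auto simp: fil_Z_eq)
    also have "\<dots> \<in> den r (fst g + r) (?n + 1) A"
      using y(2) by (intro d_den[OF A]) (simp add: fil_denom_eq bigrade_simps)
    finally show ?thesis
      unfolding P.pr_eq_iff[OF A Z] by (simp add: fil_denom_eq bigrade_simps)
  qed
  then show ?thesis
    unfolding eq using P.self_in_cls[OF A x, folded page_cls_def] by (rule UN_const_on[rotated])
qed

text \<open>
  All identities are inherited from \<open>d\<close> by choosing representatives.
\<close>

theorem page_differential: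
  "bigraded_differential_functor k M (r, 1 - r) (page r) (page_d r)"
proof -
  have dZ: "d (total_degree g) A x \<in> numer r (g + (r, 1 - r)) A"
    if "A \<in> Obj M" "x \<in> numer r g A" for g A x
    using that d_cyc by (simp add: fil_Z_eq)
  have deg: "total_degree (g + (r, 1 - r)) = total_degree g + 1" for g by simp
  show ?thesis
  proof (intro bigraded_differential_functor.intro bigraded_differential_functor_axioms.intro
      P.G_lax, goal_cases)
    case (1 A g)
    show ?case
      by (rule P.induced_linear[OF 1 1, where f = "d (total_degree g) A"])
        (use 1 d_linear page_d_eq dZ in \<open>auto simp: bigrade_simps\<close>)
  next
    case (2 A B f x g)
    obtain a where a: "a \<in> numer r g A" "x = page_cls r g A a" by (rule P.carrierE[OF 2(1,4)])
    have "FMor (bigrade T) g f a \<in> numer r g B" using P.Z_mor[OF 2(1-3) a(1)] .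
    then show ?case
      using a 2 P.pr_mor[OF 2(1-3) a(1)] P.pr_mor[OF 2(1-3) dZ[OF 2(1) a(1)]]
        d_natural[OF 2(1-3)] P.Z_carrier[OF 2(1) a(1)]
      by (simp add: page_d_eq bigrade_simps flip: P.pr_mor)
  next
    case (3 A x g)
    obtain a where a: "a \<in> numer r g A" "x = page_cls r g A a" by (rule P.carrierE[OF 3])
    have "d (total_degree g + 1) A (d (total_degree g) A a) = \<zero>\<^bsub>FObj T (total_degree g + 1 + 1) A\<^esub>"
      using P.Z_carrier[OF 3(1) a(1)] d_square[OF 3(1)] by (simp add: bigrade_simps)
    then show ?case
      using a page_d_eq[OF 3(1) a(1)] page_d_eq[OF 3(1) dZ[OF 3(1) a(1)]]
        P.pr_zero[OF 3(1), where g = "g + (r, 1 - r) + (r, 1 - r)"]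
      by (simp add: bigrade_simps)
  next
    case (4 A B x p q y h)
    obtain a where a: "a \<in> numer r (p, q) A" "x = page_cls r (p, q) A a" by (rule P.carrierE[OF 4(1,3)])
    obtain b where b: "b \<in> numer r h B" "y = page_cls r h B b" by (rule P.carrierE[OF 4(2,4)])
    note AB = tens_obj[OF 4(1,2)]
    let ?g = "(p, q)" and ?\<delta> = "(r, 1 - r)"
    note dab = P.Z_prod[OF 4(1,2) dZ[OF 4(1) a(1)] b(1)] and adb = P.Z_prod[OF 4(1,2) a(1) dZ[OF 4(2) b(1)]]
    have ix: "?g + ?\<delta> + h = ?g + h + ?\<delta>" "?g + (h + ?\<delta>) = ?g + h + ?\<delta>"
      by (simp_all add: algebra_simps)
    let ?k = "?g + h + ?\<delta>"
    let ?u = "FProd (bigrade T) (?g + ?\<delta>) h A B (d (p + q) A a) b"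
    let ?v = "FProd (bigrade T) ?g (h + ?\<delta>) A B a (d (total_degree h) B b)"
    have u: "?u \<in> numer r ?k (A \<boxtimes> B)" and v: "?v \<in> numer r ?k (A \<boxtimes> B)"
      using dab adb unfolding ix by simp_all
    have av: "alternate (FObj (bigrade T) ?k (A \<boxtimes> B)) (p + q) ?v \<in> numer r ?k (A \<boxtimes> B)"
      by (rule submodule_alternate[OF P.obj_space[OF AB] P.Z_sub[OF AB] v])
    have "page_d r (?g + h) (A \<boxtimes> B) (FProd (page r) ?g h A B x y)
      = page_d r (?g + h) (A \<boxtimes> B) (page_cls r (?g + h) (A \<boxtimes> B) (FProd (bigrade T) ?g h A B a b))"
      using P.pr_prod[OF 4(1,2) a(1) b(1)] a b by simp
    also have "\<dots> = page_cls r ?k (A \<boxtimes> B) (d (p + q + total_degree h) (A \<boxtimes> B) (FProd (bigrade T) ?g h A B a b))"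
      using page_d_eq[OF AB P.Z_prod[OF 4(1,2) a(1) b(1)]] by simp
    also have "d (p + q + total_degree h) (A \<boxtimes> B) (FProd (bigrade T) ?g h A B a b)
        = ?u \<oplus>\<^bsub>FObj (bigrade T) ?k (A \<boxtimes> B)\<^esub> alternate (FObj (bigrade T) ?k (A \<boxtimes> B)) (p + q) ?v"
      using d_leibniz[OF 4(1,2) P.Z_carrier[OF 4(1) a(1), unfolded bigrade_simps]
          P.Z_carrier[OF 4(2) b(1), unfolded bigrade_simps]]
      by (simp add: bigrade_simps algebra_simps)
    also have "page_cls r ?k (A \<boxtimes> B) \<dots> = page_cls r ?k (A \<boxtimes> B) ?u \<oplus>\<^bsub>FObj (page r) ?k (A \<boxtimes> B)\<^esub>
        alternate (FObj (page r) ?k (A \<boxtimes> B)) (p + q) (page_cls r ?k (A \<boxtimes> B) ?v)"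
      by (simp only: P.pr_add[OF AB u av] P.pr_alternate[OF AB v])
    also have "page_cls r ?k (A \<boxtimes> B) ?u = FProd (page r) (?g + ?\<delta>) h A B (page_d r ?g A x) y"
      using P.pr_prod[OF 4(1,2) dZ[OF 4(1) a(1)] b(1)] page_d_eq[OF 4(1) a(1)] a b unfolding ix by simp
    also have "page_cls r ?k (A \<boxtimes> B) ?v = FProd (page r) ?g (h + ?\<delta>) A B x (page_d r h B y)"
      using P.pr_prod[OF 4(1,2) a(1) dZ[OF 4(2) b(1)]] page_d_eq[OF 4(2) b(1)] a b unfolding ix by simp
    finally show ?case .
  next
    case 5
    have "page_d r 0 (UnitO M) (FUnit (page r)) = page_cls r (r, 1 - r) (UnitO M) (d 0 (UnitO M) (FUnit T))"
      using page_d_eq[OF unit_obj P.Z_unit] by (simp add: P.pr_unit[symmetric] bigrade_simps)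
    also have "\<dots> = \<zero>\<^bsub>FObj (page r) (r, 1 - r) (UnitO M)\<^esub>"
      using P.pr_zero[OF unit_obj, where g = "(r, 1 - r)"] by (simp add: d_unit bigrade_simps)
    finally show ?case .
  qed
qed

text \<open>
  If the class of \<open>x\<close> on page \<open>r\<close> is a cycle, then \<open>dx = z + dw\<close> with \<open>z\<close> one step deeper than required and
  \<open>w \<in> \<F>\<^sup>p\<^sup>+\<^sup>1\<close>. The representative \<open>x - w\<close> has differential \<open>z\<close>, hence survives to page \<open>r + 1\<close>.
\<close>

lemma cyc_lift:
  assumes A: "A \<in> Obj M" and x: "x \<in> cyc r p n A" and dx: "d n A x \<in> den r (p + r) (n + 1) A"
  obtains x' where "x' \<in> cyc (r + 1) p n A" "x \<ominus>\<^bsub>FObj T n A\<^esub> x' \<in> cyc (r - 1) (p + 1) n A"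
proof -
  interpret V: module k "FObj T n A" by (rule obj_space[OF A])
  interpret W: module k "FObj T (n + 1) A" by (rule obj_space[OF A])
  obtain z w where zw: "z \<in> cyc (r - 1) (p + r + 1) (n + 1) A" "w \<in> \<F> (p + r + 1 - r) (n + 1 - 1) A"
    "d (n + 1 - 1) A w \<in> \<F> (p + r) (n + 1) A" "d n A x = z \<oplus>\<^bsub>FObj T (n + 1) A\<^esub> d (n + 1 - 1) A w"
    using dx by (rule denE[OF A])
  have w: "w \<in> \<F> (p + 1) n A" "d n A w \<in> \<F> (p + r) (n + 1) A" using zw by simp_all
  note c = cyc_carrier[OF A x] fil_carrier[OF A w(1)] cyc_carrier[OF A zw(1)] fil_carrier[OF A w(2)]
  have "d n A (x \<ominus>\<^bsub>FObj T n A\<^esub> w) = z"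
    using d_diff[OF A c(1,2)] zw(4) c W.add_diff_cancel'[OF c(3,4)] by simp
  then have "x \<ominus>\<^bsub>FObj T n A\<^esub> w \<in> cyc (r + 1) p n A"
    using x zw(1) fil_diff_closed[OF A] fil_antimono[OF A _ w(1), of p] by (simp add: cyc_def add.assoc)
  moreover have "x \<ominus>\<^bsub>FObj T n A\<^esub> (x \<ominus>\<^bsub>FObj T n A\<^esub> w) = w"
    using c by (simp add: V.group_simps)
  then have "x \<ominus>\<^bsub>FObj T n A\<^esub> (x \<ominus>\<^bsub>FObj T n A\<^esub> w) \<in> cyc (r - 1) (p + 1) n A"
    using w by (simp add: cyc_def)
  ultimately show ?thesis by (rule that)
qed

lemma d_den_if_cyc:
  assumes A: "A \<in> Obj M" and x: "x \<in> cyc (r + 1) p n A" shows "d n A x \<in> den r (p + r) (n + 1) A"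
  using d_cyc[OF A x, of "r - 1"] by (intro cyc_in_den[OF A]) (simp add: add.assoc)

lemma page_d_zero_iff:
  assumes A: "A \<in> Obj M" and x: "x \<in> numer r g A"
  shows "page_d r g A (page_cls r g A x) = \<zero>\<^bsub>FObj (page r) (g + (r, 1 - r)) A\<^esub> \<longleftrightarrow>
    d (total_degree g) A x \<in> den r (fst g + r) (total_degree g + 1) A"
proof -
  have "d (total_degree g) A x \<in> numer r (g + (r, 1 - r)) A"
    using x d_cyc[OF A] by (simp add: fil_Z_eq)
  from lax_presentation.pr_zero_iff[OF page_presentation A this] show ?thesis
    using page_d_eq[OF A x] by (simp add: fil_denom_eq)
qed

lemma page_cycles:
  assumes A: "A \<in> Obj M"
  shows "{X \<in> carrier (FObj (page r) g A). page_d r g A X =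
      \<zero>\<^bsub>FObj (page r) (g + (r, 1 - r)) A\<^esub>} = page_cls r g A ` numer (r + 1) g A"
proof -
  let ?n = "total_degree g"
  note d0 = page_d_zero_iff[OF A]
  show ?thesis
  proof (intro equalityI subsetI)
    fix X assume X: "X \<in> {X \<in> carrier (FObj (page r) g A). page_d r g A X =
      \<zero>\<^bsub>FObj (page r) (g + (r, 1 - r)) A\<^esub>}"
    then have "X \<in> carrier (FObj (page r) g A)" by simp
    from P.carrierE[OF A this] obtain x where x: "x \<in> numer r g A" "X = page_cls r g A x" .
    then have "d ?n A x \<in> den r (fst g + r) (?n + 1) A" using X d0 by simp
    then obtain x' where x': "x' \<in> cyc (r + 1) (fst g) ?n A"
      "x \<ominus>\<^bsub>FObj T ?n A\<^esub> x' \<in> cyc (r - 1) (fst g + 1) ?n A"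
      using x(1) by (auto simp: fil_Z_eq elim: cyc_lift[OF A])
    have "X = page_cls r g A x'"
      using x x' cyc_mono[OF A, of r "r + 1"] P.pr_eq_iff[OF A x(1), of x'] cyc_in_den[OF A x'(2)]
      by (simp add: fil_Z_eq fil_denom_eq bigrade_simps)
    then show "X \<in> page_cls r g A ` numer (r + 1) g A" using x'(1) by (simp add: fil_Z_eq)
  next
    fix X assume "X \<in> page_cls r g A ` numer (r + 1) g A"
    then obtain x where x: "x \<in> cyc (r + 1) (fst g) ?n A" "X = page_cls r g A x"
      by (auto simp: fil_Z_eq)
    have "x \<in> numer r g A" using x(1) cyc_mono[OF A, of r "r + 1"] by (simp add: fil_Z_eq)
    then show "X \<in> {X \<in> carrier (FObj (page r) g A). page_d r g A X =
      \<zero>\<^bsub>FObj (page r) (g + (r, 1 - r)) A\<^esub>}"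
      using x d0 P.pr_closed[OF A] d_den_if_cyc[OF A x(1)] by simp
  qed
qed

lemma page_boundaries:
  assumes A: "A \<in> Obj M"
  shows "page_d r (g - (r, 1 - r)) A ` carrier (FObj (page r) (g - (r, 1 - r)) A) =
    page_cls r g A ` denom (r + 1) g A"
proof -
  let ?n = "total_degree g" and ?p = "fst g"
  let ?h = "g - (r, 1 - r)"
  have deg: "total_degree ?h = ?n - 1" "fst ?h = ?p - r" by (simp_all add: total_degree_def)
  have "page_d r ?h A ` carrier (FObj (page r) ?h A)
      = (\<lambda>x. page_d r ?h A (page_cls r ?h A x)) ` numer r ?h A"
    by (simp add: P.pr_onto[OF A, symmetric] image_image)
  also have "\<dots> = (\<lambda>x. page_cls r g A (d (?n - 1) A x)) ` numer r ?h A"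
    using page_d_eq[OF A, of _ r ?h] by (intro image_cong) (simp_all add: deg)
  also have "\<dots> = (\<lambda>x. page_cls r g A (d (?n - 1) A x)) ` cyc r (?p - r) (?n - 1) A"
    by (simp add: fil_Z_eq deg)
  also have "\<dots> = page_cls r g A ` denom (r + 1) g A"
  proof (intro equalityI subsetI; elim imageE)
    fix X x assume X: "X = page_cls r g A (d (?n - 1) A x)" and x: "x \<in> cyc r (?p - r) (?n - 1) A"
    have "d (?n - 1) A x \<in> den (r + 1) ?p ?n A"
      by (rule boundary_in_den[OF A]) (use x in \<open>simp_all add: cyc_def\<close>)
    then show "X \<in> page_cls r g A ` denom (r + 1) g A"
      using X by (simp add: fil_denom_eq)
  next
    fix X x assume X: "X = page_cls r g A x" and "x \<in> denom (r + 1) g A"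
    then have "x \<in> den (r + 1) ?p ?n A" by (simp add: fil_denom_eq)
    then obtain z w where zw: "z \<in> cyc (r + 1 - 1) (?p + 1) ?n A" "w \<in> \<F> (?p + 1 - (r + 1)) (?n - 1) A"
      "d (?n - 1) A w \<in> \<F> ?p ?n A" "x = z \<oplus>\<^bsub>FObj T ?n A\<^esub> d (?n - 1) A w"
      by (rule denE[OF A])
    interpret V: module k "FObj T ?n A" by (rule obj_space[OF A])
    have w: "w \<in> cyc r (?p - r) (?n - 1) A" using zw(2,3) by (simp add: cyc_def)
    have z: "z \<in> den r ?p ?n A"
      using zw(1) cyc_mono[OF A, of "r - 1" r] by (intro cyc_in_den[OF A]) simp
    have dw: "d (?n - 1) A w \<in> numer r g A"
      using d_cyc[OF A w, of r] by (simp add: fil_Z_eq)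
    have zZ: "z \<in> numer r g A" using z den_le_cyc[OF A] by (auto simp: fil_Z_eq)
    have "page_cls r g A x = page_cls r g A (d (?n - 1) A w)"
      using P.pr_eq_iff[OF A P.Z_add[OF A zZ dw] dw] z zw
        V.add_diff_cancel'[OF cyc_carrier[OF A zw(1)] fil_carrier[OF A zw(3)]]
      by (simp add: bigrade_simps fil_denom_eq)
    then show "X \<in> (\<lambda>x. page_cls r g A (d (?n - 1) A x)) ` cyc r (?p - r) (?n - 1) A"
      using X w by auto
  qed
  finally show ?thesis .
qed

definition page_boundary :: "int \<Rightarrow> int \<times> int \<Rightarrow> 'o \<Rightarrow> 'v set set" where
  "page_boundary r g A =
    page_d r (g - (r, 1 - r)) A ` carrier (FObj (page r) (g - (r, 1 - r)) A)"

text \<open>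
  In view of \<open>page_cycles\<close> and \<open>page_boundaries\<close> the cohomology of page \<open>r\<close> is a subquotient of page \<open>r\<close> by
  images of the numerator and the denominator of page \<open>r + 1\<close>. What the third isomorphism theorem asks
  for is that an element of the numerator of page \<open>r + 1\<close> that vanishes on page \<open>r\<close> vanishes on page
  \<open>r + 1\<close>: if \<open>x = z + dw\<close>, then \<open>dz = dx\<close> is deep enough for \<open>z\<close> to be in the denominator there.
\<close>

lemma page_cohomology_presentation:
  "lax_presentation k M (bigrade T) (numer (r + 1)) (denom (r + 1))
    (cohomology M (r, 1 - r) (page r) (page_d r))
    (\<lambda>g A x. page_cls r g A x <+\<^bsub>FObj (page r) g A\<^esub> page_boundary r g A)"
  unfolding cohomology_def page_boundary_def
proof (rule lax_presentation.subquotient_presentation[OF page_presentation page_subquotient], goal_cases)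
  case (1 g A) then show ?case using cyc_mono[OF 1, of r "r + 1"] by (auto simp: fil_Z_eq)
next
  case (2 g A x)
  let ?n = "total_degree g" and ?p = "fst g"
  have x: "x \<in> cyc (r + 1) ?p ?n A" "x \<in> den r ?p ?n A" using 2 by (simp_all add: fil_Z_eq fil_denom_eq)
  obtain z w where zw: "z \<in> cyc (r - 1) (?p + 1) ?n A" "w \<in> \<F> (?p + 1 - r) (?n - 1) A"
    "d (?n - 1) A w \<in> \<F> ?p ?n A" "x = z \<oplus>\<^bsub>FObj T ?n A\<^esub> d (?n - 1) A w"
    using x(2) by (rule denE[OF 2(1)])
  interpret W: module k "FObj T (?n + 1) A" by (rule obj_space[OF 2(1)])
  have "d ?n A x = d ?n A z"
    using zw d_add[OF 2(1), of z ?n "d (?n - 1) A w"] d_d[OF 2(1), of w ?n] fil_carrier[OF 2(1)]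
      cyc_carrier[OF 2(1) zw(1)] d_closed[OF 2(1)] by simp
  then have "z \<in> cyc (r + 1 - 1) (?p + 1) ?n A"
    using x(1) zw(1) by (simp add: cyc_def ac_simps)
  moreover have "w \<in> \<F> (?p + 1 - (r + 1)) (?n - 1) A"
    using fil_antimono[OF 2(1) _ zw(2)] by simp
  ultimately have "x \<in> den (r + 1) ?p ?n A" using denI[OF 2(1) _ _ zw(3,4)] by blast
  then show ?case by (simp add: fil_denom_eq)
next
  case (3 g A) then show ?case by (rule page_cycles)
next
  case (4 g A) then show ?case by (rule page_boundaries)
qed

lemma fil_iso_eq:
  assumes A: "A \<in> Obj M" and x: "x \<in> numer (r + 1) g A"
  shows "page_iso r g A (page_cls r g A x <+\<^bsub>FObj (page r) g A\<^esub> page_boundary r g A) =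
    page_cls (r + 1) g A x"
proof -
  interpret Q: lax_presentation k M "bigrade T" "numer (r + 1)" "denom (r + 1)"
    "cohomology M (r, 1 - r) (page r) (page_d r)"
    "\<lambda>g A x. page_cls r g A x <+\<^bsub>FObj (page r) g A\<^esub> page_boundary r g A"
    by (rule page_cohomology_presentation)
  interpret V: module k "FObj T (total_degree g) A" by (rule obj_space[OF A])
  interpret E: module k "FObj (page r) g A" by (rule P.G_space[OF A])
  have le: "numer (r + 1) g A \<subseteq> numer r g A"
    using cyc_mono[OF A, of r "r + 1"] by (auto simp: fil_Z_eq)
  have B: "submodule (page_boundary r g A) k (FObj (page r) g A)"
    unfolding page_boundary_def page_boundaries[OF A]
    by (rule P.image_submodule[OF A P.N_sub[OF A]]) (use P.N_le_Z[OF A, of "r + 1" g] le in blast)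
  have mem: "page_cls r g A y \<in> page_cls r g A x <+\<^bsub>FObj (page r) g A\<^esub> page_boundary r g A
      \<longleftrightarrow> y \<ominus>\<^bsub>FObj T (total_degree g) A\<^esub> x \<in> denom (r + 1) g A"
    if y: "y \<in> numer (r + 1) g A" for y
  proof -
    have c: "page_cls r g A y \<in> carrier (FObj (page r) g A)"
        "page_cls r g A x \<in> carrier (FObj (page r) g A)"
      using P.pr_closed[OF A subsetD[OF le x]] P.pr_closed[OF A subsetD[OF le y]] by simp_all
    then show ?thesis
      using E.mem_l_coset[OF B c(2), of "page_cls r g A y"] E.l_coset_eq_iff[OF B c] Q.pr_eq_iff[OF A y x]
      by (simp add: bigrade_simps)
  qed
  have "page_iso r g A X = {y \<in> numer (r + 1) g A. page_cls r g A y \<in> X}" for X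
    by (cases g) (simp add: fil_iso_def page_cls_def bigrade_simps)
  then show ?thesis
    using mem P.mem_cls[OF A x] V.mem_l_coset[OF P.N_sub[OF A, unfolded bigrade_simps] P.Z_carrier[OF A x, unfolded bigrade_simps]]
      P.Z_carrier[OF A, of _ "r + 1" g]
    by (auto simp: page_cls_def[of "r + 1"] bigrade_simps)
qed

theorem fil_spectral_sequence:
  "functorial_mult_spectral_sequence k M a page page_d page_iso"
  by (intro functorial_mult_spectral_sequence.intro page_differential
      presentations_isomorphic[OF page_cohomology_presentation page_presentation] fil_iso_eq)

section \<open>Convergence\<close>

definition cocycles :: "int \<Rightarrow> 'o \<Rightarrow> 'v set" where
  "cocycles n A = {x \<in> carrier (FObj T n A). d n A x = \<zero>\<^bsub>FObj T (n + 1) A\<^esub>}"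

definition coboundaries :: "int \<Rightarrow> 'o \<Rightarrow> 'v set" where
  "coboundaries n A = d (n - 1) A ` carrier (FObj T (n - 1) A)"

lemma cocycles_sub: "A \<in> Obj M \<Longrightarrow> submodule (cocycles n A) k (FObj T n A)"
  using submodule_vimage[OF obj_space obj_space d_linear module.carrier_is_submodule[OF obj_space]
      submodule_zero_set[OF obj_space]]
  by (simp add: cocycles_def)

lemma coboundaries_sub: "A \<in> Obj M \<Longrightarrow> submodule (coboundaries n A) k (FObj T n A)"
  unfolding coboundaries_def
  by (rule submodule_image[OF obj_space obj_space d_linear_into module.carrier_is_submodule[OF obj_space]])

lemma coboundaries_le: "A \<in> Obj M \<Longrightarrow> coboundaries n A \<subseteq> cocycles n A"
  using d_into d_d by (auto simp: cocycles_def coboundaries_def)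

lemma cocycles_carrier: "x \<in> cocycles n A \<Longrightarrow> x \<in> carrier (FObj T n A)"
  by (simp add: cocycles_def)

lemma cocycles_mor:
  "\<lbrakk>A \<in> Obj M; B \<in> Obj M; f \<in> carrier (Hom M A B); x \<in> cocycles n A\<rbrakk> \<Longrightarrow> FMor T n f x \<in> cocycles n B"
  by (simp add: cocycles_def mor_closed d_natural linear_map_zero[OF obj_space obj_space mor_linear])

lemma prod_zero_right: "\<lbrakk>A \<in> Obj M; B \<in> Obj M; x \<in> carrier (FObj T m A)\<rbrakk> \<Longrightarrow>
    FProd T m n A B x \<zero>\<^bsub>FObj T n B\<^esub> = \<zero>\<^bsub>FObj T (m + n) (A \<boxtimes> B)\<^esub>"
  by (rule linear_map_zero[OF obj_space obj_space[OF tens_obj] prod_linear_right])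

lemma prod_zero_left: "\<lbrakk>A \<in> Obj M; B \<in> Obj M; y \<in> carrier (FObj T n B)\<rbrakk> \<Longrightarrow>
    FProd T m n A B \<zero>\<^bsub>FObj T m A\<^esub> y = \<zero>\<^bsub>FObj T (m + n) (A \<boxtimes> B)\<^esub>"
  by (rule linear_map_zero[OF obj_space obj_space[OF tens_obj] prod_linear_left])

text \<open>
  For cocycles the error terms of \<open>prod_boundary_left\<close> and \<open>prod_boundary_right\<close> vanish, so coboundaries
  form an ideal.
\<close>

lemma cohomology_subquotient: "lax_subquotient k M T cocycles coboundaries"
proof (intro lax_subquotient.intro lax_subquotient_axioms.intro linear_monoidal_abelian_category_axioms
    graded_lax_functor_axioms, goal_cases)
  case (1 A n) then show ?case by (rule cocycles_sub)
next
  case (2 A n) then show ?case by (rule coboundaries_sub)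
next
  case (3 A n) then show ?case by (rule coboundaries_le)
next
  case (4 A B f x n) then show ?case by (rule cocycles_mor)
next
  case (5 A B f x n)
  then obtain w where w: "w \<in> carrier (FObj T (n - 1) A)" "x = d (n - 1) A w"
    by (auto simp: coboundaries_def)
  then show ?case
    using d_natural[OF 5(1-3) w(1)] mor_closed[OF 5(1-3) w(1)]
    by (auto simp: coboundaries_def intro!: image_eqI[of _ _ "FMor T (n - 1) f w"])
next
  case (6 A B x m y n)
  have xy: "x \<in> carrier (FObj T m A)" "y \<in> carrier (FObj T n B)" using 6 by (simp_all add: cocycles_def)
  interpret V: module k "FObj T (m + n + 1) (A \<boxtimes> B)" by (rule obj_space[OF tens_obj[OF 6(1,2)]])
  have "FProd T (m + 1) n A B (d m A x) y = \<zero>\<^bsub>FObj T (m + n + 1) (A \<boxtimes> B)\<^esub>"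
    using prod_zero_left[OF 6(1,2) xy(2), of "m + 1"] 6(3) by (simp add: cocycles_def ac_simps)
  moreover have "FProd T m (n + 1) A B x (d n B y) = \<zero>\<^bsub>FObj T (m + n + 1) (A \<boxtimes> B)\<^esub>"
    using prod_zero_right[OF 6(1,2) xy(1), of "n + 1"] 6(4) by (simp add: cocycles_def ac_simps)
  ultimately show ?case
    using d_leibniz[OF 6(1,2) xy] prod_closed[OF 6(1,2) xy]
    by (simp add: cocycles_def alternate_zero[OF V.module_axioms])
next
  case (7 A B x m y n)
  then obtain w where w: "w \<in> carrier (FObj T (m - 1) A)" "x = d (m - 1) A w"
    by (auto simp: coboundaries_def)
  have y: "y \<in> carrier (FObj T n B)" using 7 by (simp add: cocycles_def)
  note b = prod_boundary_left[OF 7(1,2) w(1) y]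
  interpret V: module k "FObj T (m + n) (A \<boxtimes> B)" by (rule obj_space[OF tens_obj[OF 7(1,2)]])
  have "FProd T (m - 1) (n + 1) A B w (d n B y) = \<zero>\<^bsub>FObj T (m + n) (A \<boxtimes> B)\<^esub>"
    using prod_zero_right[OF 7(1,2) w(1), of "n + 1"] 7(4) by (simp add: cocycles_def)
  then have "FProd T m n A B x y = d (m + n - 1) (A \<boxtimes> B) (FProd T (m - 1) n A B w y)"
    using b(1) w(2) d_into[OF tens_obj[OF 7(1,2)] b(2)]
    by (simp add: alternate_zero[OF V.module_axioms] V.diff_zero)
  then show ?case using b(2) by (simp add: coboundaries_def)
next
  case (8 A B x m y n)
  then obtain w where w: "w \<in> carrier (FObj T (n - 1) B)" "y = d (n - 1) B w"
    by (auto simp: coboundaries_def)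
  have x: "x \<in> carrier (FObj T m A)" using 8 by (simp add: cocycles_def)
  note b = prod_boundary_right[OF 8(1,2) x w(1)]
  interpret V: module k "FObj T (m + n) (A \<boxtimes> B)" by (rule obj_space[OF tens_obj[OF 8(1,2)]])
  have "FProd T (m + 1) (n - 1) A B (d m A x) w = \<zero>\<^bsub>FObj T (m + n) (A \<boxtimes> B)\<^esub>"
    using prod_zero_left[OF 8(1,2) w(1), of "m + 1"] 8(3) by (simp add: cocycles_def)
  then have "FProd T m n A B x y = d (m + n - 1) (A \<boxtimes> B)
      (alternate (FObj T (m + n - 1) (A \<boxtimes> B)) m (FProd T m (n - 1) A B x w))"
    using b(1) w(2) d_into[OF tens_obj[OF 8(1,2)] b(2)]
    by (simp add: alternate_zero[OF V.module_axioms] V.diff_zero)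
  then show ?case using b(2) by (simp add: coboundaries_def)
next
  case 9
  show ?case using unit_mem d_unit by (simp add: cocycles_def)
qed

definition coh_cls :: "int \<Rightarrow> 'o \<Rightarrow> 'v \<Rightarrow> 'v set" where
  "coh_cls n A x = x <+\<^bsub>FObj T n A\<^esub> coboundaries n A"

lemma cohomology_presentation:
  "lax_presentation k M T cocycles coboundaries H coh_cls"
  using lax_subquotient.presentation[OF cohomology_subquotient]
  unfolding cohomology_def coh_cls_def[abs_def] cocycles_def[abs_def] coboundaries_def[abs_def] .

definition fil_cocycles :: "int \<times> int \<Rightarrow> 'o \<Rightarrow> 'v set" where
  "fil_cocycles g A = \<F> (fst g) (total_degree g) A \<inter> cocycles (total_degree g) A"

text \<open>
  The cocycles of filtration degree \<open>p\<close> whose cohomology class has a representative in \<open>\<F>\<^sup>p\<^sup>+\<^sup>1\<close>; adding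
  \<open>(1, -1)\<close> to the bidegree raises \<open>p\<close> and keeps the total degree.
\<close>

definition deeper_cocycles :: "int \<times> int \<Rightarrow> 'o \<Rightarrow> 'v set" where
  "deeper_cocycles g A = fil_cocycles g A \<inter>
    (fil_cocycles (g + (1, - 1)) A <+>\<^bsub>FObj T (total_degree g) A\<^esub> coboundaries (total_degree g) A)"

lemma cohomology_fil_eq:
  assumes "A \<in> Obj M"
  shows "H_fil s n A = coh_cls n A ` (\<F> s n A \<inter> cocycles n A)"
  using fil_carrier[OF assms]
  by (auto simp: cohomology_fil_def coh_cls_def coboundaries_def cocycles_def)

lemma deeper_cocycles_iff:
  assumes A: "A \<in> Obj M"
  shows "x \<in> deeper_cocycles g A \<longleftrightarrow> x \<in> fil_cocycles g A \<and>
    (\<exists>z \<in> \<F> (fst g + 1) (total_degree g) A \<inter> cocycles (total_degree g) A.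
     \<exists>w \<in> carrier (FObj T (total_degree g - 1) A).
       x = z \<oplus>\<^bsub>FObj T (total_degree g) A\<^esub> d (total_degree g - 1) A w)"
  by (simp add: deeper_cocycles_def module.mem_set_add[OF obj_space[OF A]] coboundaries_def
      fil_cocycles_def)

lemma deeper_cocycles_E:
  assumes "A \<in> Obj M" "x \<in> deeper_cocycles g A"
  obtains z b where "z \<in> fil_cocycles (g + (1, - 1)) A" "b \<in> coboundaries (total_degree g) A"
    "x = z \<oplus>\<^bsub>FObj T (total_degree g) A\<^esub> b"
  using assms by (auto simp: deeper_cocycles_def module.mem_set_add[OF obj_space[OF assms(1)]])

lemma limit_subquotient: "lax_subquotient k M (bigrade T) fil_cocycles deeper_cocycles"
proof -
  interpret K: lax_subquotient k M T cocycles coboundaries by (rule cohomology_subquotient)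
  have Z: "submodule (fil_cocycles g A) k (FObj T (total_degree g) A)" if "A \<in> Obj M" for g A
    unfolding fil_cocycles_def by (rule submodule_Int[OF obj_space fil_sub cocycles_sub]) (use that in auto)
  have shift: "total_degree (g + (1, - 1)) = total_degree g" for g by simp
  have Zp: "FProd T (total_degree g) (total_degree h) A B x y \<in> fil_cocycles (g + h) (A \<boxtimes> B)"
    if "A \<in> Obj M" "B \<in> Obj M" "x \<in> fil_cocycles g A" "y \<in> fil_cocycles h B" for A B x y g h
    using that fil_prod[OF that(1,2)] K.Z_prod[OF that(1,2)] by (simp add: fil_cocycles_def)
  have N_le: "deeper_cocycles g A \<subseteq> fil_cocycles g A" for g A by (auto simp: deeper_cocycles_def)
  show ?thesis
  proof (intro lax_subquotient.intro lax_subquotient_axioms.intro linear_monoidal_abelian_category_axioms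
      bigrade_lax graded_lax_functor_axioms, unfold bigrade_simps, goal_cases)
    case (1 A g) then show ?case by (rule Z)
  next
    case (2 A g)
    show ?case
      unfolding deeper_cocycles_def
      by (rule submodule_Int[OF obj_space[OF 2] Z[OF 2] module.submodule_add_set[OF obj_space[OF 2]
              Z[OF 2, of "g + (1, - 1)", unfolded shift] coboundaries_sub[OF 2]]])
  next
    case (3 A g) show ?case by (rule N_le)
  next
    case (4 A B f x g)
    then show ?case using fil_mor[OF 4(1-3)] cocycles_mor[OF 4(1-3)] by (simp add: fil_cocycles_def)
  next
    case (5 A B f x g)
    let ?n = "total_degree g"
    obtain z b where zb: "z \<in> fil_cocycles (g + (1, - 1)) A" "b \<in> coboundaries ?n A"
      "x = z \<oplus>\<^bsub>FObj T ?n A\<^esub> b"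
      by (rule deeper_cocycles_E[OF 5(1,4)])
    have zc: "z \<in> carrier (FObj T ?n A)" and bc: "b \<in> carrier (FObj T ?n A)"
      using zb K.N_carrier[OF 5(1)] by (simp_all add: fil_cocycles_def cocycles_def)
    have "FMor T ?n f z \<in> fil_cocycles (g + (1, - 1)) B"
      using zb(1) fil_mor[OF 5(1-3)] cocycles_mor[OF 5(1-3)] by (simp add: fil_cocycles_def)
    moreover have "FMor T ?n f b \<in> coboundaries ?n B" by (rule K.N_mor[OF 5(1-3) zb(2)])
    moreover have "FMor T ?n f x \<in> fil_cocycles g B"
      using subsetD[OF N_le 5(4)] fil_mor[OF 5(1-3)] cocycles_mor[OF 5(1-3)] by (simp add: fil_cocycles_def)
    ultimately show ?case
      using linear_map_add[OF mor_linear[OF 5(1-3)] zc bc]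
      by (auto simp: deeper_cocycles_def module.mem_set_add[OF obj_space[OF 5(2)]] zb(3))
  next
    case (6 A B x g y h) then show ?case by (rule Zp)
  next
    case (7 A B x g y h)
    let ?m = "total_degree g" and ?n = "total_degree h"
    obtain z b where zb: "z \<in> fil_cocycles (g + (1, - 1)) A" "b \<in> coboundaries ?m A"
      "x = z \<oplus>\<^bsub>FObj T ?m A\<^esub> b"
      by (rule deeper_cocycles_E[OF 7(1,3)])
    have yc: "y \<in> carrier (FObj T ?n B)" "y \<in> cocycles ?n B"
      using 7(4) by (simp_all add: fil_cocycles_def cocycles_def)
    have zc: "z \<in> carrier (FObj T ?m A)" and bc: "b \<in> carrier (FObj T ?m A)"
      using zb K.N_carrier[OF 7(1)] by (simp_all add: fil_cocycles_def cocycles_def)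
    have ix: "g + (1, - 1) + h = g + h + (1, - 1)" by (simp add: algebra_simps)
    have "FProd T ?m ?n A B z y \<in> fil_cocycles (g + h + (1, - 1)) (A \<boxtimes> B)"
      using Zp[OF 7(1,2) zb(1) 7(4)] by (simp add: ix)
    moreover have "FProd T ?m ?n A B b y \<in> coboundaries (?m + ?n) (A \<boxtimes> B)"
      by (rule K.N_prod_left[OF 7(1,2) zb(2) yc(2)])
    moreover have "FProd T ?m ?n A B x y \<in> fil_cocycles (g + h) (A \<boxtimes> B)"
      using Zp[OF 7(1,2) _ 7(4)] 7(3) N_le by blast
    ultimately show ?case
      using linear_map_add[OF prod_linear_left[OF 7(1,2) yc(1)] zc bc]
      by (auto simp: deeper_cocycles_def module.mem_set_add[OF obj_space[OF tens_obj[OF 7(1,2)]]] zb(3))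
  next
    case (8 A B x g y h)
    let ?m = "total_degree g" and ?n = "total_degree h"
    obtain z b where zb: "z \<in> fil_cocycles (h + (1, - 1)) B" "b \<in> coboundaries ?n B"
      "y = z \<oplus>\<^bsub>FObj T ?n B\<^esub> b"
      by (rule deeper_cocycles_E[OF 8(2,4)])
    have xc: "x \<in> carrier (FObj T ?m A)" "x \<in> cocycles ?m A"
      using 8(3) by (simp_all add: fil_cocycles_def cocycles_def)
    have zc: "z \<in> carrier (FObj T ?n B)" and bc: "b \<in> carrier (FObj T ?n B)"
      using zb K.N_carrier[OF 8(2)] by (simp_all add: fil_cocycles_def cocycles_def)
    have ix: "g + (h + (1, - 1)) = g + h + (1, - 1)" by (simp add: algebra_simps)
    have "FProd T ?m ?n A B x z \<in> fil_cocycles (g + h + (1, - 1)) (A \<boxtimes> B)"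
      using Zp[OF 8(1,2,3) zb(1)] by (simp add: ix)
    moreover have "FProd T ?m ?n A B x b \<in> coboundaries (?m + ?n) (A \<boxtimes> B)"
      by (rule K.N_prod_right[OF 8(1,2) xc(2) zb(2)])
    moreover have "FProd T ?m ?n A B x y \<in> fil_cocycles (g + h) (A \<boxtimes> B)"
      using Zp[OF 8(1,2,3)] 8(4) N_le by blast
    ultimately show ?case
      using linear_map_add[OF prod_linear_right[OF 8(1,2) xc(1)] zc bc]
      by (auto simp: deeper_cocycles_def module.mem_set_add[OF obj_space[OF tens_obj[OF 8(1,2)]]] zb(3))
  next
    case 9
    show ?case using fil_unit K.Z_unit by (simp add: fil_cocycles_def)
  qed
qed

text \<open>
  A class in \<open>\<F>\<^sup>p H\<close> is by definition the class of a cocycle in \<open>\<F>\<^sup>p\<close>; it lies in \<open>\<F>\<^sup>p\<^sup>+\<^sup>1 H\<close> if and only if that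
  cocycle is one of the \<open>deeper_cocycles\<close>.
\<close>

theorem graded_cohomology_presentation:
  "lax_presentation k M (bigrade T) fil_cocycles deeper_cocycles
    (associated_graded M H H_fil)
    (\<lambda>g A x. coh_cls (total_degree g) A x <+\<^bsub>FObj (bigrade H) g A\<^esub>
      H_fil (fst g + 1) (total_degree g) A)"
proof -
  interpret K: lax_presentation k M T cocycles coboundaries "H" coh_cls
    by (rule cohomology_presentation)
  have ag: "associated_graded M H H_fil =
    subquotient_functor M (bigrade H)
      (\<lambda>g. H_fil (fst g) (total_degree g))
      (\<lambda>g. H_fil (fst g + 1) (total_degree g))"
    by (simp add: associated_graded_def total_degree_def case_prod_beta')
  show ?thesis
    unfolding ag
  proof (rule lax_presentation.subquotient_presentation
      [OF bigrade_presentation[OF cohomology_presentation] limit_subquotient], goal_cases)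
    case (1 g A) show ?case by (auto simp: fil_cocycles_def)
  next
    case (2 g A x)
    interpret V: module k "FObj T (total_degree g) A" by (rule obj_space[OF 2(1)])
    obtain w where w: "w \<in> carrier (FObj T (total_degree g - 1) A)" "x = d (total_degree g - 1) A w"
      using 2(3) by (auto simp: coboundaries_def)
    have "x = \<zero>\<^bsub>FObj T (total_degree g) A\<^esub> \<oplus>\<^bsub>FObj T (total_degree g) A\<^esub> d (total_degree g - 1) A w"
      using w K.N_carrier[OF 2(1,3)] by simp
    then show ?case
      unfolding deeper_cocycles_iff[OF 2(1)]
      using w 2(2) fil_zero[OF 2(1)] V.submodule_zero[OF cocycles_sub[OF 2(1)]] by blast
  next
    case (3 g A) then show ?case by (simp add: cohomology_fil_eq fil_cocycles_def)
  next
    case (4 g A)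
    let ?n = "total_degree g"
    interpret V: module k "FObj T ?n A" by (rule obj_space[OF 4])
    show ?case
      unfolding cohomology_fil_eq[OF 4]
    proof (intro equalityI subsetI; elim imageE)
      fix X z assume X: "X = coh_cls ?n A z" and z: "z \<in> \<F> (fst g + 1) ?n A \<inter> cocycles ?n A"
      have "z \<in> fil_cocycles g A"
        using z fil_antimono[OF 4, of "fst g" "fst g + 1"] by (simp add: fil_cocycles_def)
      moreover have "z = z \<oplus>\<^bsub>FObj T ?n A\<^esub> d (?n - 1) A \<zero>\<^bsub>FObj T (?n - 1) A\<^esub>"
        using d_zero[OF 4, of "?n - 1"] z cocycles_carrier[of z ?n A] by simp
      ultimately have "z \<in> deeper_cocycles g A"
        unfolding deeper_cocycles_iff[OF 4]
        using z fil_carrier[OF 4 fil_zero[OF 4]] by blast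
      then show "X \<in> coh_cls ?n A ` deeper_cocycles g A" using X by blast
    next
      fix X x assume X: "X = coh_cls ?n A x" and "x \<in> deeper_cocycles g A"
      then obtain z w where zw: "z \<in> \<F> (fst g + 1) ?n A" "z \<in> cocycles ?n A"
        "w \<in> carrier (FObj T (?n - 1) A)" "x = z \<oplus>\<^bsub>FObj T ?n A\<^esub> d (?n - 1) A w"
        unfolding deeper_cocycles_iff[OF 4] by blast
      have dw: "d (?n - 1) A w \<in> coboundaries ?n A" using zw(3) by (simp add: coboundaries_def)
      have "coh_cls ?n A x = coh_cls ?n A z"
        using K.pr_eq_iff[OF 4 K.Z_add[OF 4 zw(2) subsetD[OF coboundaries_le[OF 4] dw]] zw(2)] dw zw(4)
          V.add_diff_cancel[OF cocycles_carrier[OF zw(2)] d_into[OF 4 zw(3)]] by simp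
      then show "X \<in> coh_cls ?n A ` (\<F> (fst g + 1) ?n A \<inter> cocycles ?n A)"
        using X zw by auto
    qed
  qed
qed

text \<open>
  An element of the first page that is represented by \<open>x \<in> Z\<^sub>n\<close> is carried to the class of the same \<open>x\<close> on
  page \<open>n\<close>, because \<open>page_iso\<close> preserves representatives.
\<close>

lemma ss_reach_page_cls:
  assumes A: "A \<in> Obj M"
  shows "x \<in> numer (int n) g A \<Longrightarrow>
    ss_reach 0 page page_d page_iso n g A (page_cls 0 g A x) =
    page_cls (int n) g A x"
proof (induction n)
  case 0 then show ?case by simp
next
  case (Suc n)
  have "x \<in> numer (int n) g A"
    using Suc.prems cyc_mono[OF A, of "int n" "int n + 1"] by (simp add: fil_Z_eq add.commute)
  then show ?case
    using Suc.IH fil_iso_eq[OF A, of x "int n" g] Suc.prems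
    by (simp add: page_boundary_def Let_def add.commute)
qed

text \<open>
  That \<open>x\<close> survives to page \<open>n\<close> and is a cycle there gives a lift to \<open>Z\<^sub>n\<^sub>+\<^sub>1\<close> which differs from \<open>x\<close> by an
  element of \<open>\<F>\<^sup>p\<^sup>+\<^sup>1\<close>. That difference is zero already on page \<open>0\<close>.
\<close>

lemma ss_cycles_page:
  assumes A: "A \<in> Obj M"
  shows "ss_cycles 0 page page_d page_iso n g A =
    page_cls 0 g A ` numer (int n) g A"
proof (induction n)
  case 0
  show ?case using lax_presentation.pr_onto[OF page_presentation A] by simp
next
  case (Suc n)
  let ?n = "total_degree g" and ?p = "fst g"
  have "ss_cycles 0 page page_d page_iso (Suc n) g A
    = page_cls 0 g A ` {x \<in> numer (int n) g A. d ?n A x \<in> den (int n) (?p + int n) (?n + 1) A}"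
    using page_d_zero_iff[OF A] by (simp add: Suc.IH Compr_image_eq ss_reach_page_cls[OF A] Let_def cong: conj_cong)
  also have "\<dots> = page_cls 0 g A ` numer (int n + 1) g A"
  proof (intro equalityI subsetI; elim imageE)
    fix X x assume X: "X = page_cls 0 g A x"
      and "x \<in> {x \<in> numer (int n) g A. d ?n A x \<in> den (int n) (?p + int n) (?n + 1) A}"
    then have x: "x \<in> cyc (int n) ?p ?n A" "d ?n A x \<in> den (int n) (?p + int n) (?n + 1) A"
      by (simp_all add: fil_Z_eq)
    obtain x' where x': "x' \<in> cyc (int n + 1) ?p ?n A"
      "x \<ominus>\<^bsub>FObj T ?n A\<^esub> x' \<in> cyc (int n - 1) (?p + 1) ?n A"
      by (rule cyc_lift[OF A x])
    have Z0: "x \<in> numer 0 g A" "x' \<in> numer 0 g A"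
      using cyc_mono[OF A _ x(1), of 0] cyc_mono[OF A _ x'(1), of 0] by (simp_all add: fil_Z_eq)
    have "x \<ominus>\<^bsub>FObj T ?n A\<^esub> x' \<in> den 0 ?p ?n A"
      using cyc_mono[OF A _ x'(2), of "0 - 1"] by (intro cyc_in_den[OF A]) simp
    then have "X = page_cls 0 g A x'"
      using P.pr_eq_iff[OF A Z0] X by (simp add: fil_denom_eq bigrade_simps)
    then show "X \<in> page_cls 0 g A ` numer (int n + 1) g A" using x'(1) by (simp add: fil_Z_eq)
  next
    fix X x assume X: "X = page_cls 0 g A x" and "x \<in> numer (int n + 1) g A"
    then have x: "x \<in> cyc (int n + 1) ?p ?n A" by (simp add: fil_Z_eq)
    then show "X \<in> page_cls 0 g A ` {x \<in> numer (int n) g A. d ?n A x \<in> den (int n) (?p + int n) (?n + 1) A}"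
      using X d_den_if_cyc[OF A x] cyc_mono[OF A _ x, of "int n"] by (simp add: fil_Z_eq)
  qed
  finally show ?case by (simp add: add.commute)
qed

lemma ss_bounds_page:
  assumes A: "A \<in> Obj M"
  shows "ss_bounds 0 page page_d page_iso n g A =
    page_cls 0 g A ` denom (int n) g A"
proof -
  have "{x \<in> numer (int n) g A. x \<in> denom (int n) g A} = denom (int n) g A"
    using P.N_le_Z[OF A, of "int n" g] by blast
  then show ?thesis
    by (simp add: ss_bounds_def ss_cycles_page[OF A] Compr_image_eq ss_reach_page_cls[OF A] P.pr_zero_iff[OF A, of _ "int n" g]
        cong: conj_cong)
qed

end

locale bounded_filtered_differential_functor = filtered_differential_functor +
  assumes fil_bounded: "A \<in> Obj M \<Longrightarrow> \<exists>s. \<F> s n A = {\<zero>\<^bsub>FObj T n A\<^esub>}"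
begin

interpretation P: lax_presentation k M "bigrade T" "numer r" "denom r"
  "page r" "page_cls r" for r
  by (rule page_presentation)

lemma fil_eventually_zero:
  assumes A: "A \<in> Obj M"
  shows "\<exists>s. \<forall>t\<ge>s. \<forall>x\<in>\<F> t n A. x = \<zero>\<^bsub>FObj T n A\<^esub>"
proof -
  obtain s where "\<F> s n A = {\<zero>\<^bsub>FObj T n A\<^esub>}" using fil_bounded[OF A] by blast
  then show ?thesis using fil_antimono[OF A, of s _ _ n] by (intro exI[of _ s]) blast
qed

text \<open>
  If \<open>\<F>\<^sup>p\<^sup>+\<^sup>m T\<^sup>n\<^sup>+\<^sup>1 = 0\<close>, then \<open>dx \<in> \<F>\<^sup>p\<^sup>+\<^sup>m\<close> forces \<open>dx = 0\<close>, so the intersection of the cycles is the image of the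
  cocycles in \<open>\<F>\<^sup>p\<close>; this is where boundedness enters. The union of the boundaries is the image of the
  cocycles \<open>z + dw\<close> with \<open>z \<in> \<F>\<^sup>p\<^sup>+\<^sup>1\<close> and arbitrary \<open>w\<close>: every \<open>w\<close> lies in some \<open>\<F>\<^sup>s\<close> because the filtration
  is exhaustive.
\<close>

theorem E_infinity_presentation:
  "lax_presentation k M (bigrade T) fil_cocycles deeper_cocycles
    (E_infinity M 0 page page_d page_iso)
    (\<lambda>g A x. page_cls 0 g A x <+\<^bsub>FObj (page 0) g A\<^esub>
      (\<Union>n. ss_bounds 0 page page_d page_iso n g A))"
  unfolding E_infinity_def
proof (rule lax_presentation.subquotient_presentation[OF page_presentation limit_subquotient], goal_cases)
  case (1 g A)
  then show ?case using fil_zero by (auto simp: fil_Z_eq cyc_def fil_cocycles_def cocycles_def)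
next
  case (2 g A x)
  let ?n = "total_degree g"
  interpret V: module k "FObj T ?n A" by (rule obj_space[OF 2(1)])
  have "x \<in> den 0 (fst g) ?n A" using 2(3) by (simp add: fil_denom_eq)
  then obtain z w where zw: "z \<in> cyc (0 - 1) (fst g + 1) ?n A" "w \<in> \<F> (fst g + 1 - 0) (?n - 1) A"
      "d (?n - 1) A w \<in> \<F> (fst g) ?n A" "x = z \<oplus>\<^bsub>FObj T ?n A\<^esub> d (?n - 1) A w"
    by (rule denE[OF 2(1)])
  have xc: "x \<in> carrier (FObj T ?n A)" "x \<in> cocycles ?n A"
    using 2(2) by (simp_all add: fil_cocycles_def cocycles_def)
  have "d (?n - 1) A w \<in> \<F> (fst g + 1) ?n A"
    using fil_d[OF 2(1) zw(2)] by simp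
  then have "x \<in> \<F> (fst g + 1) ?n A" using zw(1,4) fil_add[OF 2(1)] by (simp add: cyc_def)
  moreover have "x = x \<oplus>\<^bsub>FObj T ?n A\<^esub> d (?n - 1) A \<zero>\<^bsub>FObj T (?n - 1) A\<^esub>"
    using d_zero[OF 2(1), of "?n - 1"] xc by simp
  ultimately show ?case
    unfolding deeper_cocycles_iff[OF 2(1)] using 2(2) xc fil_carrier[OF 2(1) fil_zero[OF 2(1)]] by blast
next
  case (3 g A)
  let ?n = "total_degree g"
  obtain s where s: "\<forall>t\<ge>s. \<forall>x\<in>\<F> t (?n + 1) A. x = \<zero>\<^bsub>FObj T (?n + 1) A\<^esub>"
    using fil_eventually_zero[OF 3] by blast
  define m where "m = nat (s - fst g)"
  have "numer (int m) g A \<subseteq> fil_cocycles g A"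
    using s[rule_format, of "fst g + int m"] fil_carrier[OF 3]
    by (auto simp: m_def fil_Z_eq cyc_def fil_cocycles_def cocycles_def)
  moreover have "fil_cocycles g A \<subseteq> numer (int n) g A" for n
    using fil_zero[OF 3] by (auto simp: fil_Z_eq cyc_def fil_cocycles_def cocycles_def)
  ultimately show ?case
    unfolding ss_cycles_page[OF 3] by blast
next
  case (4 g A)
  let ?n = "total_degree g" and ?p = "fst g"
  interpret V: module k "FObj T ?n A" by (rule obj_space[OF 4])
  interpret W: module k "FObj T (?n + 1) A" by (rule obj_space[OF 4])
  show ?case
    unfolding ss_bounds_page[OF 4]
  proof (intro equalityI subsetI; (elim UN_E)?; elim imageE)
    fix X m x assume X: "X = page_cls 0 g A x" and "x \<in> denom (int m) g A"
    then have "x \<in> den (int m) ?p ?n A" by (simp add: fil_denom_eq)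
    then obtain z w where zw: "z \<in> cyc (int m - 1) (?p + 1) ?n A" "w \<in> \<F> (?p + 1 - int m) (?n - 1) A"
      "d (?n - 1) A w \<in> \<F> ?p ?n A" "x = z \<oplus>\<^bsub>FObj T ?n A\<^esub> d (?n - 1) A w"
      by (rule denE[OF 4])
    let ?y = "d (?n - 1) A w"
    have wc: "w \<in> carrier (FObj T (?n - 1) A)" using fil_carrier[OF 4 zw(2)] .
    have y: "?y \<in> fil_cocycles g A"
      using zw(3) fil_carrier[OF 4 zw(3)] d_d[OF 4 wc] by (simp add: fil_cocycles_def cocycles_def)
    have zc: "z \<in> carrier (FObj T ?n A)" using cyc_carrier[OF 4 zw(1)] .
    have y0: "?y = \<zero>\<^bsub>FObj T ?n A\<^esub> \<oplus>\<^bsub>FObj T ?n A\<^esub> ?y" using fil_carrier[OF 4 zw(3)] by simp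
    have "?y \<in> deeper_cocycles g A"
      unfolding deeper_cocycles_iff[OF 4]
      using y y0 wc fil_zero[OF 4] V.submodule_zero[OF cocycles_sub[OF 4]] by blast
    moreover have z: "z \<in> den 0 ?p ?n A"
      using cyc_mono[OF 4 _ zw(1), of "0 - 1"] by (intro cyc_in_den[OF 4]) simp
    moreover have "z \<in> numer 0 g A" "?y \<in> numer 0 g A"
      using subsetD[OF den_le_cyc[OF 4] z] y fil_zero[OF 4]
      by (simp_all add: fil_Z_eq cyc_def fil_cocycles_def cocycles_def)
    ultimately have "page_cls 0 g A x = page_cls 0 g A ?y"
      using P.pr_eq_iff[OF 4 P.Z_add[OF 4, of z 0 g ?y], of ?y] V.add_diff_cancel'[OF zc fil_carrier[OF 4 zw(3)]] zw(4)
      by (simp add: bigrade_simps fil_denom_eq)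
    then show "X \<in> page_cls 0 g A ` deeper_cocycles g A" using X \<open>?y \<in> deeper_cocycles g A\<close> by blast
  next
    fix X x assume X: "X = page_cls 0 g A x" and x: "x \<in> deeper_cocycles g A"
    then obtain z w where zw: "z \<in> \<F> (?p + 1) ?n A" "z \<in> cocycles ?n A"
      "w \<in> carrier (FObj T (?n - 1) A)" "x = z \<oplus>\<^bsub>FObj T ?n A\<^esub> d (?n - 1) A w"
      unfolding deeper_cocycles_iff[OF 4] by blast
    obtain s where s: "w \<in> \<F> s (?n - 1) A" using fil_exhaustive[OF 4 zw(3)] by blast
    define m where "m = nat (?p + 1 - s)"
    have xF: "x \<in> \<F> ?p ?n A" using x by (simp add: deeper_cocycles_def fil_cocycles_def)
    have "x \<in> den (int m) ?p ?n A"
    proof (rule denI[OF 4 _ _ _ zw(4)])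
      show "z \<in> cyc (int m - 1) (?p + 1) ?n A"
        using zw(1,2) fil_zero[OF 4] by (simp add: cyc_def cocycles_def)
      show "w \<in> \<F> (?p + 1 - int m) (?n - 1) A"
        using s by (rule fil_antimono[OF 4, rotated]) (simp add: m_def)
      have "d (?n - 1) A w = x \<ominus>\<^bsub>FObj T ?n A\<^esub> z"
        using zw(4) V.add_diff_cancel[OF cocycles_carrier[OF zw(2)] d_into[OF 4 zw(3)]] by simp
      then show "d (?n - 1) A w \<in> \<F> ?p ?n A"
        using fil_diff_closed[OF 4 xF] fil_antimono[OF 4 _ zw(1), of ?p] by simp
    qed
    then show "X \<in> (\<Union>m. page_cls 0 g A ` denom (int m) g A)"
      using X by (auto simp: fil_denom_eq)
  qed
qed

text \<open>
  The filtration of the cohomology is Hausdorff because \<open>\<F>\<^sup>s T\<^sup>n = 0\<close> for some \<open>s\<close>.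
\<close>

theorem cohomology_filtered:
  "filtered_graded_lax_functor k M H H_fil"
proof -
  interpret K: lax_presentation k M T cocycles coboundaries "H" coh_cls
    by (rule cohomology_presentation)
  have mono: "\<F> (s + 1) n A \<subseteq> \<F> s n A" if "A \<in> Obj M" for s n A
    using fil_antimono[OF that, of s "s + 1"] by auto
  show ?thesis
  proof (intro filtered_graded_lax_functor.intro filtered_graded_lax_functor_axioms.intro K.G_lax, goal_cases)
    case (1 A s n)
    show ?case
      unfolding cohomology_fil_eq[OF 1]
      by (rule K.image_submodule[OF 1 submodule_Int[OF obj_space[OF 1] fil_sub[OF 1] cocycles_sub[OF 1]]]) blast
  next
    case (2 A B f x s n)
    then show ?case
      using fil_mor[OF 2(1-3)] cocycles_mor[OF 2(1-3)]
      by (auto simp: cohomology_fil_eq K.pr_mor[OF 2(1-3), symmetric])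
  next
    case (3 A s n) then show ?case using mono[OF 3] by (auto simp: cohomology_fil_eq)
  next
    case (4 A n)
    have "(\<Union>s. \<F> s n A \<inter> cocycles n A) = cocycles n A"
      using fil_exhaustive[OF 4] by (auto simp: cocycles_def)
    then show ?case
      by (simp only: cohomology_fil_eq[OF 4] K.pr_onto[OF 4, symmetric] flip: image_UN)
  next
    case (5 A n)
    obtain s where "\<F> s n A = {\<zero>\<^bsub>FObj T n A\<^esub>}" using fil_bounded[OF 5] by blast
    then have "H_fil s n A \<subseteq> {\<zero>\<^bsub>FObj H n A\<^esub>}"
      unfolding cohomology_fil_eq[OF 5] using K.pr_zero[OF 5] by auto
    moreover have "\<zero>\<^bsub>FObj H n A\<^esub> \<in> H_fil s n A" for s
      unfolding cohomology_fil_eq[OF 5] K.pr_zero[OF 5, symmetric]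
      using fil_zero[OF 5] module.submodule_zero[OF obj_space[OF 5] cocycles_sub[OF 5]] by blast
    ultimately show ?case by blast
  next
    case (6 A B x s m y t n)
    then show ?case
      using fil_prod[OF 6(1,2)] K.Z_prod[OF 6(1,2)] tens_obj[OF 6(1,2)]
      by (auto simp: cohomology_fil_eq K.pr_prod[OF 6(1,2), symmetric])
  next
    case 7
    show ?case
      unfolding cohomology_fil_eq[OF unit_obj] K.pr_unit[symmetric]
      using fil_unit K.Z_unit by blast
  qed
qed

theorem fil_spectral_sequence_converges:
  "converges_multiplicatively k M 0 page page_d page_iso
    H H_fil"
proof -
  obtain \<psi> where "lax_monoidal_iso k M (E_infinity M 0 page page_d page_iso)
      (associated_graded M H H_fil) \<psi>"
    using presentations_isomorphic_ex[OF E_infinity_presentation graded_cohomology_presentation] by blast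
  then show ?thesis
    unfolding converges_multiplicatively_def
    using cohomology_filtered lax_monoidal_iso.axioms(1) by blast
qed

end

section \<open>The total complex of a bicomplex lax monoidal functor\<close>

locale bicomplex_over_monoidal_category =
  linear_monoidal_abelian_category k M + graded_lax_functor k M C + bicomplex_lax_functor k M C dh dv
  for k :: "('k, 'r) ring_scheme" and M :: "('k, 'o, 'm, 'c) linear_moncat_scheme" (structure)
    and C :: "(int \<times> int, 'k, 'o, 'm, 'v) lax_functor"
    and dh dv :: "int \<times> int \<Rightarrow> 'o \<Rightarrow> 'v \<Rightarrow> 'v"
begin

abbreviation "T \<equiv> Tot M C"
abbreviation "d \<equiv> tot_diff C dh dv"
abbreviation "tot \<equiv> tot_space C"
abbreviation "part n p A \<equiv> FObj C (p, n - p) A"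

definition single :: "int \<Rightarrow> 'o \<Rightarrow> int \<Rightarrow> 'v \<Rightarrow> int \<Rightarrow> 'v" where
  "single n A p a = (\<lambda>s. if s = p then a else \<zero>\<^bsub>part n s A\<^esub>)"

lemma comp_closed: "x \<in> carrier (tot n A) \<Longrightarrow> x p \<in> carrier (part n p A)"
  by (simp add: tot_space_def)

lemma tot_memI:
  assumes "\<And>p. x p \<in> carrier (part n p A)" and "finite S"
    and "\<And>p. p \<notin> S \<Longrightarrow> x p = \<zero>\<^bsub>part n p A\<^esub>"
  shows "x \<in> carrier (tot n A)"
proof -
  have "tot_support C n A x \<subseteq> S" using assms(3) by (auto simp: tot_support_def)
  then show ?thesis using assms(1,2) finite_subset by (auto simp: tot_space_def)
qed

lemma finite_support: "x \<in> carrier (tot n A) \<Longrightarrow> finite (tot_support C n A x)"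
  by (simp add: tot_space_def)

lemma outside_support: "p \<notin> tot_support C n A x \<Longrightarrow> x p = \<zero>\<^bsub>part n p A\<^esub>"
  by (simp add: tot_support_def)

lemma tot_add: "(x \<oplus>\<^bsub>tot n A\<^esub> y) p = x p \<oplus>\<^bsub>part n p A\<^esub> y p"
  by (simp add: tot_space_def)

lemma tot_smult: "(c \<odot>\<^bsub>tot n A\<^esub> x) p = c \<odot>\<^bsub>part n p A\<^esub> x p"
  by (simp add: tot_space_def)

lemma tot_zero: "\<zero>\<^bsub>tot n A\<^esub> p = \<zero>\<^bsub>part n p A\<^esub>"
  by (simp add: tot_space_def)

lemma FObj_Tot: "FObj T = tot"
  by (simp add: Tot_def)

lemma FMor_Tot: "FMor T n f x p = FMor C (p, n - p) f (x p)"
  by (simp add: Tot_def)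

lemma tot_mem_combination:
  assumes "x \<in> carrier (tot n A)" and "y \<in> carrier (tot n A)"
    and "\<And>p. z p \<in> carrier (part n p A)"
    and "\<And>p. \<lbrakk>x p = \<zero>\<^bsub>part n p A\<^esub>; y p = \<zero>\<^bsub>part n p A\<^esub>\<rbrakk> \<Longrightarrow> z p = \<zero>\<^bsub>part n p A\<^esub>"
  shows "z \<in> carrier (tot n A)"
  by (rule tot_memI[where S = "tot_support C n A x \<union> tot_support C n A y"])
    (use assms finite_support[OF assms(1)] finite_support[OF assms(2)] in \<open>auto simp: tot_support_def\<close>)

lemma tot_zero_closed:
  assumes A: "A \<in> Obj M" shows "\<zero>\<^bsub>tot n A\<^esub> \<in> carrier (tot n A)"
  by (rule tot_memI[where S = "{}"])
    (simp_all add: tot_zero abelian_groupE(2)[OF module.axioms(2)[OF obj_space[OF A]]])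

lemma tot_add_closed:
  assumes A: "A \<in> Obj M" and x: "x \<in> carrier (tot n A)" and y: "y \<in> carrier (tot n A)"
  shows "x \<oplus>\<^bsub>tot n A\<^esub> y \<in> carrier (tot n A)"
  using abelian_groupE(1,2,5)[OF module.axioms(2)[OF obj_space[OF A]]]
  by (intro tot_mem_combination[OF x y]) (simp_all add: tot_add comp_closed[OF x] comp_closed[OF y])

lemma tot_minus_closed:
  assumes A: "A \<in> Obj M" and x: "x \<in> carrier (tot n A)"
  shows "(\<lambda>p. \<ominus>\<^bsub>part n p A\<^esub> x p) \<in> carrier (tot n A)"
proof (rule tot_mem_combination[OF x x])
  fix p
  interpret V: module k "part n p A" by (rule obj_space[OF A])
  show "\<ominus>\<^bsub>part n p A\<^esub> x p \<in> carrier (part n p A)" by (simp add: comp_closed[OF x])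
  show "\<ominus>\<^bsub>part n p A\<^esub> x p = \<zero>\<^bsub>part n p A\<^esub>" if "x p = \<zero>\<^bsub>part n p A\<^esub>"
    by (simp add: that)
qed

lemma tot_smult_closed:
  assumes A: "A \<in> Obj M" and c: "c \<in> carrier k" and x: "x \<in> carrier (tot n A)"
  shows "c \<odot>\<^bsub>tot n A\<^esub> x \<in> carrier (tot n A)"
  by (rule tot_mem_combination[OF x x])
    (simp_all add: tot_smult c comp_closed[OF x] module.smult_closed[OF obj_space[OF A]]
      module.smult_r_null[OF obj_space[OF A]])

lemma tot_module:
  assumes A: "A \<in> Obj M" shows "module k (tot n A)"
proof -
  have V: "module k (part n p A)" for p by (rule obj_space[OF A])
  then have grp: "abelian_group (part n p A)" for p by (rule module.axioms(2))
  have R: "cring k" using V[of 0] by (rule module.axioms(1))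
  have inv: "\<exists>y\<in>carrier (tot n A). y \<oplus>\<^bsub>tot n A\<^esub> x = \<zero>\<^bsub>tot n A\<^esub>"
    if x: "x \<in> carrier (tot n A)" for x
    by (rule bexI[OF _ tot_minus_closed[OF A x]])
      (simp add: fun_eq_iff tot_add tot_zero comp_closed[OF x] abelian_group.l_neg[OF grp])
  show ?thesis
    by (intro moduleI[OF R abelian_groupI] tot_add_closed[OF A] tot_zero_closed[OF A]
        tot_smult_closed[OF A] inv)
      (simp_all add: fun_eq_iff tot_add tot_zero tot_smult comp_closed abelian_groupE(3,4,5)[OF grp]
        module.smult_l_distr[OF V] module.smult_r_distr[OF V]
        module.smult_assoc1[OF V] module.smult_one[OF V])
qed

lemma single_closed:
  assumes A: "A \<in> Obj M" and a: "a \<in> carrier (part n p A)"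
  shows "single n A p a \<in> carrier (tot n A)"
proof (rule tot_memI[where S = "{p}"])
  fix s
  interpret V: module k "part n s A" by (rule obj_space[OF A])
  show "single n A p a s \<in> carrier (part n s A)" using a by (simp add: single_def)
qed (auto simp: single_def)

lemma single_zero: "single n A p \<zero>\<^bsub>part n p A\<^esub> = \<zero>\<^bsub>tot n A\<^esub>"
  by (rule ext) (simp add: single_def tot_zero)

lemma single_add:
  assumes A: "A \<in> Obj M"
  shows "single n A p a \<oplus>\<^bsub>tot n A\<^esub> single n A p b = single n A p (a \<oplus>\<^bsub>part n p A\<^esub> b)"
proof
  fix s
  interpret V: module k "part n s A" by (rule obj_space[OF A])
  show "(single n A p a \<oplus>\<^bsub>tot n A\<^esub> single n A p b) s = single n A p (a \<oplus>\<^bsub>part n p A\<^esub> b) s"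
    by (simp add: single_def tot_add)
qed

lemma single_linear:
  assumes A: "A \<in> Obj M" shows "linear_map k (part n p A) (tot n A) (single n A p)"
proof -
  have "single n A p (c \<odot>\<^bsub>part n p A\<^esub> a) = c \<odot>\<^bsub>tot n A\<^esub> single n A p a"
    if "c \<in> carrier k" for c a
  proof
    fix s
    interpret V: module k "part n s A" by (rule obj_space[OF A])
    show "single n A p (c \<odot>\<^bsub>part n p A\<^esub> a) s = (c \<odot>\<^bsub>tot n A\<^esub> single n A p a) s"
      using that by (simp add: single_def tot_smult)
  qed
  then show ?thesis
    by (auto simp: linear_map_def single_closed[OF A] single_add[OF A])
qed

text \<open>
  \<open>Tot\<^sup>n\<close> is spanned by the families with a single nonzero member.
\<close>

lemma tot_induct:
  assumes A: "A \<in> Obj M" and x: "x \<in> carrier (tot n A)"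
    and zero: "P \<zero>\<^bsub>tot n A\<^esub>"
    and add: "\<And>p a y. a \<in> carrier (part n p A) \<Longrightarrow> y \<in> carrier (tot n A) \<Longrightarrow> P y \<Longrightarrow>
      P (single n A p a \<oplus>\<^bsub>tot n A\<^esub> y)"
  shows "P x"
proof -
  have "P x" if "finite S" "x \<in> carrier (tot n A)" "tot_support C n A x \<subseteq> S" for S x
    using that
  proof (induction S arbitrary: x rule: finite_induct)
    case empty
    then have "x = \<zero>\<^bsub>tot n A\<^esub>" by (intro ext) (auto simp: tot_zero tot_support_def)
    then show ?case using zero by simp
  next
    case (insert p S)
    define y where "y = x(p := \<zero>\<^bsub>part n p A\<^esub>)"
    have y_mem: "y \<in> carrier (tot n A)"
    proof (rule tot_memI[where S = "tot_support C n A x"])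
      fix s
      interpret V: module k "part n s A" by (rule obj_space[OF A])
      show "y s \<in> carrier (part n s A)"
        using comp_closed[OF insert.prems(1), of s] comp_closed[OF tot_zero_closed[OF A], of n s]
        by (cases "s = p") (simp_all add: y_def tot_zero)
    qed (use finite_support[OF insert.prems(1)] in \<open>auto simp: y_def outside_support\<close>)
    have "tot_support C n A y \<subseteq> S"
      using insert.prems(2) by (auto simp: y_def tot_support_def split: if_splits)
    then have "P y" using insert.IH y_mem by blast
    moreover have "x = single n A p (x p) \<oplus>\<^bsub>tot n A\<^esub> y"
    proof
      fix s
      have V: "module k (part n s A)" for s by (rule obj_space[OF A])
      note grp = module.axioms(2)[OF V]
      show "x s = (single n A p (x p) \<oplus>\<^bsub>tot n A\<^esub> y) s"
        using comp_closed[OF insert.prems(1)]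
          abelian_monoid.r_zero[OF abelian_group.axioms(1)[OF grp]] abelian_groupE(5)[OF grp]
        by (simp add: tot_add single_def y_def)
    qed
    ultimately show ?case using add[OF comp_closed[OF insert.prems(1)] y_mem, of p] by simp
  qed
  then show ?thesis using finite_support[OF x] x by blast
qed

text \<open>
  Multilinear identities on \<open>Tot\<close>, applied to one argument at a time, reduce to families with a single
  nonzero member. On those the finite sum in the exterior product has one term.
\<close>

lemma linear_ext:
  assumes A: "A \<in> Obj M" and W: "module k W"
    and f: "linear_map k (tot n A) W f" and g: "linear_map k (tot n A) W g"
    and eq: "\<And>p a. a \<in> carrier (part n p A) \<Longrightarrow> f (single n A p a) = g (single n A p a)"
    and x: "x \<in> carrier (tot n A)"
  shows "f x = g x"
proof (rule tot_induct[OF A x])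
  note T = tot_module[OF A]
  show "f \<zero>\<^bsub>tot n A\<^esub> = g \<zero>\<^bsub>tot n A\<^esub>"
    by (simp add: linear_map_zero[OF T W f] linear_map_zero[OF T W g])
  show "f (single n A p a \<oplus>\<^bsub>tot n A\<^esub> y) = g (single n A p a \<oplus>\<^bsub>tot n A\<^esub> y)"
    if "a \<in> carrier (part n p A)" "y \<in> carrier (tot n A)" "f y = g y" for p a y
    using that eq single_closed[OF A that(1)]
    by (simp add: linear_map_add[OF f] linear_map_add[OF g])
qed

section \<open>Functoriality and exterior products\<close>

lemma tot_mor_linear:
  assumes A: "A \<in> Obj M" and B: "B \<in> Obj M" and f: "f \<in> carrier (Hom M A B)"
  shows "linear_map k (tot n A) (tot n B) (FMor T n f)"
proof -
  note l = mor_linear[OF A B f]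
  have "FMor T n f x \<in> carrier (tot n B)" if x: "x \<in> carrier (tot n A)" for x
    by (rule tot_memI[where S = "tot_support C n A x"])
      (use x finite_support comp_closed[OF x] linear_map_closed[OF l] outside_support[of _ n A x]
        linear_map_zero[OF obj_space[OF A] obj_space[OF B] l] in \<open>simp_all add: FMor_Tot\<close>)
  moreover have "FMor T n f (x \<oplus>\<^bsub>tot n A\<^esub> y) = FMor T n f x \<oplus>\<^bsub>tot n B\<^esub> FMor T n f y"
    if "x \<in> carrier (tot n A)" "y \<in> carrier (tot n A)" for x y
    using that by (intro ext) (simp add: FMor_Tot tot_add linear_map_add[OF l] comp_closed)
  moreover have "FMor T n f (c \<odot>\<^bsub>tot n A\<^esub> x) = c \<odot>\<^bsub>tot n B\<^esub> FMor T n f x"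
    if "c \<in> carrier k" "x \<in> carrier (tot n A)" for c x
    using that by (intro ext) (simp add: FMor_Tot tot_smult linear_map_smult[OF l] comp_closed)
  ultimately show ?thesis by (simp add: linear_map_def)
qed

lemma FMor_single:
  assumes A: "A \<in> Obj M" and B: "B \<in> Obj M" and f: "f \<in> carrier (Hom M A B)"
  shows "FMor T n f (single n A p a) = single n B p (FMor C (p, n - p) f a)"
  by (rule ext) (simp add: FMor_Tot single_def linear_map_zero[OF obj_space[OF A] obj_space[OF B] mor_linear[OF A B f]])

text \<open>
  The contribution of the member of \<open>x\<close> in column \<open>p\<close> to the member of the product in column \<open>s\<close>.
\<close>

definition prod_term :: "int \<Rightarrow> int \<Rightarrow> 'o \<Rightarrow> 'o \<Rightarrow> (int \<Rightarrow> 'v) \<Rightarrow> (int \<Rightarrow> 'v) \<Rightarrow> int \<Rightarrow> int \<Rightarrow> 'v" where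
  "prod_term m n A B x y s p = FProd C (p, m - p) (s - p, n - (s - p)) A B (x p) (y (s - p))"

lemma component_prod_linear:
  assumes A: "A \<in> Obj M" and B: "B \<in> Obj M"
  shows component_prod_linear_right: "a \<in> carrier (part m p A) \<Longrightarrow>
      linear_map k (part n u B) (part (m + n) (p + u) (A \<boxtimes> B))
        (FProd C (p, m - p) (u, n - u) A B a)"
    and component_prod_linear_left: "b \<in> carrier (part n u B) \<Longrightarrow>
      linear_map k (part m p A) (part (m + n) (p + u) (A \<boxtimes> B))
        (\<lambda>a. FProd C (p, m - p) (u, n - u) A B a b)"
proof -
  have ix: "(p, m - p) + (u, n - u) = (p + u, m + n - (p + u))" by simp
  show "a \<in> carrier (part m p A) \<Longrightarrow>
      linear_map k (part n u B) (part (m + n) (p + u) (A \<boxtimes> B))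
        (FProd C (p, m - p) (u, n - u) A B a)"
    using prod_linear_right[OF A B, of a "(p, m - p)" "(u, n - u)"] unfolding ix .
  show "b \<in> carrier (part n u B) \<Longrightarrow>
      linear_map k (part m p A) (part (m + n) (p + u) (A \<boxtimes> B))
        (\<lambda>a. FProd C (p, m - p) (u, n - u) A B a b)"
    using prod_linear_left[OF A B, of b "(u, n - u)" "(p, m - p)"] unfolding ix .
qed

lemma prod_term_linear:
  assumes A: "A \<in> Obj M" and B: "B \<in> Obj M"
  shows prod_term_linear_right: "x \<in> carrier (tot m A) \<Longrightarrow>
      linear_map k (tot n B) (part (m + n) s (A \<boxtimes> B)) (\<lambda>y. prod_term m n A B x y s p)"
    and prod_term_linear_left: "y \<in> carrier (tot n B) \<Longrightarrow>
      linear_map k (tot m A) (part (m + n) s (A \<boxtimes> B)) (\<lambda>x. prod_term m n A B x y s p)"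
proof -
  have ev: "linear_map k (tot n' A') (part n' p A') (\<lambda>x. x p)" for n' A' p
    by (auto simp: linear_map_def tot_add tot_smult comp_closed)
  show "linear_map k (tot n B) (part (m + n) s (A \<boxtimes> B)) (\<lambda>y. prod_term m n A B x y s p)"
    if x: "x \<in> carrier (tot m A)"
    using linear_map_comp[OF ev component_prod_linear_right[OF A B comp_closed[OF x, of p], where u = "s - p" and n = n]]
    unfolding prod_term_def by simp
  show "linear_map k (tot m A) (part (m + n) s (A \<boxtimes> B)) (\<lambda>x. prod_term m n A B x y s p)"
    if y: "y \<in> carrier (tot n B)"
    using linear_map_comp[OF ev component_prod_linear_left[OF A B comp_closed[OF y, of "s - p"], where p = p and m = m]]
    unfolding prod_term_def by simp
qed

lemma prod_term_closed:
  "\<lbrakk>A \<in> Obj M; B \<in> Obj M; x \<in> carrier (tot m A); y \<in> carrier (tot n B)\<rbrakk> \<Longrightarrow>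
    prod_term m n A B x y s p \<in> carrier (part (m + n) s (A \<boxtimes> B))"
  by (rule linear_map_closed[OF prod_term_linear_right])

lemma prod_term_zero:
  assumes A: "A \<in> Obj M" and B: "B \<in> Obj M"
    and x: "x \<in> carrier (tot m A)" and y: "y \<in> carrier (tot n B)"
    and 0: "p \<notin> tot_support C m A x \<or> s - p \<notin> tot_support C n B y"
  shows "prod_term m n A B x y s p = \<zero>\<^bsub>part (m + n) s (A \<boxtimes> B)\<^esub>"
proof -
  have ix: "p + (s - p) = s" by simp
  note AB = obj_space[OF tens_obj[OF A B]]
  show ?thesis
    using 0
  proof
    assume "p \<notin> tot_support C m A x"
    from outside_support[OF this] show ?thesis
      unfolding prod_term_def
      using linear_map_zero[OF obj_space[OF A] AB component_prod_linear_left[OF A B comp_closed[OF y]], of p m "s - p"]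
      by simp
  next
    assume "s - p \<notin> tot_support C n B y"
    from outside_support[OF this] show ?thesis
      unfolding prod_term_def
      using linear_map_zero[OF obj_space[OF B] AB component_prod_linear_right[OF A B comp_closed[OF x]], of p "s - p" n]
      by simp
  qed
qed

text \<open>
  Outside the support of \<open>x\<close> the terms vanish; so the products of two families and of their sum can be
  computed over a common index set.
\<close>

lemma FProd_Tot:
  assumes A: "A \<in> Obj M" and B: "B \<in> Obj M"
    and x: "x \<in> carrier (tot m A)" and y: "y \<in> carrier (tot n B)"
    and S: "finite S" "tot_support C m A x \<subseteq> S"
  shows "FProd T m n A B x y s = (\<Oplus>\<^bsub>part (m + n) s (A \<boxtimes> B)\<^esub>p\<in>S. prod_term m n A B x y s p)"
proof -
  interpret W: module k "part (m + n) s (A \<boxtimes> B)" by (rule obj_space[OF tens_obj[OF A B]])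
  have "FProd T m n A B x y s = finsum (part (m + n) s (A \<boxtimes> B)) (prod_term m n A B x y s) (tot_support C m A x)"
    by (simp add: Tot_def prod_term_def[abs_def])
  also have "\<dots> = finsum (part (m + n) s (A \<boxtimes> B)) (prod_term m n A B x y s) S"
    by (rule W.M.add.finprod_mono_neutral_cong_left)
      (use S prod_term_closed[OF A B x y] prod_term_zero[OF A B x y] in auto)
  finally show ?thesis .
qed

lemma tot_prod_closed:
  assumes A: "A \<in> Obj M" and B: "B \<in> Obj M"
    and x: "x \<in> carrier (tot m A)" and y: "y \<in> carrier (tot n B)"
  shows "FProd T m n A B x y \<in> carrier (tot (m + n) (A \<boxtimes> B))"
proof (rule tot_memI[where S = "(\<lambda>(p, u). p + u) ` (tot_support C m A x \<times> tot_support C n B y)"])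
  show "finite ((\<lambda>(p, u). p + u) ` (tot_support C m A x \<times> tot_support C n B y))"
    using finite_support[OF x] finite_support[OF y] by simp
  fix s
  interpret W: module k "part (m + n) s (A \<boxtimes> B)" by (rule obj_space[OF tens_obj[OF A B]])
  note eq = FProd_Tot[OF A B x y finite_support[OF x] subset_refl, of s]
  show "FProd T m n A B x y s \<in> carrier (part (m + n) s (A \<boxtimes> B))"
    unfolding eq by (rule W.M.finsum_closed) (use prod_term_closed[OF A B x y] in auto)
  assume s: "s \<notin> (\<lambda>(p, u). p + u) ` (tot_support C m A x \<times> tot_support C n B y)"
  have "prod_term m n A B x y s p = \<zero>\<^bsub>part (m + n) s (A \<boxtimes> B)\<^esub>" if "p \<in> tot_support C m A x" for p
  proof -
    have "s - p \<notin> tot_support C n B y" using s that by (force simp: image_iff)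
    then show ?thesis using prod_term_zero[OF A B x y] by blast
  qed
  then show "FProd T m n A B x y s = \<zero>\<^bsub>part (m + n) s (A \<boxtimes> B)\<^esub>"
    unfolding eq by (intro W.M.add.finprod_one_eqI) auto
qed

lemma tot_prod_linear_right:
  assumes A: "A \<in> Obj M" and B: "B \<in> Obj M" and x: "x \<in> carrier (tot m A)"
  shows "linear_map k (tot n B) (tot (m + n) (A \<boxtimes> B)) (FProd T m n A B x)"
proof -
  note l = prod_term_linear_right[OF A B x, of n]
  note eq = FProd_Tot[OF A B x _ finite_support[OF x] subset_refl]
  note cl = prod_term_closed[OF A B x]
  have "FProd T m n A B x (y \<oplus>\<^bsub>tot n B\<^esub> z)
      = FProd T m n A B x y \<oplus>\<^bsub>tot (m + n) (A \<boxtimes> B)\<^esub> FProd T m n A B x z"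
    if y: "y \<in> carrier (tot n B)" and z: "z \<in> carrier (tot n B)" for y z
  proof
    fix s
    interpret W: module k "part (m + n) s (A \<boxtimes> B)" by (rule obj_space[OF tens_obj[OF A B]])
    show "FProd T m n A B x (y \<oplus>\<^bsub>tot n B\<^esub> z) s
      = (FProd T m n A B x y \<oplus>\<^bsub>tot (m + n) (A \<boxtimes> B)\<^esub> FProd T m n A B x z) s"
      using cl[OF y] cl[OF z]
      by (simp add: eq y z tot_add_closed[OF B] tot_add linear_map_add[OF l] W.M.finsum_addf)
  qed
  moreover have "FProd T m n A B x (c \<odot>\<^bsub>tot n B\<^esub> y)
      = c \<odot>\<^bsub>tot (m + n) (A \<boxtimes> B)\<^esub> FProd T m n A B x y"
    if c: "c \<in> carrier k" and y: "y \<in> carrier (tot n B)" for c y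
  proof
    fix s
    interpret W: module k "part (m + n) s (A \<boxtimes> B)" by (rule obj_space[OF tens_obj[OF A B]])
    show "FProd T m n A B x (c \<odot>\<^bsub>tot n B\<^esub> y) s
      = (c \<odot>\<^bsub>tot (m + n) (A \<boxtimes> B)\<^esub> FProd T m n A B x y) s"
      using cl[OF y] c
      by (simp add: eq y tot_smult_closed[OF B] tot_smult linear_map_smult[OF l]
          W.finsum_smult_ldistr[OF finite_support[OF x]])
  qed
  ultimately show ?thesis
    using tot_prod_closed[OF A B x] by (auto simp: linear_map_def)
qed

lemma tot_prod_linear_left:
  assumes A: "A \<in> Obj M" and B: "B \<in> Obj M" and y: "y \<in> carrier (tot n B)"
  shows "linear_map k (tot m A) (tot (m + n) (A \<boxtimes> B)) (\<lambda>x. FProd T m n A B x y)"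
proof -
  note l = prod_term_linear_left[OF A B y, of m]
  note cl = prod_term_closed[OF A B _ y, of _ m]
  have supp: "tot_support C m A z \<subseteq> S" if "\<And>p. p \<notin> S \<Longrightarrow> z p = \<zero>\<^bsub>part m p A\<^esub>" for z S
    using that by (auto simp: tot_support_def)
  have "FProd T m n A B (x \<oplus>\<^bsub>tot m A\<^esub> z) y
      = FProd T m n A B x y \<oplus>\<^bsub>tot (m + n) (A \<boxtimes> B)\<^esub> FProd T m n A B z y"
    if x: "x \<in> carrier (tot m A)" and z: "z \<in> carrier (tot m A)" for x z
  proof
    fix s
    interpret W: module k "part (m + n) s (A \<boxtimes> B)" by (rule obj_space[OF tens_obj[OF A B]])
    let ?S = "tot_support C m A x \<union> tot_support C m A z"
    have S: "finite ?S" using finite_support[OF x] finite_support[OF z] by simp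
    have "tot_support C m A (x \<oplus>\<^bsub>tot m A\<^esub> z) \<subseteq> ?S"
    proof (rule supp)
      fix p assume "p \<notin> ?S"
      interpret V: module k "part m p A" by (rule obj_space[OF A])
      show "(x \<oplus>\<^bsub>tot m A\<^esub> z) p = \<zero>\<^bsub>part m p A\<^esub>"
        using \<open>p \<notin> ?S\<close> outside_support[of p m A x] outside_support[of p m A z] by (simp add: tot_add)
    qed
    then show "FProd T m n A B (x \<oplus>\<^bsub>tot m A\<^esub> z) y s
      = (FProd T m n A B x y \<oplus>\<^bsub>tot (m + n) (A \<boxtimes> B)\<^esub> FProd T m n A B z y) s"
      using cl[OF x] cl[OF z] S FProd_Tot[OF A B x y S] FProd_Tot[OF A B z y S]
        FProd_Tot[OF A B tot_add_closed[OF A x z] y S]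
      by (simp add: x z tot_add linear_map_add[OF l] W.M.finsum_addf)
  qed
  moreover have "FProd T m n A B (c \<odot>\<^bsub>tot m A\<^esub> x) y
      = c \<odot>\<^bsub>tot (m + n) (A \<boxtimes> B)\<^esub> FProd T m n A B x y"
    if c: "c \<in> carrier k" and x: "x \<in> carrier (tot m A)" for c x
  proof
    fix s
    interpret W: module k "part (m + n) s (A \<boxtimes> B)" by (rule obj_space[OF tens_obj[OF A B]])
    note S = finite_support[OF x]
    have "tot_support C m A (c \<odot>\<^bsub>tot m A\<^esub> x) \<subseteq> tot_support C m A x"
    proof (rule supp)
      fix p assume "p \<notin> tot_support C m A x"
      interpret V: module k "part m p A" by (rule obj_space[OF A])
      show "(c \<odot>\<^bsub>tot m A\<^esub> x) p = \<zero>\<^bsub>part m p A\<^esub>"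
        using outside_support[OF \<open>p \<notin> tot_support C m A x\<close>] c by (simp add: tot_smult)
    qed
    then show "FProd T m n A B (c \<odot>\<^bsub>tot m A\<^esub> x) y s
      = (c \<odot>\<^bsub>tot (m + n) (A \<boxtimes> B)\<^esub> FProd T m n A B x y) s"
      using cl[OF x] c FProd_Tot[OF A B x y S] FProd_Tot[OF A B tot_smult_closed[OF A c x] y S]
      by (simp add: x tot_smult linear_map_smult[OF l] W.finsum_smult_ldistr[OF S])
  qed
  ultimately show ?thesis
    using tot_prod_closed[OF A B _ y] by (auto simp: linear_map_def)
qed

lemma FProd_single:
  assumes A: "A \<in> Obj M" and B: "B \<in> Obj M"
    and a: "a \<in> carrier (part m p A)" and b: "b \<in> carrier (part n u B)"
  shows "FProd T m n A B (single m A p a) (single n B u b) =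
    single (m + n) (A \<boxtimes> B) (p + u) (FProd C (p, m - p) (u, n - u) A B a b)"
proof
  fix s
  interpret W: module k "part (m + n) s (A \<boxtimes> B)" by (rule obj_space[OF tens_obj[OF A B]])
  note x = single_closed[OF A a] and y = single_closed[OF B b]
  have supp: "tot_support C m A (single m A p a) \<subseteq> {p}"
    by (auto simp: tot_support_def single_def)
  have "FProd T m n A B (single m A p a) (single n B u b) s
      = prod_term m n A B (single m A p a) (single n B u b) s p"
    using FProd_Tot[OF A B x y _ supp, of s] prod_term_closed[OF A B x y] W.M.finsum_insert[of "{}" p]
    by simp
  also have "\<dots> = single (m + n) (A \<boxtimes> B) (p + u) (FProd C (p, m - p) (u, n - u) A B a b) s"
  proof (cases "s = p + u")
    case True
    then show ?thesis by (simp add: prod_term_def single_def)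
  next
    case False
    then have "s - p \<notin> tot_support C n B (single n B u b)" by (auto simp: tot_support_def single_def)
    then show ?thesis using False prod_term_zero[OF A B x y, of p s] by (simp add: single_def)
  qed
  finally show "FProd T m n A B (single m A p a) (single n B u b) s =
    single (m + n) (A \<boxtimes> B) (p + u) (FProd C (p, m - p) (u, n - u) A B a b) s" .
qed

theorem Tot_lax: "graded_lax_functor k M T"
proof (rule graded_lax_functor.intro, unfold FObj_Tot, goal_cases)
  case (1 A g) then show ?case by (rule tot_module)
next
  case (2 A B f g) then show ?case by (rule tot_mor_linear)
next
  case (3 A x g) then show ?case by (intro ext) (simp add: FMor_Tot mor_id comp_closed)
next
  case (4 A B D f f' x g)
  then show ?case by (intro ext) (simp add: FMor_Tot mor_comp[of A B D] comp_closed)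
next
  case (5 A B f f' x g)
  then show ?case by (intro ext) (simp add: FMor_Tot tot_add mor_additive[of A B] comp_closed)
next
  case (6 A B g h)
  then show ?case by (simp add: bilinear_map_def tot_prod_linear_left tot_prod_linear_right)
next
  case (7 A A' B B' f f' x g y h)
  note AB = tens_obj[OF 7(1,3)] and AB' = tens_obj[OF 7(2,4)] and ff = tens_hom[OF 7(1-6)]
  note W = tot_module[OF AB', of "g + h"]
  note x' = linear_map_closed[OF tot_mor_linear[OF 7(1,2,5)] 7(7)]
    and y' = linear_map_closed[OF tot_mor_linear[OF 7(3,4,6)]]
  have ix: "(p, g - p) + (u, h - u) = (p + u, g + h - (p + u))" for p u by simp
  show ?case
  proof (rule linear_ext[OF 7(1) W linear_map_comp[OF tot_prod_linear_left[OF 7(1,3,8)] tot_mor_linear[OF AB AB' ff]]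
        linear_map_comp[OF tot_mor_linear[OF 7(1,2,5)] tot_prod_linear_left[OF 7(2,4) y'[OF 7(8)]]] _ 7(7)])
    fix p a assume a: "a \<in> carrier (part g p A)"
    note a' = single_closed[OF 7(1) a]
    note fa = linear_map_closed[OF tot_mor_linear[OF 7(1,2,5)] a']
    show "FMor T (g + h) (f \<star> f') (FProd T g h A B (single g A p a) y) =
         FProd T g h A' B' (FMor T g f (single g A p a)) (FMor T h f' y)"
    proof (rule linear_ext[OF 7(3) W linear_map_comp[OF tot_prod_linear_right[OF 7(1,3) a'] tot_mor_linear[OF AB AB' ff]]
          linear_map_comp[OF tot_mor_linear[OF 7(3,4,6)] tot_prod_linear_right[OF 7(2,4) fa]] _ 7(8)])
      fix u b assume b: "b \<in> carrier (part h u B)"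
      have "FMor C (p + u, g + h - (p + u)) (f \<star> f') (FProd C (p, g - p) (u, h - u) A B a b)
          = FProd C (p, g - p) (u, h - u) A' B' (FMor C (p, g - p) f a) (FMor C (u, h - u) f' b)"
        using prod_natural[OF 7(1-6) a b] unfolding ix .
      then show "FMor T (g + h) (f \<star> f') (FProd T g h A B (single g A p a) (single h B u b)) =
         FProd T g h A' B' (FMor T g f (single g A p a)) (FMor T h f' (single h B u b))"
        by (simp add: FProd_single[OF 7(1,3) a b] FMor_single[OF AB AB' ff] FMor_single[OF 7(1,2,5)]
            FMor_single[OF 7(3,4,6)]
            FProd_single[OF 7(2,4) mor_closed[OF 7(1,2,5) a] mor_closed[OF 7(3,4,6) b]])
    qed
  qed
next
  case (8 A B D x g y h z l)
  note AB = tens_obj[OF 8(1,2)] and BD = tens_obj[OF 8(2,3)]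
  note L = tens_obj[OF AB 8(3)] and R = tens_obj[OF 8(1) BD] and as = assoc_hom[OF 8(1-3)]
  note W = tot_module[OF R, of "g + h + l"]
  note as_lin = tot_mor_linear[OF L R as, of "g + h + l"]
  have right: "linear_map k (tot (h + l) (B \<boxtimes> D)) (tot (g + h + l) (A \<boxtimes> B \<boxtimes> D))
      (FProd T g (h + l) A (B \<boxtimes> D) a)" if "a \<in> carrier (tot g A)" for a
    using tot_prod_linear_right[OF 8(1) BD that, of "h + l"] by (simp add: add.assoc)
  have left: "linear_map k (tot g A) (tot (g + h + l) (A \<boxtimes> B \<boxtimes> D))
      (\<lambda>a. FProd T g (h + l) A (B \<boxtimes> D) a b)" if "b \<in> carrier (tot (h + l) (B \<boxtimes> D))" for b
    using tot_prod_linear_left[OF 8(1) BD that, of g] by (simp add: add.assoc)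
  have ix: "(p, g - p) + (u, h - u) = (p + u, g + h - (p + u))"
    "(u, h - u) + (w, l - w) = (u + w, h + l - (u + w))"
    "(p + u, g + h - (p + u)) + (w, l - w) = (p + u + w, g + h + l - (p + u + w))" for p u w
    by simp_all
  have c3: "FMor T (g + h + l) (Assoc M A B D) (FProd T (g + h) l (A \<boxtimes> B) D (FProd T g h A B (single g A p a) (single h B u b)) (single l D w c))
      = FProd T g (h + l) A (B \<boxtimes> D) (single g A p a) (FProd T h l B D (single h B u b) (single l D w c))"
    if a: "a \<in> carrier (part g p A)" and b: "b \<in> carrier (part h u B)"
      and c: "c \<in> carrier (part l w D)" for p a u b w c
  proof -
    have ab: "FProd C (p, g - p) (u, h - u) A B a b \<in> carrier (part (g + h) (p + u) (A \<boxtimes> B))"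
      using prod_closed[OF 8(1,2) a b] unfolding ix .
    have bc: "FProd C (u, h - u) (w, l - w) B D b c \<in> carrier (part (h + l) (u + w) (B \<boxtimes> D))"
      using prod_closed[OF 8(2,3) b c] unfolding ix .
    show ?thesis
      using prod_assoc[OF 8(1-3) a b c, unfolded ix]
      by (simp add: FProd_single[OF 8(1,2) a b] FProd_single[OF AB 8(3) ab c] FProd_single[OF 8(2,3) b c]
          FProd_single[OF 8(1) BD a bc] FMor_single[OF L R as] add.assoc)
  qed
  have c2: "FMor T (g + h + l) (Assoc M A B D) (FProd T (g + h) l (A \<boxtimes> B) D (FProd T g h A B (single g A p a) (single h B u b)) z)
      = FProd T g (h + l) A (B \<boxtimes> D) (single g A p a) (FProd T h l B D (single h B u b) z)"
    if a: "a \<in> carrier (part g p A)" and b: "b \<in> carrier (part h u B)" for p a u b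
    by (rule linear_ext[OF 8(3) W linear_map_comp[OF tot_prod_linear_right[OF AB 8(3)
              tot_prod_closed[OF 8(1,2) single_closed[OF 8(1) a] single_closed[OF 8(2) b]]] as_lin]
          linear_map_comp[OF tot_prod_linear_right[OF 8(2,3) single_closed[OF 8(2) b]] right[OF single_closed[OF 8(1) a]]]
          c3[OF a b] 8(6)])
  have c1: "FMor T (g + h + l) (Assoc M A B D) (FProd T (g + h) l (A \<boxtimes> B) D (FProd T g h A B (single g A p a) y) z)
      = FProd T g (h + l) A (B \<boxtimes> D) (single g A p a) (FProd T h l B D y z)"
    if a: "a \<in> carrier (part g p A)" for p a
    by (rule linear_ext[OF 8(2) W linear_map_comp[OF linear_map_comp[OF tot_prod_linear_right[OF 8(1,2)
                single_closed[OF 8(1) a]] tot_prod_linear_left[OF AB 8(3,6)]] as_lin]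
          linear_map_comp[OF tot_prod_linear_left[OF 8(2,3,6)] right[OF single_closed[OF 8(1) a]]]
          c2[OF a] 8(5)])
  show ?case
    by (rule linear_ext[OF 8(1) W linear_map_comp[OF linear_map_comp[OF tot_prod_linear_left[OF 8(1,2,5)]
              tot_prod_linear_left[OF AB 8(3,6)]] as_lin]
          left[OF tot_prod_closed[OF 8(2,3,5,6)]] c1 8(4)])
next
  case 9
  have "FUnit T = single 0 (UnitO M) 0 (FUnit C)" by (auto simp: Tot_def single_def)
  then show ?case using single_closed[OF unit_obj, of "FUnit C" 0 0] unit_mem by (simp add: zero_prod_def)
next
  case (10 A x g)
  have U: "FUnit T = single 0 (UnitO M) 0 (FUnit C)" by (auto simp: Tot_def single_def)
  have u: "FUnit C \<in> carrier (part 0 0 (UnitO M))" using unit_mem by (simp add: zero_prod_def)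
  note UA = tens_obj[OF unit_obj 10(1)]
  note pr = tot_prod_linear_right[OF unit_obj 10(1) single_closed[OF unit_obj u], of g, unfolded add_0_left]
  have id: "linear_map k (tot g A) (tot g A) (\<lambda>x. x)" by (simp add: linear_map_def)
  show ?case
    unfolding U
  proof (rule linear_ext[OF 10(1) tot_module[OF 10(1)] linear_map_comp[OF pr tot_mor_linear[OF UA 10(1) lunit_hom[OF 10(1)]]]
        id _ 10(2)])
    fix p a assume a: "a \<in> carrier (part g p A)"
    show "FMor T g (LUnit M A) (FProd T 0 g (UnitO M) A (single 0 (UnitO M) 0 (FUnit C)) (single g A p a)) = single g A p a"
      using unit_left[OF 10(1) a] FProd_single[OF unit_obj 10(1) u a]
      by (simp add: FMor_single[OF UA 10(1) lunit_hom[OF 10(1)]] zero_prod_def)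
  qed
next
  case (11 A x g)
  have U: "FUnit T = single 0 (UnitO M) 0 (FUnit C)" by (auto simp: Tot_def single_def)
  have u: "FUnit C \<in> carrier (part 0 0 (UnitO M))" using unit_mem by (simp add: zero_prod_def)
  note UA = tens_obj[OF 11(1) unit_obj]
  note pr = tot_prod_linear_left[OF 11(1) unit_obj single_closed[OF unit_obj u], of g, unfolded add_0_right]
  have id: "linear_map k (tot g A) (tot g A) (\<lambda>x. x)" by (simp add: linear_map_def)
  show ?case
    unfolding U
  proof (rule linear_ext[OF 11(1) tot_module[OF 11(1)] linear_map_comp[OF pr tot_mor_linear[OF UA 11(1) runit_hom[OF 11(1)]]]
        id _ 11(2)])
    fix p a assume a: "a \<in> carrier (part g p A)"
    show "FMor T g (RUnit M A) (FProd T g 0 A (UnitO M) (single g A p a) (single 0 (UnitO M) 0 (FUnit C))) = single g A p a"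
      using unit_right[OF 11(1) a] FProd_single[OF 11(1) unit_obj a u]
      by (simp add: FMor_single[OF UA 11(1) runit_hom[OF 11(1)]] zero_prod_def)
  qed
qed

section \<open>The total differential\<close>

lemma dh_linear: "A \<in> Obj M \<Longrightarrow> linear_map k (part n p A) (part (n + 1) (p + 1) A) (dh (p, n - p) A)"
  using horizontal.d_linear[of A "(p, n - p)"] by simp

lemma dv_linear: "A \<in> Obj M \<Longrightarrow> linear_map k (part n p A) (part (n + 1) p A) (dv (p, n - p) A)"
  using vertical.d_linear[of A "(p, n - p)"] by (simp add: algebra_simps)

lemma dh_linear_into: "A \<in> Obj M \<Longrightarrow>
    linear_map k (part n (p - 1) A) (part (n + 1) p A) (dh (p - 1, n - (p - 1)) A)"
  using dh_linear[of A "p - 1" n] by simp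

lemma tot_diff_linear:
  assumes A: "A \<in> Obj M" shows "linear_map k (tot n A) (tot (n + 1) A) (d n A)"
proof -
  have ev: "linear_map k (tot n A) (part n p A) (\<lambda>x. x p)" for p
    by (auto simp: linear_map_def tot_add tot_smult comp_closed)
  have comp: "linear_map k (tot n A) (part (n + 1) p A) (\<lambda>x. d n A x p)" for p
    unfolding tot_diff_def
    by (rule linear_map_sum[OF obj_space[OF A] linear_map_comp[OF ev dh_linear_into[OF A]]
          linear_map_comp[OF ev dv_linear[OF A]]])
  have "d n A x \<in> carrier (tot (n + 1) A)" if x: "x \<in> carrier (tot n A)" for x
  proof (rule tot_memI[where S = "tot_support C n A x \<union> (\<lambda>p. p + 1) ` tot_support C n A x"])
    show "d n A x p \<in> carrier (part (n + 1) p A)" for p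
      using linear_map_closed[OF comp x] .
    show "d n A x p = \<zero>\<^bsub>part (n + 1) p A\<^esub>"
      if p: "p \<notin> tot_support C n A x \<union> (\<lambda>p. p + 1) ` tot_support C n A x" for p
    proof -
      interpret V: module k "part (n + 1) p A" by (rule obj_space[OF A])
      have "p - 1 \<notin> tot_support C n A x" using p by (force simp: image_iff)
      then show ?thesis
        using p outside_support[of p n A x] outside_support[of "p - 1" n A x]
          linear_map_zero[OF obj_space[OF A] obj_space[OF A] dh_linear_into[OF A, of p n]]
          linear_map_zero[OF obj_space[OF A] obj_space[OF A] dv_linear[OF A, of p n]]
        by (simp add: tot_diff_def)
    qed
  qed (use finite_support[OF x] in simp)
  then show ?thesis
    using linear_map_add[OF comp] linear_map_smult[OF comp]
    by (auto simp: linear_map_def tot_add tot_smult fun_eq_iff)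
qed

lemma tot_diff_single:
  assumes A: "A \<in> Obj M" and a: "a \<in> carrier (part n p A)"
  shows "d n A (single n A p a) = single (n + 1) A (p + 1) (dh (p, n - p) A a) \<oplus>\<^bsub>tot (n + 1) A\<^esub>
    single (n + 1) A p (dv (p, n - p) A a)"
proof
  fix s
  interpret V: module k "part (n + 1) s A" by (rule obj_space[OF A])
  note dh0 = linear_map_zero[OF obj_space[OF A] obj_space[OF A] dh_linear_into[OF A, of s n]]
    and dv0 = linear_map_zero[OF obj_space[OF A] obj_space[OF A] dv_linear[OF A, of s n]]
  have dhc: "s = p + 1 \<Longrightarrow> dh (p, n - p) A a \<in> carrier (part (n + 1) s A)"
    using linear_map_closed[OF dh_linear[OF A] a] by simp
  have dvc: "s = p \<Longrightarrow> dv (p, n - p) A a \<in> carrier (part (n + 1) s A)"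
    using linear_map_closed[OF dv_linear[OF A] a] by simp
  show "d n A (single n A p a) s = (single (n + 1) A (p + 1) (dh (p, n - p) A a) \<oplus>\<^bsub>tot (n + 1) A\<^esub>
    single (n + 1) A p (dv (p, n - p) A a)) s"
    using dh0 dv0 dhc dvc V.M.zero_closed
    by (cases "s = p + 1"; cases "s = p") (simp_all add: tot_diff_def tot_add single_def)
qed

text \<open>
  Of the four terms \<open>dh dh\<close>, \<open>dh dv\<close>, \<open>dv dh\<close>, \<open>dv dv\<close> the outer two vanish and the inner two, which lie in the
  same column, cancel.
\<close>

lemma tot_diff_square:
  assumes A: "A \<in> Obj M" and x: "x \<in> carrier (tot n A)"
  shows "d (n + 1) A (d n A x) = \<zero>\<^bsub>tot (n + 1 + 1) A\<^esub>"
proof (rule linear_ext[OF A tot_module[OF A] linear_map_comp[OF tot_diff_linear[OF A] tot_diff_linear[OF A]] _ _ x])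
  interpret W: module k "tot (n + 1 + 1) A" by (rule tot_module[OF A])
  show "linear_map k (tot n A) (tot (n + 1 + 1) A) (\<lambda>x. \<zero>\<^bsub>tot (n + 1 + 1) A\<^esub>)"
    by (rule linear_map_const_zero[OF tot_module[OF A]])
  fix p a assume a: "a \<in> carrier (part n p A)"
  let ?h = "dh (p, n - p) A a" and ?v = "dv (p, n - p) A a"
  have hc: "?h \<in> carrier (part (n + 1) (p + 1) A)" by (rule linear_map_closed[OF dh_linear[OF A] a])
  have vc: "?v \<in> carrier (part (n + 1) p A)" by (rule linear_map_closed[OF dv_linear[OF A] a])
  have hh: "dh (p + 1, n + 1 - (p + 1)) A ?h = \<zero>\<^bsub>part (n + 1 + 1) (p + 1 + 1) A\<^esub>"
    using horizontal.d_square[OF A a] by simp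
  have vv: "dv (p, n + 1 - p) A ?v = \<zero>\<^bsub>part (n + 1 + 1) p A\<^esub>"
    using vertical.d_square[OF A a] by (simp add: algebra_simps)
  have vh: "dh (p, n + 1 - p) A ?v \<oplus>\<^bsub>part (n + 1 + 1) (p + 1) A\<^esub> dv (p + 1, n + 1 - (p + 1)) A ?h
      = \<zero>\<^bsub>part (n + 1 + 1) (p + 1) A\<^esub>"
    using anticommute[OF A a] by (simp add: algebra_simps)
  have c: "dv (p + 1, n + 1 - (p + 1)) A ?h \<in> carrier (part (n + 1 + 1) (p + 1) A)"
    "dh (p, n + 1 - p) A ?v \<in> carrier (part (n + 1 + 1) (p + 1) A)"
    using linear_map_closed[OF dv_linear[OF A] hc] linear_map_closed[OF dh_linear[OF A] vc] by simp_all
  let ?s = "single (n + 1 + 1) A (p + 1)"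
  have "d (n + 1) A (d n A (single n A p a)) =
      d (n + 1) A (single (n + 1) A (p + 1) ?h) \<oplus>\<^bsub>tot (n + 1 + 1) A\<^esub> d (n + 1) A (single (n + 1) A p ?v)"
    unfolding tot_diff_single[OF A a]
    by (rule linear_map_add[OF tot_diff_linear[OF A] single_closed[OF A hc] single_closed[OF A vc]])
  also have "\<dots> = ?s (dv (p + 1, n + 1 - (p + 1)) A ?h) \<oplus>\<^bsub>tot (n + 1 + 1) A\<^esub> ?s (dh (p, n + 1 - p) A ?v)"
    unfolding tot_diff_single[OF A hc] tot_diff_single[OF A vc] hh vv single_zero
    by (simp only: W.M.l_zero W.M.r_zero single_closed[OF A c(1)] single_closed[OF A c(2)])
  also have "\<dots> = ?s (dh (p, n + 1 - p) A ?v \<oplus>\<^bsub>part (n + 1 + 1) (p + 1) A\<^esub> dv (p + 1, n + 1 - (p + 1)) A ?h)"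
    using W.M.a_comm[OF single_closed[OF A c(1)] single_closed[OF A c(2)]] single_add[OF A] by simp
  also have "\<dots> = \<zero>\<^bsub>tot (n + 1 + 1) A\<^esub>" unfolding vh single_zero ..
  finally show "d (n + 1) A (d n A (single n A p a)) = \<zero>\<^bsub>tot (n + 1 + 1) A\<^esub>" .
qed

lemma single_alternate:
  assumes A: "A \<in> Obj M" and a: "a \<in> carrier (part n p A)"
  shows "alternate (tot n A) m (single n A p a) = single n A p (alternate (part n p A) m a)"
  by (rule linear_map_alternate_commute[OF obj_space[OF A] tot_module[OF A] single_linear[OF A] a, symmetric])

text \<open>
  In bidegree \<open>(p, m - p)\<close> the sign of both Leibniz rules of the bicomplex is \<open>(-1)\<^sup>m\<close>. The terms \<open>e1\<close>, \<open>e2\<close> come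
  from \<open>dh\<close>, the terms \<open>e3\<close>, \<open>e4\<close> from \<open>dv\<close>.
\<close>

lemma tot_diff_leibniz_single:
  assumes A: "A \<in> Obj M" and B: "B \<in> Obj M"
    and a: "a \<in> carrier (part m p A)" and b: "b \<in> carrier (part n u B)"
  defines "x \<equiv> single m A p a" and "y \<equiv> single n B u b" and "W \<equiv> tot (m + n + 1) (A \<boxtimes> B)"
  shows "d (m + n) (A \<boxtimes> B) (FProd T m n A B x y) =
    FProd T (m + 1) n A B (d m A x) y \<oplus>\<^bsub>W\<^esub> alternate W m (FProd T m (n + 1) A B x (d n B y))"
proof -
  note AB = tens_obj[OF A B]
  interpret W: module k W unfolding W_def by (rule tot_module[OF AB])
  let ?N = "m + n + 1"
  let ?s = "single ?N (A \<boxtimes> B)"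
  let ?V1 = "part (?N) (p + u + 1) (A \<boxtimes> B)" and ?V0 = "part (?N) (p + u) (A \<boxtimes> B)"
  let ?ab = "FProd C (p, m - p) (u, n - u) A B a b"
  note dha = linear_map_closed[OF dh_linear[OF A] a] and dva = linear_map_closed[OF dv_linear[OF A] a]
  note dhb = linear_map_closed[OF dh_linear[OF B] b] and dvb = linear_map_closed[OF dv_linear[OF B] b]
  have ab: "?ab \<in> carrier (part (m + n) (p + u) (A \<boxtimes> B))"
    using linear_map_closed[OF component_prod_linear_right[OF A B a] b] .
  define e1 where "e1 = FProd C (p + 1, m + 1 - (p + 1)) (u, n - u) A B (dh (p, m - p) A a) b"
  define e2 where "e2 = FProd C (p, m - p) (u + 1, n + 1 - (u + 1)) A B a (dh (u, n - u) B b)"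
  define e3 where "e3 = FProd C (p, m + 1 - p) (u, n - u) A B (dv (p, m - p) A a) b"
  define e4 where "e4 = FProd C (p, m - p) (u, n + 1 - u) A B a (dv (u, n - u) B b)"
  have ix: "m + 1 + n = ?N" "m + (n + 1) = ?N" "p + 1 + u = p + u + 1" "p + (u + 1) = p + u + 1" by simp_all
  have e1c: "e1 \<in> carrier ?V1"
    using linear_map_closed[OF component_prod_linear_right[OF A B dha] b] unfolding e1_def ix .
  have e2c: "e2 \<in> carrier ?V1"
    using linear_map_closed[OF component_prod_linear_right[OF A B a] dhb] unfolding e2_def ix .
  have e3c: "e3 \<in> carrier ?V0"
    using linear_map_closed[OF component_prod_linear_right[OF A B dva] b] unfolding e3_def ix .
  have e4c: "e4 \<in> carrier ?V0"
    using linear_map_closed[OF component_prod_linear_right[OF A B a] dvb] unfolding e4_def ix .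
  have dh_ab: "dh (p + u, m + n - (p + u)) (A \<boxtimes> B) ?ab = e1 \<oplus>\<^bsub>?V1\<^esub> alternate ?V1 m e2"
    using horizontal.d_leibniz[OF A B a b] by (simp add: e1_def e2_def algebra_simps)
  have dv_ab: "dv (p + u, m + n - (p + u)) (A \<boxtimes> B) ?ab = e3 \<oplus>\<^bsub>?V0\<^esub> alternate ?V0 m e4"
    using vertical.d_leibniz[OF A B a b] by (simp add: e3_def e4_def algebra_simps)
  have sc: "?s (p + u + 1) e1 \<in> carrier W" "?s (p + u + 1) e2 \<in> carrier W"
      "?s (p + u) e3 \<in> carrier W" "?s (p + u) e4 \<in> carrier W"
    unfolding W_def using e1c e2c e3c e4c single_closed[OF AB] by auto
  have alt: "alternate W m (?s (p + u + 1) e2) \<in> carrier W" "alternate W m (?s (p + u) e4) \<in> carrier W"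
    using alternate_closed[OF W.module_axioms] sc by auto
  have add_s: "?s q (v \<oplus>\<^bsub>part (?N) q (A \<boxtimes> B)\<^esub> v') = ?s q v \<oplus>\<^bsub>W\<^esub> ?s q v'" for q v v'
    unfolding W_def by (rule single_add[OF AB, symmetric])
  have alt_s: "?s q (alternate (part (?N) q (A \<boxtimes> B)) m v) = alternate W m (?s q v)"
    if "v \<in> carrier (part (?N) q (A \<boxtimes> B))" for q v
    unfolding W_def by (rule single_alternate[OF AB that, symmetric])
  have "d (m + n) (A \<boxtimes> B) (FProd T m n A B x y) =
      (?s (p + u + 1) e1 \<oplus>\<^bsub>W\<^esub> alternate W m (?s (p + u + 1) e2)) \<oplus>\<^bsub>W\<^esub>
      (?s (p + u) e3 \<oplus>\<^bsub>W\<^esub> alternate W m (?s (p + u) e4))"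
    unfolding x_def y_def FProd_single[OF A B a b] tot_diff_single[OF AB ab] dh_ab dv_ab
    by (simp only: add_s alt_s[OF e2c] alt_s[OF e4c] W_def[symmetric])
  also have "\<dots> = (?s (p + u + 1) e1 \<oplus>\<^bsub>W\<^esub> ?s (p + u) e3) \<oplus>\<^bsub>W\<^esub>
      alternate W m (?s (p + u + 1) e2 \<oplus>\<^bsub>W\<^esub> ?s (p + u) e4)"
    using sc alt by (simp add: alternate_add[OF W.module_axioms] W.M.a_ac)
  also have "?s (p + u + 1) e1 \<oplus>\<^bsub>W\<^esub> ?s (p + u) e3 = FProd T (m + 1) n A B (d m A x) y"
    using linear_map_add[OF tot_prod_linear_left[OF A B single_closed[OF B b], of "m + 1"]
        single_closed[OF A dha] single_closed[OF A dva]]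
    unfolding x_def y_def tot_diff_single[OF A a] FProd_single[OF A B dha b] FProd_single[OF A B dva b]
      e1_def[symmetric] e3_def[symmetric] ix W_def by simp
  also have "?s (p + u + 1) e2 \<oplus>\<^bsub>W\<^esub> ?s (p + u) e4 = FProd T m (n + 1) A B x (d n B y)"
    using linear_map_add[OF tot_prod_linear_right[OF A B single_closed[OF A a], of "n + 1"]
        single_closed[OF B dhb] single_closed[OF B dvb]]
    unfolding x_def y_def tot_diff_single[OF B b] FProd_single[OF A B a dhb] FProd_single[OF A B a dvb]
      e2_def[symmetric] e4_def[symmetric] ix W_def by simp
  finally show ?thesis .
qed

lemma tot_diff_leibniz:
  assumes A: "A \<in> Obj M" and B: "B \<in> Obj M"
    and x: "x \<in> carrier (tot m A)" and y: "y \<in> carrier (tot n B)"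
  defines "W \<equiv> tot (m + n + 1) (A \<boxtimes> B)"
  shows "d (m + n) (A \<boxtimes> B) (FProd T m n A B x y) =
    FProd T (m + 1) n A B (d m A x) y \<oplus>\<^bsub>W\<^esub> alternate W m (FProd T m (n + 1) A B x (d n B y))"
proof -
  note AB = tens_obj[OF A B]
  have W: "module k W" unfolding W_def by (rule tot_module[OF AB])
  have ix: "m + 1 + n = m + n + 1" "m + (n + 1) = m + n + 1" by simp_all
  note dAB = tot_diff_linear[OF AB, of "m + n", folded W_def]
  note dA = tot_diff_linear[OF A, of m] and dB = tot_diff_linear[OF B, of n]
  note right = tot_prod_linear_right[OF A B, where n = "n + 1", of _ m, unfolded ix, folded W_def]
    and right' = tot_prod_linear_right[OF A B, where m = "m + 1", of _ n, unfolded ix, folded W_def]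
    and left = tot_prod_linear_left[OF A B, where m = "m + 1", of _ n, unfolded ix, folded W_def]
    and left' = tot_prod_linear_left[OF A B, where n = "n + 1", of _ m, unfolded ix, folded W_def]
  have step: "d (m + n) (A \<boxtimes> B) (FProd T m n A B (single m A p a) y) =
    FProd T (m + 1) n A B (d m A (single m A p a)) y \<oplus>\<^bsub>W\<^esub>
    alternate W m (FProd T m (n + 1) A B (single m A p a) (d n B y))"
    if a: "a \<in> carrier (part m p A)" for p a
  proof -
    note sa = single_closed[OF A a]
    show ?thesis
      by (rule linear_ext[OF B W linear_map_comp[OF tot_prod_linear_right[OF A B sa] dAB]
            linear_map_sum[OF W right'[OF linear_map_closed[OF dA sa]]
              linear_map_comp[OF linear_map_comp[OF dB right[OF sa]] linear_map_alternate[OF W]]] _ y])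
        (unfold W_def, rule tot_diff_leibniz_single[OF A B a])
  qed
  show ?thesis
    by (rule linear_ext[OF A W linear_map_comp[OF tot_prod_linear_left[OF A B y] dAB]
          linear_map_sum[OF W linear_map_comp[OF dA left[OF y]]
            linear_map_comp[OF left'[OF linear_map_closed[OF dB y]] linear_map_alternate[OF W]]] step x])
qed

lemma tot_diff_natural:
  assumes A: "A \<in> Obj M" and B: "B \<in> Obj M" and f: "f \<in> carrier (Hom M A B)"
    and x: "x \<in> carrier (tot n A)"
  shows "d n B (FMor T n f x) = FMor T (n + 1) f (d n A x)"
proof
  fix p
  have ix: "(p - 1, n - (p - 1)) + (1, 0) = (p, n + 1 - p)" by simp
  have h: "dh (p - 1, n - (p - 1)) B (FMor C (p - 1, n - (p - 1)) f (x (p - 1))) =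
      FMor C (p, n + 1 - p) f (dh (p - 1, n - (p - 1)) A (x (p - 1)))"
    using horizontal.d_natural[OF A B f comp_closed[OF x, of "p - 1"]] unfolding ix .
  have v: "dv (p, n - p) B (FMor C (p, n - p) f (x p)) = FMor C (p, n + 1 - p) f (dv (p, n - p) A (x p))"
    using vertical.d_natural[OF A B f comp_closed[OF x, of p]] by (simp add: algebra_simps)
  show "d n B (FMor T n f x) p = FMor T (n + 1) f (d n A x) p"
    unfolding tot_diff_def FMor_Tot h v
    by (rule linear_map_add[OF mor_linear[OF A B f] linear_map_closed[OF dh_linear_into[OF A] comp_closed[OF x]]
          linear_map_closed[OF dv_linear[OF A] comp_closed[OF x]], symmetric])
qed

lemma tot_diff_unit: "d 0 (UnitO M) (FUnit T) = \<zero>\<^bsub>tot 1 (UnitO M)\<^esub>"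
proof -
  interpret W: module k "tot 1 (UnitO M)" by (rule tot_module[OF unit_obj])
  have U: "FUnit T = single 0 (UnitO M) 0 (FUnit C)" by (auto simp: Tot_def single_def)
  have u: "FUnit C \<in> carrier (part 0 0 (UnitO M))" using unit_mem by (simp add: zero_prod_def)
  have "single 1 (UnitO M) 1 (dh (0, 0) (UnitO M) (FUnit C)) = \<zero>\<^bsub>tot 1 (UnitO M)\<^esub>"
    using horizontal.d_unit single_zero[of 1 "UnitO M" 1] by (simp add: zero_prod_def)
  moreover have "single 1 (UnitO M) 0 (dv (0, 0) (UnitO M) (FUnit C)) = \<zero>\<^bsub>tot 1 (UnitO M)\<^esub>"
    using vertical.d_unit single_zero[of 1 "UnitO M" 0] by (simp add: zero_prod_def)
  ultimately show ?thesis
    unfolding U using tot_diff_single[OF unit_obj u] by simp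
qed

end

section \<open>The column and row filtrations\<close>

text \<open>
  \<open>w n p\<close> is the filtration degree of column \<open>p\<close> in total degree \<open>n\<close>: \<open>p\<close> for the column filtration, \<open>n - p\<close>
  for the row filtration. Additivity makes the filtration multiplicative; neither \<open>dh\<close>, which raises \<open>n\<close>
  and \<open>p\<close>, nor \<open>dv\<close>, which raises \<open>n\<close>, may lower the weight.
\<close>

locale weighted_bicomplex = bicomplex_over_monoidal_category k M C dh dv
  for k :: "('k, 'r) ring_scheme" and M :: "('k, 'o, 'm, 'c) linear_moncat_scheme" (structure)
    and C :: "(int \<times> int, 'k, 'o, 'm, 'v) lax_functor"
    and dh dv :: "int \<times> int \<Rightarrow> 'o \<Rightarrow> 'v \<Rightarrow> 'v" +
  fixes w :: "int \<Rightarrow> int \<Rightarrow> int"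
  assumes w_add: "w (m + n) (p + u) = w m p + w n u"
    and w_dh: "w n p \<le> w (n + 1) (p + 1)"
    and w_dv: "w n p \<le> w (n + 1) p"
begin

definition weight_fil :: "int \<Rightarrow> int \<Rightarrow> 'o \<Rightarrow> (int \<Rightarrow> 'v) set" where
  "weight_fil s n A = {x \<in> carrier (tot n A). \<forall>p\<in>tot_support C n A x. s \<le> w n p}"

lemma weight_filI:
  assumes "x \<in> carrier (tot n A)" and "\<And>p. w n p < s \<Longrightarrow> x p = \<zero>\<^bsub>part n p A\<^esub>"
  shows "x \<in> weight_fil s n A"
  using assms by (force simp: weight_fil_def tot_support_def not_le)

lemma weight_filD:
  assumes "x \<in> weight_fil s n A"
  shows "x \<in> carrier (tot n A)" and "w n p < s \<Longrightarrow> x p = \<zero>\<^bsub>part n p A\<^esub>"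
  using assms by (force simp: weight_fil_def tot_support_def not_le)+

theorem weight_filtered: "filtered_differential_functor k M T d weight_fil"
proof (intro filtered_differential_functor.intro filtered_differential_functor_axioms.intro
    linear_monoidal_abelian_category_axioms Tot_lax, unfold FObj_Tot, goal_cases)
  case (1 A n) then show ?case by (rule tot_diff_linear)
next
  case (2 A B f x n) then show ?case by (rule tot_diff_natural)
next
  case (3 A x n) then show ?case by (rule tot_diff_square)
next
  case (4 A B x m y n) then show ?case by (rule tot_diff_leibniz)
next
  case 5 show ?case by (rule tot_diff_unit)
next
  case (6 A s n)
  interpret W: module k "tot n A" by (rule tot_module[OF 6])
  have V: "module k (part n p A)" for p by (rule obj_space[OF 6])
  note grp = module.axioms(2)[OF V]
  have z: "\<zero>\<^bsub>part n p A\<^esub> \<in> carrier (part n p A)" for p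
    by (rule abelian_groupE(2)[OF grp])
  show ?case
  proof (rule W.submoduleI)
    show "weight_fil s n A \<subseteq> carrier (tot n A)" by (auto simp: weight_fil_def)
    show "\<zero>\<^bsub>tot n A\<^esub> \<in> weight_fil s n A" by (rule weight_filI) (simp_all add: tot_zero)
    show add: "x \<oplus>\<^bsub>tot n A\<^esub> y \<in> weight_fil s n A" if "x \<in> weight_fil s n A" "y \<in> weight_fil s n A" for x y
      by (rule weight_filI)
        (use that[THEN weight_filD(1)] that[THEN weight_filD(2)] z abelian_groupE(5)[OF grp] in
          \<open>simp_all add: tot_add\<close>)
    show sm: "c \<odot>\<^bsub>tot n A\<^esub> x \<in> weight_fil s n A" if "c \<in> carrier k" "x \<in> weight_fil s n A" for c x
      by (rule weight_filI)
        (use that(1) weight_filD[OF that(2)] module.smult_r_null[OF V] in \<open>simp_all add: tot_smult\<close>)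
    show "\<ominus>\<^bsub>tot n A\<^esub> x \<in> weight_fil s n A" if "x \<in> weight_fil s n A" for x
      using sm[OF _ that, of "\<ominus>\<^bsub>k\<^esub> \<one>\<^bsub>k\<^esub>"] W.smult_l_minus[of "\<one>\<^bsub>k\<^esub>" x] weight_filD(1)[OF that] by simp
  qed
next
  case (7 A B f x s n)
  show ?case
    by (rule weight_filI)
      (use weight_filD[OF 7(4)] linear_map_closed[OF tot_mor_linear[OF 7(1-3)]]
        linear_map_zero[OF obj_space[OF 7(1)] obj_space[OF 7(2)] mor_linear[OF 7(1-3)]] in
        \<open>simp_all add: FMor_Tot\<close>)
next
  case (8 A s t x n) then show ?case by (force simp: weight_fil_def)
next
  case (9 A x n)
  show ?case
  proof (cases "tot_support C n A x = {}")
    case True then show ?thesis using 9 by (auto simp: weight_fil_def)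
  next
    case False
    then show ?thesis
      using 9 finite_support[OF 9(2)]
      \<comment> \<open>the least weight in the finite support\<close>
      by (intro exI[of _ "Min (w n ` tot_support C n A x)"]) (simp add: weight_fil_def)
  qed
next
  case (10 A B x s m y t n)
  note x = weight_filD[OF 10(3)] and y = weight_filD[OF 10(4)]
  show ?case
  proof (rule weight_filI[OF tot_prod_closed[OF 10(1,2) x(1) y(1)]])
    fix q assume q: "w (m + n) q < s + t"
    interpret W: module k "part (m + n) q (A \<boxtimes> B)" by (rule obj_space[OF tens_obj[OF 10(1,2)]])
    have "prod_term m n A B x y q p = \<zero>\<^bsub>part (m + n) q (A \<boxtimes> B)\<^esub>" for p
    proof (rule prod_term_zero[OF 10(1,2) x(1) y(1)])
      have "w m p < s \<or> w n (q - p) < t" using q w_add[of m n p "q - p"] by auto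
      then show "p \<notin> tot_support C m A x \<or> q - p \<notin> tot_support C n B y"
        using x(2) y(2) by (auto simp: tot_support_def)
    qed
    then show "FProd T m n A B x y q = \<zero>\<^bsub>part (m + n) q (A \<boxtimes> B)\<^esub>"
      unfolding FProd_Tot[OF 10(1,2) x(1) y(1) finite_support[OF x(1)] subset_refl]
      by (intro W.M.add.finprod_one_eqI)
  qed
next
  case 11
  have "w 0 0 = 0" using w_add[of 0 0 0 0] by simp
  then show ?case
    using graded_lax_functor.unit_mem[OF Tot_lax]
    by (intro weight_filI) (auto simp: FObj_Tot Tot_def)
next
  case (12 A x s n)
  note x = weight_filD[OF 12(2)]
  show ?case
  proof (rule weight_filI[OF linear_map_closed[OF tot_diff_linear[OF 12(1)] x(1)]])
    fix p assume p: "w (n + 1) p < s"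
    interpret V: module k "part (n + 1) p A" by (rule obj_space[OF 12(1)])
    have "w n p < s" "w n (p - 1) < s" using p w_dv[of n p] w_dh[of n "p - 1"] by auto
    then show "d n A x p = \<zero>\<^bsub>part (n + 1) p A\<^esub>"
      using x(2) linear_map_zero[OF obj_space[OF 12(1)] obj_space[OF 12(1)] dh_linear_into[OF 12(1), of p n]]
        linear_map_zero[OF obj_space[OF 12(1)] obj_space[OF 12(1)] dv_linear[OF 12(1), of p n]]
      by (simp add: tot_diff_def)
  qed
qed

theorem weight_bounded:
  assumes bounded: "\<And>A n. A \<in> Obj M \<Longrightarrow>
    \<exists>s. \<forall>p. s \<le> w n p \<longrightarrow> carrier (part n p A) = {\<zero>\<^bsub>part n p A\<^esub>}"
  shows "bounded_filtered_differential_functor k M T d weight_fil"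
proof (intro bounded_filtered_differential_functor.intro bounded_filtered_differential_functor_axioms.intro
    weight_filtered)
  interpret filtered_differential_functor k M T d weight_fil by (rule weight_filtered)
  fix A n assume A: "A \<in> Obj M"
  obtain s where s: "\<forall>p. s \<le> w n p \<longrightarrow> carrier (part n p A) = {\<zero>\<^bsub>part n p A\<^esub>}"
    using bounded[OF A] by blast
  have "x = \<zero>\<^bsub>tot n A\<^esub>" if "x \<in> weight_fil s n A" for x
  proof
    fix p
    show "x p = \<zero>\<^bsub>tot n A\<^esub> p"
      using s weight_filD[OF that] comp_closed[OF weight_filD(1)[OF that], of p]
      by (cases "s \<le> w n p") (auto simp: tot_zero)
  qed
  then have "weight_fil s n A = {\<zero>\<^bsub>FObj T n A\<^esub>}"
    using fil_zero[OF A, of n s] unfolding FObj_Tot by blast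
  then show "\<exists>s. weight_fil s n A = {\<zero>\<^bsub>FObj T n A\<^esub>}" ..
qed

end

theorem corollary1p27:
  fixes k :: "('k, 'r) ring_scheme"
    and M :: "('k, 'o, 'm, 'c) linear_moncat_scheme"
    and C :: "(int \<times> int, 'k, 'o, 'm, 'v) lax_functor"
    and dh dv :: "int \<times> int \<Rightarrow> 'o \<Rightarrow> 'v \<Rightarrow> 'v"
  defines "T \<equiv> Tot M C" and "d \<equiv> tot_diff C dh dv"
    and "col \<equiv> column_fil C" and "row \<equiv> row_fil C"
  assumes "linear_monoidal_abelian_category k M"
    and "bicomplex_lax_functor k M C dh dv"
  shows "functorial_mult_spectral_sequence k M 0
           (fil_page M T d col) (fil_diff T d col) (fil_iso T d col) \<and>
         functorial_mult_spectral_sequence k M 0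
           (fil_page M T d row) (fil_diff T d row) (fil_iso T d row) \<and>
         (column_bounded M C \<longrightarrow> converges_multiplicatively k M 0
           (fil_page M T d col) (fil_diff T d col) (fil_iso T d col)
           (cohomology M 1 T d) (cohomology_fil T d col)) \<and>
         (row_bounded M C \<longrightarrow> converges_multiplicatively k M 0
           (fil_page M T d row) (fil_diff T d row) (fil_iso T d row)
           (cohomology M 1 T d) (cohomology_fil T d row))"
proof -
  interpret B: bicomplex_lax_functor k M C dh dv by fact
  have B: "bicomplex_over_monoidal_category k M C dh dv"
    by (intro bicomplex_over_monoidal_category.intro assms(5,6) B.horizontal.graded_lax_functor_axioms)
  interpret col: weighted_bicomplex k M C dh dv "\<lambda>n p. p"
    by (intro weighted_bicomplex.intro B weighted_bicomplex_axioms.intro) simp_all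
  interpret row: weighted_bicomplex k M C dh dv "\<lambda>n p. n - p"
    by (intro weighted_bicomplex.intro B weighted_bicomplex_axioms.intro) simp_all
  have col: "col = col.weight_fil"
    by (intro ext) (simp add: col_def column_fil_def col.weight_fil_def)
  have row: "row = row.weight_fil"
    by (intro ext) (simp add: row_def row_fil_def row.weight_fil_def)
  interpret fcol: filtered_differential_functor k M T d col
    unfolding T_def d_def col by (rule col.weight_filtered)
  interpret frow: filtered_differential_functor k M T d row
    unfolding T_def d_def row by (rule row.weight_filtered)
  have "bounded_filtered_differential_functor k M T d col" if "column_bounded M C"
    unfolding T_def d_def col using that by (intro col.weight_bounded) (simp add: column_bounded_def)
  moreover have "bounded_filtered_differential_functor k M T d row" if rows: "row_bounded M C"
    unfolding T_def d_def row
  proof (rule row.weight_bounded)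
    fix A n assume "A \<in> Obj M"
    then obtain s where s: "\<forall>q\<ge>s. carrier (FObj C (n - q, q) A) = {\<zero>\<^bsub>FObj C (n - q, q) A\<^esub>}"
      using rows unfolding row_bounded_def by blast
    then show "\<exists>s. \<forall>p. s \<le> n - p \<longrightarrow> carrier (FObj C (p, n - p) A) = {\<zero>\<^bsub>FObj C (p, n - p) A\<^esub>}"
      using s[rule_format, of "n - p" for p] by (intro exI[of _ s]) simp
  qed
  ultimately show ?thesis
    by (intro conjI impI fcol.fil_spectral_sequence frow.fil_spectral_sequence
        bounded_filtered_differential_functor.fil_spectral_sequence_converges) simp_all
qed

end
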